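(* Each of the following occurs in the semigroup of Betti diagrams: (1) $B_{\mathrm{mod}}$ is not necessarily a saturated semigroup. (2) The set $B_{\mathbb N}\setminus B_{\mathrm{mod}}$ is not necessarily finite. (3) There exist rays of $B_{\mathbb N}$ which are missing at least $(\dim S-2)$ consecutive lattice points. (4) There exist rays of $B_{\mathbb N}$ where the points of $B_{\mathrm{mod}}$ are nonconsecutive lattice points.
   Context: Let $S=k[x_1,\dots,x_n]$ be the polynomial ring over any field $k$, with the standard grading. For a finitely generated graded $S$-module $M$ with minimal graded free resolution $0\to F_p\to\dots\to F_1\to F_0\to M\to 0$, where $F_i=\bigoplus_j S(-j)^{\beta_{i,j}(M)}$, the Betti diagram $\beta(M)$ is the vector with coordinates $\beta_{i,j}(M)$ in $\bigoplus_{j=-\infty}^{\infty}\bigoplus_{i=0}^p\mathbb Q$. A degree sequence is an integral sequence $d=(d_0,\dots,d_p)\in\mathbb N^{p+1}$ with $d_i<d_{i+1}$ for all $i$. Fix two degree sequences $\underline d,\overline d\in\mathbb N^{p+1}$ with $\underline d_i\le\overline d_i$ for all $i$. Let $\mathcal Z$ be the semigroup (under direct sum) of finitely generated graded $S$-modules $M$ of projective dimension $\le p$ such that $\beta_{i,j}(M)$ is nonzero only if $i\le p$ and $\underline d_i\le j\le\overline d_i$. The semigroup of Betti diagrams is $B_{\mathrm{mod}}=B_{\mathrm{mod}}(\underline d,\overline d)=\{\beta(M): M\in\mathcal Z\}$. The cone of Betti diagrams $B_{\mathbb Q}$ is the positive rational cone over $B_{\mathrm{mod}}$. The semigroup of virtual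 Betti diagrams $B_{\mathbb N}$ is the semigroup of lattice points (points with integer coordinates) in $B_{\mathbb Q}$. A ray of $B_{\mathbb N}$ means the set of lattice points on a half-line from the origin contained in $B_{\mathbb Q}$ (not necessarily an extremal ray of the cone). A lattice point of such a ray is missing if it does not belong to $B_{\mathrm{mod}}$. A semigroup $B$ of lattice points is saturated if every element $w$ of the group generated by $B$ with $mw\in B$ for some integer $m\ge 1$ lies in $B$. *)

theory Defs
  imports
    Complex_Main
    "HOL-Algebra.Module"
    "HOL-Library.Poly_Mapping"
    "HOL-Library.Function_Algebras"
    "HOL-Computational_Algebra.Group_Closure"
begin

section \<open>The graded polynomial ring\<close>

text \<open>The number \<open>n\<close> of variables has to be quantified inside a formula, so
  \<open>k[x\<^sub>1, ..., x\<^sub>n]\<close> is a \<^emph>\<open>carrier\<close> inside the ring of polynomials in the variables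
  indexed by \<open>nat\<close>: it consists of the polynomials using only the variables with index \<open>< n\<close>.\<close>

type_synonym monom = "nat \<Rightarrow>\<^sub>0 nat"
type_synonym 'k mpoly = "monom \<Rightarrow>\<^sub>0 'k"

definition poly_carrier :: "nat \<Rightarrow> 'k::field mpoly set" where
  "poly_carrier n = {f. \<forall>m \<in> Poly_Mapping.keys f. Poly_Mapping.keys m \<subseteq> {..<n}}"

definition poly_ring :: "nat \<Rightarrow> 'k::field mpoly ring" where
  "poly_ring n = \<lparr>carrier = poly_carrier n, mult = (*), one = 1, zero = 0, add = (+)\<rparr>"

definition monom_degree :: "monom \<Rightarrow> nat" where
  "monom_degree m = (\<Sum>x \<in> Poly_Mapping.keys m. Poly_Mapping.lookup m x)"

text \<open>Degrees are integers, since graded modules are graded by the integers; the part of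
  negative degree is \<open>{0}\<close>.\<close>

definition poly_homogeneous :: "nat \<Rightarrow> int \<Rightarrow> 'k::field mpoly set" where
  "poly_homogeneous n e =
    {f \<in> poly_carrier n. \<forall>m \<in> Poly_Mapping.keys f. int (monom_degree m) = e}"

definition irrelevant_ideal :: "nat \<Rightarrow> 'k::field mpoly set" where
  "irrelevant_ideal n = {f \<in> poly_carrier n. Poly_Mapping.lookup f 0 = 0}"


section \<open>Graded modules\<close>

text \<open>\<open>G d\<close> is the homogeneous part of degree \<open>d\<close>; the last conjunct says that the module is
  the direct sum of its homogeneous parts.\<close>

definition graded_module ::
    "nat \<Rightarrow> ('k::field mpoly, 'm) module \<Rightarrow> (int \<Rightarrow> 'm set) \<Rightarrow> bool" where
  "graded_module n M G \<longleftrightarrow>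
     module (poly_ring n) M \<and>
     (\<forall>d. subgroup (G d) (add_monoid M)) \<and>
     (\<forall>e d. \<forall>f \<in> poly_homogeneous n e. \<forall>x \<in> G d. f \<odot>\<^bsub>M\<^esub> x \<in> G (e + d)) \<and>
     (\<forall>x \<in> carrier M. \<exists>!c. (\<forall>d. c d \<in> G d) \<and> finite {d. c d \<noteq> \<zero>\<^bsub>M\<^esub>} \<and>
        x = (\<Oplus>\<^bsub>M\<^esub>d \<in> {d. c d \<noteq> \<zero>\<^bsub>M\<^esub>}. c d))"

definition finitely_generated :: "nat \<Rightarrow> ('k::field mpoly, 'm) module \<Rightarrow> bool" where
  "finitely_generated n M \<longleftrightarrow>
     (\<exists>A. finite A \<and> A \<subseteq> carrier M \<and>
        (\<forall>N. submodule N (poly_ring n) M \<and> A \<subseteq> N \<longrightarrow> N = carrier M))"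

text \<open>Homomorphisms of degree \<open>0\<close>.\<close>

definition graded_hom ::
    "nat \<Rightarrow> ('k::field mpoly, 'a) module \<Rightarrow> (int \<Rightarrow> 'a set) \<Rightarrow>
     ('k mpoly, 'b) module \<Rightarrow> (int \<Rightarrow> 'b set) \<Rightarrow> ('a \<Rightarrow> 'b) \<Rightarrow> bool" where
  "graded_hom n M G N H h \<longleftrightarrow>
     (\<forall>x \<in> carrier M. h x \<in> carrier N) \<and>
     (\<forall>x \<in> carrier M. \<forall>y \<in> carrier M. h (x \<oplus>\<^bsub>M\<^esub> y) = h x \<oplus>\<^bsub>N\<^esub> h y) \<and>
     (\<forall>f \<in> poly_carrier n. \<forall>x \<in> carrier M. h (f \<odot>\<^bsub>M\<^esub> x) = f \<odot>\<^bsub>N\<^esub> h x) \<and>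
     (\<forall>d. h ` G d \<subseteq> H d)"


section \<open>Graded free resolutions\<close>

text \<open>A list \<open>as = [a\<^sub>0, ..., a\<^sub>r]\<close> of integers stands for the graded free module
  \<open>S(-a\<^sub>0) \<oplus> ... \<oplus> S(-a\<^sub>r)\<close>, whose basis elements have degrees \<open>a\<^sub>0, ..., a\<^sub>r\<close>. Its elements are
  the vectors of polynomials, extended by \<open>0\<close>. The fields \<open>mult\<close> and \<open>one\<close> of the record play no
  role in a module.\<close>

definition free_module :: "nat \<Rightarrow> int list \<Rightarrow> ('k::field mpoly, nat \<Rightarrow> 'k mpoly) module" where
  "free_module n as =
     \<lparr>carrier = {v. (\<forall>t < length as. v t \<in> poly_carrier n) \<and> (\<forall>t \<ge> length as. v t = 0)},
      mult = undefined, one = undefined,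
      zero = (\<lambda>t. 0), add = (\<lambda>u v t. u t + v t), smult = (\<lambda>f v t. f * v t)\<rparr>"

definition free_grading :: "nat \<Rightarrow> int list \<Rightarrow> int \<Rightarrow> (nat \<Rightarrow> 'k::field mpoly) set" where
  "free_grading n as d =
     {v \<in> carrier (free_module n as). \<forall>t < length as. v t \<in> poly_homogeneous n (d - as ! t)}"

definition graded_free_resolution ::
    "nat \<Rightarrow> ('k::field mpoly, 'm) module \<Rightarrow> (int \<Rightarrow> 'm set) \<Rightarrow> (nat \<Rightarrow> int list) \<Rightarrow>
     (nat \<Rightarrow> (nat \<Rightarrow> 'k mpoly) \<Rightarrow> (nat \<Rightarrow> 'k mpoly)) \<Rightarrow> ((nat \<Rightarrow> 'k mpoly) \<Rightarrow> 'm) \<Rightarrow> bool" where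
  "graded_free_resolution n M G F \<phi> \<epsilon> \<longleftrightarrow>
     graded_hom n (free_module n (F 0)) (free_grading n (F 0)) M G \<epsilon> \<and>
     (\<forall>i. graded_hom n (free_module n (F (Suc i))) (free_grading n (F (Suc i)))
                       (free_module n (F i)) (free_grading n (F i)) (\<phi> i)) \<and>
     \<epsilon> ` carrier (free_module n (F 0)) = carrier M \<and>
     {v \<in> carrier (free_module n (F 0)). \<epsilon> v = \<zero>\<^bsub>M\<^esub>} = \<phi> 0 ` carrier (free_module n (F 1)) \<and>
     (\<forall>i. {v \<in> carrier (free_module n (F (Suc i))). \<phi> i v = (\<lambda>t. 0)} =
          \<phi> (Suc i) ` carrier (free_module n (F (Suc (Suc i)))))"

text \<open>Minimality: the differentials have image in \<open>\<mm> F\<^sub>i\<close>, where \<open>\<mm>\<close> is the irrelevant ideal.\<close>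

definition minimal_graded_free_resolution ::
    "nat \<Rightarrow> ('k::field mpoly, 'm) module \<Rightarrow> (int \<Rightarrow> 'm set) \<Rightarrow> (nat \<Rightarrow> int list) \<Rightarrow>
     (nat \<Rightarrow> (nat \<Rightarrow> 'k mpoly) \<Rightarrow> (nat \<Rightarrow> 'k mpoly)) \<Rightarrow> ((nat \<Rightarrow> 'k mpoly) \<Rightarrow> 'm) \<Rightarrow> bool" where
  "minimal_graded_free_resolution n M G F \<phi> \<epsilon> \<longleftrightarrow>
     graded_free_resolution n M G F \<phi> \<epsilon> \<and>
     (\<forall>i. \<forall>v \<in> carrier (free_module n (F (Suc i))). \<forall>t. \<phi> i v t \<in> irrelevant_ideal n)"

text \<open>A finitely generated graded projective module over the polynomial ring is graded free, so
  the projective dimension of a finitely generated graded module is measured by its (not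
  necessarily minimal) graded free resolutions.\<close>

definition projective_dimension_le ::
    "nat \<Rightarrow> ('k::field mpoly, 'm) module \<Rightarrow> (int \<Rightarrow> 'm set) \<Rightarrow> nat \<Rightarrow> bool" where
  "projective_dimension_le n M G p \<longleftrightarrow>
     (\<exists>F \<phi> \<epsilon>. graded_free_resolution n M G F \<phi> \<epsilon> \<and> (\<forall>i > p. F i = []))"


section \<open>Betti diagrams\<close>

text \<open>The entry \<open>b i j\<close> is the Betti number \<open>\<beta>\<^sub>i\<^sub>,\<^sub>j\<close>, the number of summands \<open>S(-j)\<close> of
  \<open>F\<^sub>i\<close>. The relation below is a function of the module, as minimal graded free
  resolutions are unique up to isomorphism.\<close>

type_synonym diagram = "nat \<Rightarrow> int \<Rightarrow> rat"

definition is_betti_diagram ::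
    "nat \<Rightarrow> ('k::field mpoly, 'm) module \<Rightarrow> (int \<Rightarrow> 'm set) \<Rightarrow> diagram \<Rightarrow> bool" where
  "is_betti_diagram n M G b \<longleftrightarrow>
     (\<exists>F \<phi> \<epsilon>. minimal_graded_free_resolution n M G F \<phi> \<epsilon> \<and>
        b = (\<lambda>i j. of_nat (count_list (F i) j)))"

text \<open>A sequence \<open>(d\<^sub>0, ..., d\<^sub>p)\<close> is a function of which only the values at \<open>0, ..., p\<close> matter.\<close>

definition degree_sequence :: "nat \<Rightarrow> (nat \<Rightarrow> nat) \<Rightarrow> bool" where
  "degree_sequence p d \<longleftrightarrow> (\<forall>i < p. d i < d (Suc i))"

definition degree_bounds :: "nat \<Rightarrow> (nat \<Rightarrow> nat) \<Rightarrow> (nat \<Rightarrow> nat) \<Rightarrow> bool" where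
  "degree_bounds p dl du \<longleftrightarrow>
     degree_sequence p dl \<and> degree_sequence p du \<and> (\<forall>i \<le> p. dl i \<le> du i)"

text \<open>The semigroup \<open>B\<^sub>m\<^sub>o\<^sub>d\<close>. The modules range over those with elements in
  \<open>(nat \<Rightarrow> 'k mpoly) set\<close>. This type contains the set of cosets of any submodule of a free module
  of finite rank, so every finitely generated module is isomorphic to one of these.\<close>

definition B_mod ::
    "'k::field itself \<Rightarrow> nat \<Rightarrow> nat \<Rightarrow> (nat \<Rightarrow> nat) \<Rightarrow> (nat \<Rightarrow> nat) \<Rightarrow> diagram set" where
  "B_mod K n p dl du =
     {b. \<exists>(M :: ('k mpoly, (nat \<Rightarrow> 'k mpoly) set) module) G.
          graded_module n M G \<and> finitely_generated n M \<and> projective_dimension_le n M G p \<and>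
          is_betti_diagram n M G b \<and>
          (\<forall>i j. b i j \<noteq> 0 \<longrightarrow> i \<le> p \<and> int (dl i) \<le> j \<and> j \<le> int (du i))}"

definition scale :: "rat \<Rightarrow> diagram \<Rightarrow> diagram" where
  "scale q v = (\<lambda>i j. q * v i j)"

definition rational_cone :: "diagram set \<Rightarrow> diagram set" where
  "rational_cone B =
     {v. \<exists>T c. finite T \<and> T \<subseteq> B \<and> (\<forall>t \<in> T. 0 \<le> c t) \<and> v = (\<Sum>t \<in> T. scale (c t) t)}"

definition lattice_points :: "diagram set" where
  "lattice_points = {v. \<forall>i j. v i j \<in> \<int>}"

definition B_Q ::
    "'k::field itself \<Rightarrow> nat \<Rightarrow> nat \<Rightarrow> (nat \<Rightarrow> nat) \<Rightarrow> (nat \<Rightarrow> nat) \<Rightarrow> diagram set" where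
  "B_Q K n p dl du = rational_cone (B_mod K n p dl du)"

definition B_N ::
    "'k::field itself \<Rightarrow> nat \<Rightarrow> nat \<Rightarrow> (nat \<Rightarrow> nat) \<Rightarrow> (nat \<Rightarrow> nat) \<Rightarrow> diagram set" where
  "B_N K n p dl du = B_Q K n p dl du \<inter> lattice_points"

definition saturated :: "diagram set \<Rightarrow> bool" where
  "saturated B \<longleftrightarrow>
     (\<forall>w \<in> group_closure B. (\<exists>m::nat. 1 \<le> m \<and> scale (of_nat m) w \<in> B) \<longrightarrow> w \<in> B)"


section \<open>Rays\<close>

definition half_line :: "diagram \<Rightarrow> diagram set" where
  "half_line v = {scale q v | q. 0 \<le> q}"

definition rays ::
    "'k::field itself \<Rightarrow> nat \<Rightarrow> nat \<Rightarrow> (nat \<Rightarrow> nat) \<Rightarrow> (nat \<Rightarrow> nat) \<Rightarrow> diagram set set" where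
  "rays K n p dl du =
     {half_line v \<inter> lattice_points | v. v \<noteq> 0 \<and> half_line v \<subseteq> B_Q K n p dl du}"

text \<open>\<open>D\<close> is the first nonzero lattice point of the ray \<open>R\<close>. Then \<open>0, D, 2D, 3D, ...\<close>
  are all the lattice points of \<open>R\<close>, listed consecutively.\<close>

definition ray_generator :: "diagram set \<Rightarrow> diagram \<Rightarrow> bool" where
  "ray_generator R D \<longleftrightarrow> D \<noteq> 0 \<and> R = range (\<lambda>m::nat. scale (of_nat m) D)"

end

theory Submission
  imports Defs "Jordan_Normal_Form.Determinant"
begin

text \<open>The diagrams in \<open>B_mod\<close> are the diagrams of minimal resolutions that are given by degree lists
  \<open>F q\<close> and homogeneous matrices \<open>G q\<close>, the module being the cokernel of \<open>G 0\<close>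
  (\<open>B_mod_iff\<close>). Membership is therefore shown by constructing resolutions, and non-membership by
  linear algebra on the homogeneous parts of a hypothetical one.

  \<^emph>\<open>Construction.\<close> Let \<open>K\<close> be a graded submodule of finite colength in the irrelevant part of a
  free module generated in degree \<open>0\<close>. Iterated minimal covers resolve it
  (\<open>minimal_resolution_exists\<close>): the generators of the \<open>q\<close>-th syzygy module sit in the degrees where
  the \<open>q\<close>-th Koszul homology of \<open>K\<close> does not vanish, so the resolution is finite and its degrees are
  bounded. Euler characteristics (\<open>syz_dim\<close>) then give the ranks.

  \<^emph>\<open>Missing multiples.\<close> Let \<open>K\<close> be generated by the coefficients of the product of
  \<open>x\<^sub>0 + x\<^sub>1 t + ... + x\<^sub>n\<^sub>-\<^sub>1 t\<^sup>n\<^sup>-\<^sup>1\<close> with a polynomial in \<open>t\<close> whose \<open>n - 1\<close> coefficients are the basis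
  vectors. By the Dedekind-Mertens lemma \<open>K\<close> contains everything of degree \<open>n - 1\<close>, and the
  resolution is pure with degrees \<open>0, 1, n, n + 1, ..., 2 n - 2\<close> (\<open>pure_resolution\<close>). Its Betti
  numbers are divisible by \<open>n - 1\<close>; the quotient \<open>D\<close> has the entries \<open>1\<close> and \<open>2\<close> in the first two
  columns. A module with diagram \<open>m D\<close> would be presented by an \<open>m\<close> by \<open>2 m\<close> matrix of linear forms.
  Cramer's rule gives such a matrix a syzygy in degree at most \<open>m + 1\<close> (\<open>wide_matrix_syzygy\<close>), while
  \<open>m D\<close> has none below degree \<open>n\<close>. Hence \<open>D, 2 D, ..., (n - 2) D\<close> are missing.

  \<^emph>\<open>No saturation, infinitely many holes.\<close> For \<open>n = 3\<close> the diagram \<open>w = D\<close> has one row and two linear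
  columns. Two linear columns with any syzygy are proportional over the fraction field, and then the
  entries of a row give a syzygy in degree \<open>2\<close>; so no diagram \<open>w + k \<beta>(S)\<close> belongs to
  \<open>B_mod\<close> (\<open>half_pure_not_in_B_mod\<close>), although \<open>2 w\<close> and \<open>\<beta>(S)\<close> do. Moreover
  \<open>w = 2 \<beta>(Y) - \<beta>(X)\<close> for \<open>X = S/\<mm>\<^sup>2\<close> and \<open>Y = S/(\<mm>\<^sup>2 + (x\<^sub>0))\<close>.

  \<^emph>\<open>A gap.\<close> Still for \<open>n = 3\<close>, let now \<open>D\<close> have the entries \<open>2\<close>; \<open>4, 3\<close>; \<open>3, 4\<close>; \<open>2\<close>. Then
  \<open>2 D\<close> is the diagram of the direct sum of \<open>X\<close> and its graded dual, so \<open>2 D\<close> and \<open>4 D\<close> belong to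
  \<open>B_mod\<close>. A module with diagram \<open>3 D\<close> has Hilbert function \<open>6, 6\<close> in degrees \<open>0\<close> and \<open>1\<close>, and its
  nine linear second syzygies form a space on which the three multiplications by variables between
  these six-dimensional spaces impose more conditions than they can satisfy: such a space has
  dimension at most eight (\<open>pencil_bound\<close>, \<open>linear_second_syzygies_bound\<close>).\<close>

section \<open>Finite-dimensional subspaces of a vector space\<close>

locale vspace = vector_space scale for scale :: "'k::field \<Rightarrow> 'b::ab_group_add \<Rightarrow> 'b"
begin

text \<open>The vectors of polynomials form an infinite-dimensional space, so dimensions are taken of
  subspaces inside a finite-dimensional one.\<close>

definition findim :: "'b set \<Rightarrow> bool" where
  "findim A \<longleftrightarrow> (\<exists>B. finite B \<and> A \<subseteq> local.span B)"

lemma findim_subset: "findim B \<Longrightarrow> A \<subseteq> B \<Longrightarrow> findim A"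
  unfolding findim_def by blast

lemma findim_independent_finite: "findim A \<Longrightarrow> B \<subseteq> A \<Longrightarrow> independent B \<Longrightarrow> finite B"
  unfolding findim_def using independent_span_bound by (meson subset_trans)

lemma basis_extension:
  assumes "local.subspace P" "local.subspace A" "P \<subseteq> A"
  obtains B C where "B \<subseteq> P" "B \<subseteq> C" "C \<subseteq> A" "independent B" "independent C"
    "P = local.span B" "A = local.span C"
proof -
  obtain B where B: "B \<subseteq> P" "independent B" "P \<subseteq> local.span B" by (metis basis_exists)
  have "B \<subseteq> A" using B(1) assms(3) by simp
  then obtain C where C: "B \<subseteq> C" "C \<subseteq> A" "independent C" "A \<subseteq> local.span C"
    using maximal_independent_subset_extend[of B A] B(2) by metis
  show thesis
    using that[of B C] B C span_minimal[OF B(1) assms(1)] span_minimal[OF C(2) assms(2)] by blast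
qed

lemma independent_span_Diff:
  assumes "independent C" "B \<subseteq> C" "x \<in> local.span B" "x \<in> local.span (C - B)"
  shows "x = 0"
proof -
  have "local.representation C x = local.representation B x" "local.representation C x = local.representation (C - B) x"
    using representation_extend[OF assms(1) assms(3) assms(2)]
      representation_extend[OF assms(1) assms(4)] by auto
  then have "local.representation C x b = 0" for b
    using representation_ne_zero[of B x b] representation_ne_zero[of "C - B" x b] by (metis DiffD2)
  moreover have "x \<in> local.span C" using assms(2,3) span_mono by blast
  ultimately show ?thesis
    using sum_nonzero_representation_eq[OF assms(1), of x] by simp
qed

lemma rank_nullity:
  assumes f: "Vector_Spaces.linear scale scale f" and A: "local.subspace A" "findim A"
  shows "local.dim A = local.dim (f ` A) + local.dim {a \<in> A. f a = 0}"
proof -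
  interpret f: Vector_Spaces.linear scale scale f by fact
  let ?K = "{a \<in> A. f a = 0}"
  have K: "local.subspace ?K" using A(1) by (auto simp: subspace_def f.add f.scale)
  obtain B C where BC: "B \<subseteq> ?K" "B \<subseteq> C" "C \<subseteq> A" "independent B" "independent C"
    "?K = local.span B" "A = local.span C"
    using basis_extension[OF K A(1)] by auto
  have fin: "finite C" using findim_independent_finite[OF A(2)] BC by blast
  have ind: "independent (C - B)" using BC(5) independent_mono by blast
  have inj: "inj_on f (local.span (C - B))"
  proof (subst f.inj_on_iff_eq_0, goal_cases)
    case 1 show ?case by simp
  next
    case 2 show ?case
    proof (intro ballI impI)
      fix x assume x: "x \<in> local.span (C - B)" "f x = 0"
      then have "x \<in> ?K" using BC(7) span_mono[of "C - B" C] by blast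
      then show "x = 0" using independent_span_Diff[OF BC(5,2)] x BC(6) by blast
    qed
  qed
  have "f ` A = local.span (f ` C)" using BC(7) f.span_image by simp
  also have "f ` C \<subseteq> local.span (f ` (C - B))"
  proof
    fix y assume "y \<in> f ` C"
    then obtain c where c: "c \<in> C" "y = f c" by blast
    show "y \<in> local.span (f ` (C - B))"
      using c BC(1) span_base span_zero by (cases "c \<in> B") auto
  qed
  then have "local.span (f ` C) = local.span (f ` (C - B))"
    using span_mono[of "f ` (C - B)" "f ` C"] span_minimal[OF _ subspace_span] by blast
  finally have "local.dim (f ` A) = card (f ` (C - B))"
    using dim_span_eq_card_independent[OF f.independent_injective_image[OF ind inj]] by simp
  also have "\<dots> = card (C - B)"
    using inj span_superset by (meson card_image inj_on_subset)
  also have "\<dots> = card C - card B" using fin BC(2) by (simp add: card_Diff_subset finite_subset)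
  finally have 1: "local.dim (f ` A) = card C - card B" .
  have 2: "local.dim A = card C" "local.dim ?K = card B"
    using BC dim_span_eq_card_independent by metis+
  show ?thesis unfolding 2 1 using card_mono[OF fin BC(2)] by simp
qed

text \<open>Such a projection stands for the quotient of \<open>A\<close> by \<open>P\<close>.\<close>

lemma projection_exists:
  assumes "local.subspace P" "local.subspace A" "P \<subseteq> A"
  obtains p where "Vector_Spaces.linear scale scale p" "\<And>a. a \<in> A \<Longrightarrow> p a = 0 \<longleftrightarrow> a \<in> P"
    "p ` A \<subseteq> A"
proof -
  interpret vector_space_pair scale scale ..
  obtain B C where BC: "B \<subseteq> P" "B \<subseteq> C" "C \<subseteq> A" "independent B" "independent C"
    "P = local.span B" "A = local.span C"
    using basis_extension[OF assms] by metis
  define p where "p = construct C (\<lambda>b. if b \<in> B then 0 else b)"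
  have lin: "Vector_Spaces.linear scale scale p"
    unfolding p_def by (rule linear_construct[OF BC(5)])
  interpret p: Vector_Spaces.linear scale scale p by fact
  have pB: "p y = 0" if "y \<in> local.span B" for y
  proof -
    have "p b = 0" if "b \<in> B" for b
      using that BC unfolding p_def by (subst construct_basis) auto
    then show ?thesis using p.eq_0_on_span[of B] that by blast
  qed
  have pC: "p z = z" if "z \<in> local.span (C - B)" for z
  proof (rule linear_eq_on[OF lin linear_id that, unfolded id_apply])
    show "p b = b" if "b \<in> C - B" for b
      using that BC unfolding p_def by (subst construct_basis) auto
  qed
  have split: "\<exists>y z. a = y + z \<and> y \<in> local.span B \<and> z \<in> local.span (C - B)" if "a \<in> A" for a
  proof -
    have "a \<in> local.span (B \<union> (C - B))" using that BC(2,7) by (simp add: Un_absorb1)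
    then show ?thesis unfolding span_Un by blast
  qed
  have "p a = 0 \<longleftrightarrow> a \<in> P" if aA: "a \<in> A" for a
  proof -
    obtain y z where yz: "a = y + z" "y \<in> local.span B" "z \<in> local.span (C - B)" using split[OF aA] by blast
    have pa: "p a = z" using yz pB pC by (simp add: p.add)
    show ?thesis
    proof
      assume "p a = 0" then show "a \<in> P" using pa yz BC(6) by simp
    next
      assume "a \<in> P" then show "p a = 0" using pB BC(6) by blast
    qed
  qed
  moreover have "p ` A \<subseteq> A"
  proof
    fix x assume "x \<in> p ` A"
    then obtain a where a: "a \<in> A" "x = p a" by blast
    obtain y z where yz: "a = y + z" "y \<in> local.span B" "z \<in> local.span (C - B)" using split[OF a(1)] by blast
    have "x = z" using yz pB pC a by (simp add: p.add)
    then show "x \<in> A" using yz(3) BC(7) span_mono[of "C - B" C] by blast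
  qed
  ultimately show thesis using that[OF lin] by blast
qed

lemma findim_image:
  assumes "Vector_Spaces.linear scale scale f" "findim A" shows "findim (f ` A)"
proof -
  interpret f: Vector_Spaces.linear scale scale f by fact
  obtain B where "finite B" "A \<subseteq> local.span B" using assms(2) findim_def by blast
  then have "finite (f ` B)" "f ` A \<subseteq> local.span (f ` B)" using f.span_image by auto
  then show ?thesis unfolding findim_def by blast
qed

lemma dim_add:
  assumes "local.subspace P" "findim P" "local.subspace Q" "findim Q"
  shows "local.dim {x + y |x y. x \<in> P \<and> y \<in> Q} + local.dim (P \<inter> Q) = local.dim P + local.dim Q"
    and "findim {x + y |x y. x \<in> P \<and> y \<in> Q}"
proof -
  let ?S = "{x + y |x y. x \<in> P \<and> y \<in> Q}"
  have S: "local.subspace ?S" by (rule subspace_sums[OF assms(1,3)])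
  obtain B B' where "finite B" "P \<subseteq> local.span B" "finite B'" "Q \<subseteq> local.span B'"
    using assms unfolding findim_def by blast
  then have "finite (B \<union> B')" "?S \<subseteq> local.span (B \<union> B')" unfolding span_Un by auto
  then show fS: "findim ?S" unfolding findim_def by blast
  have PS: "P \<subseteq> ?S" using subspace_0[OF assms(3)] by force
  have QS: "Q \<subseteq> ?S" using subspace_0[OF assms(1)] by force
  obtain p where p: "Vector_Spaces.linear scale scale p" "\<And>a. a \<in> ?S \<Longrightarrow> p a = 0 \<longleftrightarrow> a \<in> P" "p ` ?S \<subseteq> ?S"
    by (rule projection_exists[OF assms(1) S PS]) (rule that)
  interpret p: Vector_Spaces.linear scale scale p by fact
  have im: "p ` ?S = p ` Q"
  proof
    show "p ` ?S \<subseteq> p ` Q"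
    proof
      fix z assume "z \<in> p ` ?S"
      then obtain x y where xy: "x \<in> P" "y \<in> Q" "z = p (x + y)" by auto
      have "p x = 0" using p(2)[of x] PS xy by blast
      then show "z \<in> p ` Q" using xy by (auto simp: p.add)
    qed
  qed (use QS in blast)
  have "{a \<in> ?S. p a = 0} = P" using p(2) PS by blast
  then have 1: "local.dim ?S = local.dim (p ` Q) + local.dim P"
    using rank_nullity[OF p(1) S fS] im by simp
  have "{a \<in> Q. p a = 0} = P \<inter> Q" using p(2) QS by blast
  then have 2: "local.dim Q = local.dim (p ` Q) + local.dim (P \<inter> Q)"
    using rank_nullity[OF p(1) assms(3,4)] by simp
  show "local.dim ?S + local.dim (P \<inter> Q) = local.dim P + local.dim Q" using 1 2 by simp
qed

lemma findim_dim_mono: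
  assumes "findim A" "B \<subseteq> A" shows "local.dim B \<le> local.dim A"
proof -
  obtain C where C: "C \<subseteq> A" "independent C" "A \<subseteq> local.span C" "card C = local.dim A" by (metis basis_exists)
  have "finite C" using findim_independent_finite[OF assms(1) C(1,2)] .
  then show ?thesis using dim_le_card[of B C] assms C by auto
qed

lemma findim_dim_eq:
  assumes "findim A" "local.subspace A" "local.subspace B" "B \<subseteq> A" "local.dim A \<le> local.dim B" shows "B = A"
proof -
  obtain P C where PC: "P \<subseteq> B" "P \<subseteq> C" "C \<subseteq> A" "independent P" "independent C" "B = local.span P" "A = local.span C"
    using basis_extension[OF assms(3,2,4)] by metis
  have "finite C" using findim_independent_finite[OF assms(1) PC(3,5)] .
  moreover have "card C \<le> card P"
    using assms(5) PC dim_span_eq_card_independent by metis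
  ultimately have "P = C" using PC(2) by (metis card_subset_eq card_mono le_antisym)
  then show ?thesis using PC by simp
qed

lemma dim_eq_0_iff:
  assumes "findim A" "local.subspace A" shows "local.dim A = 0 \<longleftrightarrow> A = {0}"
proof
  assume "local.dim A = 0"
  moreover have "{0} \<subseteq> A" using assms(2) subspace_0 by blast
  ultimately show "A = {0}" using findim_dim_eq[OF assms subspace_single_0] by simp
next
  have "local.dim {0} = 0" using dim_le_card[of "{0}" "{}"] by simp
  then show "A = {0} \<Longrightarrow> local.dim A = 0" by simp
qed

end

section \<open>Monomials, homogeneous parts and division by a variable\<close>

abbreviation lk :: "('a \<Rightarrow>\<^sub>0 'b::zero) \<Rightarrow> 'a \<Rightarrow> 'b" where "lk \<equiv> Poly_Mapping.lookup"

definition X :: "nat \<Rightarrow> 'k::field mpoly" where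
  "X l = Poly_Mapping.single (Poly_Mapping.single l 1) 1"

definition Con :: "'k::field \<Rightarrow> 'k mpoly" where
  "Con c = Poly_Mapping.single 0 c"

lemma lk_single_mult:
  fixes f :: "'k::field mpoly"
  shows "lk (Poly_Mapping.single a c * f) (a + m) = c * lk f m"
    and "(\<And>t. k \<noteq> a + t) \<Longrightarrow> lk (Poly_Mapping.single a c * f) k = 0"
proof -
  have *: "lk (Poly_Mapping.single a c * f) k = c * (\<Sum>t. lk f t when k = a + t)" for k
  proof -
    have "lk (Poly_Mapping.single a c * f) k
        = (\<Sum>q. (c * (\<Sum>t. lk f t when k = q + t)) when a = q)"
      unfolding lookup_mult lookup_single
      by (rule arg_cong[where f = Sum_any]) (auto simp: when_def)
    then show ?thesis by simp
  qed
  have "(\<Sum>t. lk f t when a + m = a + t) = lk f m"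
    by (simp add: eq_commute[of m])
  then show "lk (Poly_Mapping.single a c * f) (a + m) = c * lk f m" unfolding * by simp
  show "(\<And>t. k \<noteq> a + t) \<Longrightarrow> lk (Poly_Mapping.single a c * f) k = 0" unfolding * by simp
qed

lemma lk_Con_mult [simp]: "lk (Con c * f) m = c * lk f m"
  using lk_single_mult(1)[of 0 c f m] by (simp add: Con_def)

lemma lk_Con: "lk (Con c) m = (if m = 0 then c else 0)"
  by (simp add: Con_def lookup_single when_def)

lemma Con_simps [simp]: "Con 0 = 0" "Con 1 = 1" "Con (a + b) = Con a + Con b"
    "Con (a * b) = Con a * Con b" "Con (- a) = - Con a"
  by (auto simp: Con_def single_add single_uminus mult_single)

lemma lk_X_mult: "lk (X l * f) m = (if lk m l = 0 then 0 else lk f (m - Poly_Mapping.single l 1))"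
proof (cases "lk m l = 0")
  case True
  have "m \<noteq> Poly_Mapping.single l 1 + t" for t
    using True by (metis add_is_0 lookup_add lookup_single_eq zero_neq_one)
  then show ?thesis using True unfolding X_def by (simp add: lk_single_mult(2))
next
  case False
  have "m = Poly_Mapping.single l 1 + (m - Poly_Mapping.single l 1)"
    using False by (intro poly_mapping_eqI) (auto simp: lookup_add lookup_minus lookup_single when_def)
  then show ?thesis using False lk_single_mult(1)[of "Poly_Mapping.single l 1" 1 f "m - Poly_Mapping.single l 1"]
    unfolding X_def by simp
qed

lemma monom_degree_superset:
  "finite A \<Longrightarrow> Poly_Mapping.keys m \<subseteq> A \<Longrightarrow> monom_degree m = (\<Sum>x\<in>A. lk m x)"
  unfolding monom_degree_def by (rule sum.mono_neutral_left) (auto simp: in_keys_iff)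

lemma keys_plus: "Poly_Mapping.keys (a + b :: monom) = Poly_Mapping.keys a \<union> Poly_Mapping.keys b"
  by (auto simp: in_keys_iff lookup_add)

lemma monom_degree_plus [simp]: "monom_degree (a + b) = monom_degree a + monom_degree b"
  using monom_degree_superset[of "Poly_Mapping.keys a \<union> Poly_Mapping.keys b"]
  by (simp add: keys_plus lookup_add sum.distrib)

lemma monom_degree_single [simp]: "monom_degree (Poly_Mapping.single l k) = k"
  by (cases "k = 0") (auto simp: monom_degree_def)

lemma monom_degree_0_iff: "monom_degree m = 0 \<longleftrightarrow> m = 0"
  by (auto simp: monom_degree_def in_keys_iff intro!: poly_mapping_eqI)

lemma poly_carrier_iff: "f \<in> poly_carrier n \<longleftrightarrow> (\<forall>m. lk f m \<noteq> 0 \<longrightarrow> Poly_Mapping.keys m \<subseteq> {..<n})"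
  by (auto simp: poly_carrier_def in_keys_iff)

lemma poly_homogeneous_iff: "f \<in> poly_homogeneous n e \<longleftrightarrow>
    (\<forall>m. lk f m \<noteq> 0 \<longrightarrow> Poly_Mapping.keys m \<subseteq> {..<n} \<and> int (monom_degree m) = e)"
  by (auto simp: poly_homogeneous_def poly_carrier_iff in_keys_iff)

lemma poly_carrier_closed [simp, intro]:
  "0 \<in> poly_carrier n" "1 \<in> poly_carrier n" "Con c \<in> poly_carrier n"
  "f \<in> poly_carrier n \<Longrightarrow> g \<in> poly_carrier n \<Longrightarrow> f + g \<in> poly_carrier n"
  "f \<in> poly_carrier n \<Longrightarrow> g \<in> poly_carrier n \<Longrightarrow> f - g \<in> poly_carrier n"
  "f \<in> poly_carrier n \<Longrightarrow> - f \<in> poly_carrier n"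
  "f \<in> poly_carrier n \<Longrightarrow> g \<in> poly_carrier n \<Longrightarrow> f * g \<in> poly_carrier n"
  "l < n \<Longrightarrow> X l \<in> poly_carrier n"
proof -
  show "f + g \<in> poly_carrier n" if "f \<in> poly_carrier n" "g \<in> poly_carrier n"
    using that keys_add[of f g] unfolding poly_carrier_def by blast
  show "f - g \<in> poly_carrier n" if "f \<in> poly_carrier n" "g \<in> poly_carrier n"
    using that unfolding poly_carrier_iff by (auto simp: lookup_minus) (metis diff_zero diff_self subsetD lessThan_iff)
  show "f * g \<in> poly_carrier n" if "f \<in> poly_carrier n" "g \<in> poly_carrier n"
    using that keys_mult[of f g] unfolding poly_carrier_def by (fastforce simp: keys_plus)
qed (auto simp: poly_carrier_iff lookup_one Con_def X_def lookup_single when_def split: if_splits)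

lemma poly_carrier_sum [intro]: "(\<And>i. i \<in> A \<Longrightarrow> f i \<in> poly_carrier n) \<Longrightarrow> sum f A \<in> poly_carrier n"
  by (induction A rule: infinite_finite_induct) auto

lemma poly_homogeneous_carrier: "f \<in> poly_homogeneous n e \<Longrightarrow> f \<in> poly_carrier n"
  by (simp add: poly_homogeneous_def)

lemma poly_homogeneous_closed [simp, intro]:
  "0 \<in> poly_homogeneous n e" "1 \<in> poly_homogeneous n 0" "Con c \<in> poly_homogeneous n 0"
  "f \<in> poly_homogeneous n e \<Longrightarrow> g \<in> poly_homogeneous n e \<Longrightarrow> f + g \<in> poly_homogeneous n e"
  "f \<in> poly_homogeneous n e \<Longrightarrow> g \<in> poly_homogeneous n e \<Longrightarrow> f - g \<in> poly_homogeneous n e"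
  "f \<in> poly_homogeneous n e \<Longrightarrow> - f \<in> poly_homogeneous n e"
  "l < n \<Longrightarrow> X l \<in> poly_homogeneous n 1"
proof -
  show "f + g \<in> poly_homogeneous n e" if "f \<in> poly_homogeneous n e" "g \<in> poly_homogeneous n e"
    using that keys_add[of f g] unfolding poly_homogeneous_def by blast
  show "f - g \<in> poly_homogeneous n e" if "f \<in> poly_homogeneous n e" "g \<in> poly_homogeneous n e"
    using that unfolding poly_homogeneous_iff by (auto simp: lookup_minus) (metis diff_zero diff_self subsetD lessThan_iff)+
qed (auto simp: poly_homogeneous_iff lookup_one Con_def X_def lookup_single when_def monom_degree_def split: if_splits)

lemma poly_homogeneous_mult [intro]:
  assumes "f \<in> poly_homogeneous n d" "g \<in> poly_homogeneous n e" "d + e = c"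
  shows "f * g \<in> poly_homogeneous n c"
proof -
  have "f * g \<in> poly_carrier n" using assms by (simp add: poly_homogeneous_def)
  moreover have "int (monom_degree m) = c" if "m \<in> Poly_Mapping.keys (f * g)" for m
  proof -
    have "m \<in> {a + b |a b. a \<in> Poly_Mapping.keys f \<and> b \<in> Poly_Mapping.keys g}"
      using keys_mult[of f g] that by (rule subsetD)
    then obtain a b where ab: "m = a + b" "a \<in> Poly_Mapping.keys f" "b \<in> Poly_Mapping.keys g" by blast
    then have "int (monom_degree a) = d" "int (monom_degree b) = e"
      using assms(1,2) by (auto simp: poly_homogeneous_def)
    then show ?thesis using ab(1) assms(3) by simp
  qed
  ultimately show ?thesis by (simp add: poly_homogeneous_def)
qed

lemma poly_homogeneous_sum [intro]:
  "(\<And>i. i \<in> A \<Longrightarrow> f i \<in> poly_homogeneous n e) \<Longrightarrow> sum f A \<in> poly_homogeneous n e"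
  by (induction A rule: infinite_finite_induct) auto

lemma poly_homogeneous_neg: "f \<in> poly_homogeneous n e \<Longrightarrow> e < 0 \<Longrightarrow> f = 0"
  by (rule poly_mapping_eqI) (auto simp: poly_homogeneous_iff)

lemma poly_homogeneous_0D: "f \<in> poly_homogeneous n 0 \<Longrightarrow> f = Con (lk f 0)"
  by (rule poly_mapping_eqI) (auto simp: poly_homogeneous_iff lk_Con monom_degree_0_iff)

lemma ex_lk_nonzero: "f \<noteq> 0 \<Longrightarrow> \<exists>m. lk f m \<noteq> 0"
  using poly_mapping_eqI[of f 0] by fastforce

definition hpart :: "int \<Rightarrow> 'k::field mpoly \<Rightarrow> 'k mpoly" where
  "hpart d f = Abs_poly_mapping (\<lambda>m. if int (monom_degree m) = d then lk f m else 0)"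

lemma lk_restrict:
  "lk (Abs_poly_mapping (\<lambda>m. if P m then lk (f :: 'k::field mpoly) m else 0))
     = (\<lambda>m. if P m then lk f m else 0)"
  by (rule lookup_Abs_poly_mapping) (rule finite_subset[OF _ finite_lookup[of f]], auto)

lemma lk_hpart: "lk (hpart d f) m = (if int (monom_degree m) = d then lk f m else 0)"
  unfolding hpart_def lk_restrict by simp

lemma hpart_add [simp]: "hpart d (f + g) = hpart d f + hpart d g"
  by (rule poly_mapping_eqI) (simp add: lk_hpart lookup_add)

lemma hpart_0 [simp]: "hpart d 0 = 0"
  by (rule poly_mapping_eqI) (simp add: lk_hpart)

lemma hpart_sum: "hpart d (sum f A) = (\<Sum>i\<in>A. hpart d (f i))"
  by (induction A rule: infinite_finite_induct) auto

lemma hpart_homogeneous [intro]: "f \<in> poly_carrier n \<Longrightarrow> hpart d f \<in> poly_homogeneous n d"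
  by (auto simp: poly_homogeneous_iff poly_carrier_iff lk_hpart split: if_splits)

lemma hpart_of_homogeneous: "f \<in> poly_homogeneous n e \<Longrightarrow> hpart d f = (if d = e then f else 0)"
  by (rule poly_mapping_eqI) (auto simp: lk_hpart poly_homogeneous_iff)

lemma hpart_decomp:
  assumes "finite D" "\<And>m. lk f m \<noteq> 0 \<Longrightarrow> int (monom_degree m) \<in> D"
  shows "(\<Sum>d\<in>D. hpart d f) = f"
proof (rule poly_mapping_eqI)
  fix m
  have "lk (\<Sum>d\<in>D. hpart d f) m = (\<Sum>d\<in>D. if d = int (monom_degree m) then lk f m else 0)"
    by (simp add: lookup_sum lk_hpart eq_commute)
  also have "\<dots> = (if int (monom_degree m) \<in> D then lk f m else 0)"
    using assms(1) by simp
  finally show "lk (\<Sum>d\<in>D. hpart d f) m = lk f m" using assms(2)[of m] by auto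
qed

lemma hpart_support_finite: "finite {d. hpart d f \<noteq> 0}"
proof (rule finite_subset)
  show "{d. hpart d f \<noteq> 0} \<subseteq> (\<lambda>m. int (monom_degree m)) ` Poly_Mapping.keys f"
  proof
    fix d assume "d \<in> {d. hpart d f \<noteq> 0}"
    then obtain m where "lk (hpart d f) m \<noteq> 0" using ex_lk_nonzero by blast
    then show "d \<in> (\<lambda>m. int (monom_degree m)) ` Poly_Mapping.keys f"
      by (auto simp: lk_hpart in_keys_iff split: if_splits)
  qed
qed simp

lemma hpart_decomp_support: "finite D \<Longrightarrow> {d. hpart d f \<noteq> 0} \<subseteq> D \<Longrightarrow> (\<Sum>d\<in>D. hpart d f) = f"
proof (rule hpart_decomp)
  fix m assume *: "{d. hpart d f \<noteq> 0} \<subseteq> D" "lk f m \<noteq> 0"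
  then have "lk (hpart (int (monom_degree m)) f) m \<noteq> 0" by (simp add: lk_hpart)
  then have "hpart (int (monom_degree m)) f \<noteq> 0" by auto
  then show "int (monom_degree m) \<in> D" using * by blast
qed

lemma hpart_mult:
  assumes f: "f \<in> poly_carrier n" and g: "g \<in> poly_homogeneous n e"
  shows "hpart d (f * g) = hpart (d - e) f * g"
proof -
  let ?D = "insert (d - e) {d. hpart d f \<noteq> 0}"
  have fin: "finite ?D" using hpart_support_finite by blast
  have "(\<Sum>c\<in>?D. hpart c f) = f" by (rule hpart_decomp_support[OF fin]) blast
  then have "f * g = (\<Sum>c\<in>?D. hpart c f * g)" by (simp only: sum_distrib_right[symmetric])
  then have "hpart d (f * g) = (\<Sum>c\<in>?D. hpart d (hpart c f * g))" by (simp only: hpart_sum)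
  also have "\<dots> = (\<Sum>c\<in>?D. if c = d - e then hpart c f * g else 0)"
  proof (rule sum.cong[OF refl])
    fix c show "hpart d (hpart c f * g) = (if c = d - e then hpart c f * g else 0)"
      using hpart_of_homogeneous[OF poly_homogeneous_mult[OF hpart_homogeneous[OF f, of c] g refl], of d]
      by auto
  qed
  also have "\<dots> = hpart (d - e) f * g" using fin by (simp only: sum.delta) simp
  finally show ?thesis .
qed

text \<open>\<open>tailpart p f\<close> collects the terms of \<open>f\<close> without variables of index \<open>< p\<close>, and \<open>dvar p f\<close> is the
  quotient by \<open>x\<^sub>p\<close> of the terms of \<open>f\<close> whose first variable is \<open>x\<^sub>p\<close>. Together they express that
  every monomial other than \<open>1\<close> is divided by its first variable; this is the contraction that makes
  the Koszul complex exact over every field.\<close>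

definition tailpart :: "nat \<Rightarrow> 'k::field mpoly \<Rightarrow> 'k mpoly" where
  "tailpart p f = Abs_poly_mapping (\<lambda>m. if Poly_Mapping.keys m \<subseteq> {p..} then lk f m else 0)"

definition dvar :: "nat \<Rightarrow> 'k::field mpoly \<Rightarrow> 'k mpoly" where
  "dvar p f = Abs_poly_mapping
     (\<lambda>m. if Poly_Mapping.keys m \<subseteq> {p..} then lk f (m + Poly_Mapping.single p 1) else 0)"

lemma lk_tailpart: "lk (tailpart p f) m = (if Poly_Mapping.keys m \<subseteq> {p..} then lk f m else 0)"
  unfolding tailpart_def lk_restrict by simp

lemma lk_dvar:
  "lk (dvar p f) m = (if Poly_Mapping.keys m \<subseteq> {p..} then lk f (m + Poly_Mapping.single p 1) else 0)"
proof -
  have "finite {m. lk f (m + Poly_Mapping.single p 1) \<noteq> 0}"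
    using finite_vimageI[OF finite_lookup[of f], of "\<lambda>m. m + Poly_Mapping.single p 1"]
    by (simp add: vimage_def inj_def)
  then have "finite {m. (if Poly_Mapping.keys m \<subseteq> {p..} then lk f (m + Poly_Mapping.single p 1) else 0) \<noteq> 0}"
    by (rule finite_subset[rotated]) auto
  then show ?thesis unfolding dvar_def by (subst lookup_Abs_poly_mapping) auto
qed

lemma dvar_add [simp]: "dvar p (f + g) = dvar p f + dvar p g"
  by (rule poly_mapping_eqI) (simp add: lk_dvar lookup_add)

lemma dvar_0 [simp]: "dvar p 0 = 0"
  by (rule poly_mapping_eqI) (simp add: lk_dvar)

lemma dvar_sum: "dvar p (sum f A) = (\<Sum>i\<in>A. dvar p (f i))"
  by (induction A rule: infinite_finite_induct) auto

lemma dvar_Con_mult: "dvar p (Con c * f) = Con c * dvar p f"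
  by (rule poly_mapping_eqI) (simp add: lk_dvar)

lemma tailpart_0 [simp]: "tailpart 0 f = f"
  by (rule poly_mapping_eqI) (auto simp: lk_tailpart)

lemma lk_single_ne: "p \<noteq> l \<Longrightarrow> lk (Poly_Mapping.single p a) l = (0::nat)"
  by (simp add: lookup_single when_def)

lemma keys_minus_single:
  "Poly_Mapping.keys (m - Poly_Mapping.single l 1 :: monom) \<subseteq> Poly_Mapping.keys m"
  by (auto simp: in_keys_iff lookup_minus)

lemma tailpart_step: "tailpart p f = X p * dvar p f + tailpart (Suc p) f"
proof (rule poly_mapping_eqI)
  fix m
  let ?s = "Poly_Mapping.single p (1::nat)"
  show "lk (tailpart p f) m = lk (X p * dvar p f + tailpart (Suc p) f) m"
  proof (cases "lk m p = 0")
    case True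
    then have "Poly_Mapping.keys m \<subseteq> {p..} \<longleftrightarrow> Poly_Mapping.keys m \<subseteq> {Suc p..}"
      by (auto simp: in_keys_iff subset_iff Suc_le_eq) (metis le_neq_implies_less gr_implies_not0, metis less_imp_le)
    then show ?thesis using True by (simp add: lookup_add lk_X_mult lk_tailpart)
  next
    case False
    have eq: "m - ?s + ?s = m"
      using False by (intro poly_mapping_eqI) (auto simp: lookup_add lookup_minus lookup_single when_def)
    have k: "Poly_Mapping.keys m = insert p (Poly_Mapping.keys (m - ?s))"
      using keys_plus[of "m - ?s" ?s] unfolding eq by simp
    have "\<not> Poly_Mapping.keys m \<subseteq> {Suc p..}" unfolding k by simp
    then show ?thesis using False by (simp add: lookup_add lk_X_mult lk_tailpart lk_dvar eq[simplified] k)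
  qed
qed

lemma tailpart_expand: "f = (\<Sum>l<p. X l * dvar l f) + tailpart p f"
  by (induction p) (simp, metis (no_types, lifting) add.assoc sum.lessThan_Suc tailpart_step)

lemma tailpart_n: "f \<in> poly_carrier n \<Longrightarrow> tailpart n f = Con (lk f 0)"
proof (rule poly_mapping_eqI)
  fix m assume f: "f \<in> poly_carrier n"
  show "lk (tailpart n f) m = lk (Con (lk f 0)) m"
  proof (cases "m = 0")
    case False
    then obtain x where "x \<in> Poly_Mapping.keys m" by fastforce
    then show ?thesis using f False by (auto simp: lk_tailpart lk_Con poly_carrier_iff subset_iff) (metis leD)
  qed (simp add: lk_tailpart lk_Con)
qed

lemma var_expand: "f \<in> poly_carrier n \<Longrightarrow> f = (\<Sum>l<n. X l * dvar l f) + Con (lk f 0)"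
  using tailpart_expand[of f n] tailpart_n[of f n] by simp

lemma dvar_X_gt: "p < l \<Longrightarrow> dvar p (X l * f) = X l * dvar p f"
proof (rule poly_mapping_eqI)
  fix m assume pl: "p < l"
  let ?s = "Poly_Mapping.single p (1::nat)" and ?t = "Poly_Mapping.single l (1::nat)"
  show "lk (dvar p (X l * f)) m = lk (X l * dvar p f) m"
  proof (cases "lk m l = 0")
    case True
    then show ?thesis using pl by (simp add: lk_dvar lk_X_mult lookup_add lk_single_ne)
  next
    case False
    have eq: "m + ?s - ?t = m - ?t + ?s"
      using False pl by (intro poly_mapping_eqI) (auto simp: lookup_add lookup_minus lookup_single when_def)
    have "Poly_Mapping.keys m \<subseteq> {p..} \<longleftrightarrow> Poly_Mapping.keys (m - ?t) \<subseteq> {p..}"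
    proof
      assume *: "Poly_Mapping.keys (m - ?t) \<subseteq> {p..}"
      show "Poly_Mapping.keys m \<subseteq> {p..}"
      proof
        fix x assume x: "x \<in> Poly_Mapping.keys m"
        show "x \<in> {p..}"
          using * x pl by (cases "x = l") (auto simp: in_keys_iff lookup_minus lk_single_ne subset_iff)
      qed
    qed (use keys_minus_single in blast)
    then show ?thesis using False pl eq by (simp add: lk_dvar lk_X_mult lookup_add lk_single_ne)
  qed
qed

lemma dvar_X_lt: "l < p \<Longrightarrow> dvar p (X l * f) = 0"
proof (rule poly_mapping_eqI)
  fix m assume lp: "l < p"
  show "lk (dvar p (X l * f)) m = lk 0 m"
  proof (cases "Poly_Mapping.keys m \<subseteq> {p..}")
    case True
    then have "lk m l = 0" using lp by (auto simp: in_keys_iff subset_iff) 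
    then show ?thesis using lp by (simp add: lk_dvar lk_X_mult lookup_add lk_single_ne)
  qed (simp add: lk_dvar)
qed

lemma dvar_X_same: "dvar p (X p * f) = tailpart p f"
  by (rule poly_mapping_eqI) (simp add: lk_dvar lk_X_mult lk_tailpart lookup_add)

lemma dvar_homogeneous [intro]:
  assumes "f \<in> poly_homogeneous n e" shows "dvar p f \<in> poly_homogeneous n (e - 1)"
proof -
  have "Poly_Mapping.keys m \<subseteq> {..<n} \<and> int (monom_degree m) = e - 1" if "lk (dvar p f) m \<noteq> 0" for m
  proof -
    have "lk f (m + Poly_Mapping.single p 1) \<noteq> 0" using that by (auto simp: lk_dvar split: if_splits)
    then have "Poly_Mapping.keys (m + Poly_Mapping.single p 1) \<subseteq> {..<n}"
      "int (monom_degree (m + Poly_Mapping.single p 1)) = e"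
      using assms by (auto simp: poly_homogeneous_iff)
    then show ?thesis by (auto simp: keys_plus)
  qed
  then show ?thesis by (simp add: poly_homogeneous_iff)
qed

lemma irrelevant_iff: "f \<in> irrelevant_ideal n \<longleftrightarrow> f \<in> poly_carrier n \<and> lk f 0 = 0"
  by (simp add: irrelevant_ideal_def)

lemma homogeneous_irrelevant: "f \<in> poly_homogeneous n e \<Longrightarrow> e \<noteq> 0 \<Longrightarrow> f \<in> irrelevant_ideal n"
  by (auto simp: poly_homogeneous_iff poly_carrier_iff irrelevant_iff monom_degree_def)

lemma lk_mult_0: fixes f g :: "'k::field mpoly" shows "lk (f * g) 0 = lk f 0 * lk g 0"
proof -
  have [simp]: "0 = a + b \<longleftrightarrow> a = 0 \<and> b = 0" for a b :: monom
    by (metis add_is_0 monom_degree_0_iff monom_degree_plus)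
  have *: "lk f q * (\<Sum>t. lk g t when 0 = q + t) = (lk f 0 * lk g 0 when q = 0)" for q
    by (cases "q = 0") auto
  show ?thesis unfolding lookup_mult * by simp
qed

lemma irrelevant_mult: "f \<in> irrelevant_ideal n \<Longrightarrow> g \<in> poly_carrier n \<Longrightarrow> g * f \<in> irrelevant_ideal n"
  by (auto simp: irrelevant_iff lk_mult_0)

lemma irrelevant_sum: "(\<And>i. i \<in> A \<Longrightarrow> f i \<in> irrelevant_ideal n) \<Longrightarrow> sum f A \<in> irrelevant_ideal n"
  by (auto simp: irrelevant_iff lookup_sum)

lemma X_ne_0 [simp]: "X l \<noteq> 0"
proof
  assume "X l = (0::'a mpoly)"
  then have "lk (X l :: 'a mpoly) (Poly_Mapping.single l 1) = 0" by simp
  then show False by (simp add: X_def)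
qed

section \<open>Graded free modules\<close>

abbreviation FM :: "nat \<Rightarrow> int list \<Rightarrow> (nat \<Rightarrow> 'k::field mpoly) set" where
  "FM n as \<equiv> carrier (free_module n as)"

text \<open>Polynomials act on vectors entrywise; the constants make the vectors a vector space over \<open>k\<close>.\<close>

definition pm :: "'k::field mpoly \<Rightarrow> (nat \<Rightarrow> 'k mpoly) \<Rightarrow> (nat \<Rightarrow> 'k mpoly)" where
  "pm f v = (\<lambda>t. f * v t)"

definition vscale :: "'k::field \<Rightarrow> (nat \<Rightarrow> 'k mpoly) \<Rightarrow> (nat \<Rightarrow> 'k mpoly)" where
  "vscale c = pm (Con c)"

interpretation V: vspace vscale
  by unfold_locales (auto simp: vscale_def pm_def fun_eq_iff algebra_simps)

lemma pm_simps [simp]: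
  "pm f 0 = 0" "pm 0 v = 0" "pm 1 v = v" "pm f (u + v) = pm f u + pm f v"
  "pm f (u - v) = pm f u - pm f v" "pm f (- v) = - pm f v" "pm (- f) v = - pm f v"
  "pm f (pm g v) = pm (f * g) v"
  by (auto simp: pm_def fun_eq_iff algebra_simps)

lemma pm_add_left: "pm (f + g) v = pm f v + pm g v"
  by (auto simp: pm_def fun_eq_iff algebra_simps)

lemma pm_apply: "pm f v t = f * v t"
  by (simp add: pm_def)

lemma sum_fun_apply: "sum v A t = (\<Sum>i\<in>A. v i t)"
  by (induction A rule: infinite_finite_induct) auto

lemma pm_sum: "pm f (sum v A) = (\<Sum>i\<in>A. pm f (v i))"
  by (rule ext) (simp add: pm_apply sum_fun_apply sum_distrib_left)

lemma pm_sum_left: "pm (sum f A) v = (\<Sum>i\<in>A. pm (f i) v)"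
  by (induction A rule: infinite_finite_induct) (auto simp: pm_add_left)

lemma pm_eq_0: "pm f v = 0 \<longleftrightarrow> f = 0 \<or> v = 0"
  by (auto simp: pm_def fun_eq_iff)

lemma FM_iff: "v \<in> FM n as \<longleftrightarrow> (\<forall>t<length as. v t \<in> poly_carrier n) \<and> (\<forall>t\<ge>length as. v t = 0)"
  by (simp add: free_module_def)

lemma FM_coeff: "v \<in> FM n as \<Longrightarrow> v t \<in> poly_carrier n"
  by (cases "t < length as") (auto simp: FM_iff)

lemma FM_closed [simp, intro]:
  "0 \<in> FM n as" "u \<in> FM n as \<Longrightarrow> v \<in> FM n as \<Longrightarrow> u + v \<in> FM n as"
  "u \<in> FM n as \<Longrightarrow> v \<in> FM n as \<Longrightarrow> u - v \<in> FM n as" "u \<in> FM n as \<Longrightarrow> - u \<in> FM n as"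
  "f \<in> poly_carrier n \<Longrightarrow> u \<in> FM n as \<Longrightarrow> pm f u \<in> FM n as"
  by (auto simp: FM_iff pm_def)

lemma FM_sum [intro]: "(\<And>i. i \<in> A \<Longrightarrow> v i \<in> FM n as) \<Longrightarrow> sum v A \<in> FM n as"
  by (induction A rule: infinite_finite_induct) auto

abbreviation FG :: "nat \<Rightarrow> int list \<Rightarrow> int \<Rightarrow> (nat \<Rightarrow> 'k::field mpoly) set" where
  "FG \<equiv> free_grading"

lemma FG_iff: "v \<in> FG n as d \<longleftrightarrow>
    (\<forall>t<length as. v t \<in> poly_homogeneous n (d - as ! t)) \<and> (\<forall>t\<ge>length as. v t = 0)"
  by (auto simp: free_grading_def FM_iff poly_homogeneous_carrier)

lemma FG_FM: "v \<in> FG n as d \<Longrightarrow> v \<in> FM n as"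
  by (simp add: free_grading_def)

lemma FG_closed [simp, intro]:
  "0 \<in> FG n as d" "u \<in> FG n as d \<Longrightarrow> v \<in> FG n as d \<Longrightarrow> u + v \<in> FG n as d"
  "u \<in> FG n as d \<Longrightarrow> v \<in> FG n as d \<Longrightarrow> u - v \<in> FG n as d"
  "u \<in> FG n as d \<Longrightarrow> - u \<in> FG n as d"
  by (auto simp: FG_iff)

lemma FG_pm: "f \<in> poly_homogeneous n e \<Longrightarrow> u \<in> FG n as d \<Longrightarrow> e + d = c \<Longrightarrow> pm f u \<in> FG n as c"
  unfolding FG_iff pm_apply by (auto intro!: poly_homogeneous_mult)

lemma FG_X: "l < n \<Longrightarrow> u \<in> FG n as d \<Longrightarrow> pm (X l) u \<in> FG n as (d + 1)"
  by (rule FG_pm[of _ _ 1]) auto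

lemma FG_vscale: "u \<in> FG n as d \<Longrightarrow> vscale c u \<in> FG n as d"
  unfolding vscale_def by (rule FG_pm[of _ _ 0]) auto

lemma FG_sum [intro]: "(\<And>i. i \<in> A \<Longrightarrow> v i \<in> FG n as d) \<Longrightarrow> sum v A \<in> FG n as d"
  by (induction A rule: infinite_finite_induct) auto

lemma FG_subspace: "V.subspace (FG n as d)"
  by (auto simp: V.subspace_def FG_vscale)

lemma FG_0_if_low: "v \<in> FG n as d \<Longrightarrow> (\<And>a. a \<in> set as \<Longrightarrow> d < a) \<Longrightarrow> v = 0"
proof (rule ext)
  fix t assume v: "v \<in> FG n as d" "\<And>a. a \<in> set as \<Longrightarrow> d < a"
  show "v t = 0 t"
  proof (cases "t < length as")
    case True
    then have "v t \<in> poly_homogeneous n (d - as ! t)" "d - as ! t < 0"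
      using v nth_mem[OF True] by (auto simp: FG_iff)
    then show ?thesis using poly_homogeneous_neg[of "v t"] by auto
  qed (use v in \<open>auto simp: FG_iff\<close>)
qed

definition hcomp :: "int list \<Rightarrow> int \<Rightarrow> (nat \<Rightarrow> 'k::field mpoly) \<Rightarrow> (nat \<Rightarrow> 'k mpoly)" where
  "hcomp as d v = (\<lambda>t. if t < length as then hpart (d - as ! t) (v t) else 0)"

lemma hcomp_FG [intro]: "v \<in> FM n as \<Longrightarrow> hcomp as d v \<in> FG n as d"
  by (auto simp: FG_iff FM_iff hcomp_def)

lemma hcomp_add [simp]: "hcomp as d (u + v) = hcomp as d u + hcomp as d v"
  by (auto simp: hcomp_def fun_eq_iff)

lemma hcomp_0 [simp]: "hcomp as d 0 = 0"
  by (auto simp: hcomp_def fun_eq_iff)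

lemma hcomp_sum: "hcomp as d (sum v A) = (\<Sum>i\<in>A. hcomp as d (v i))"
  by (rule ext) (simp add: hcomp_def sum_fun_apply hpart_sum)

lemma hcomp_of_FG: "v \<in> FG n as e \<Longrightarrow> hcomp as d v = (if d = e then v else 0)"
proof
  fix t assume v: "v \<in> FG n as e"
  show "hcomp as d v t = (if d = e then v else 0) t"
    using v hpart_of_homogeneous[of "v t" n "e - as ! t" "d - as ! t"]
    by (auto simp: hcomp_def FG_iff)
qed

lemma hcomp_decomp:
  assumes "v \<in> FM n as"
  obtains D where "finite D" "\<And>d. d \<notin> D \<Longrightarrow> hcomp as d v = 0"
    "\<And>E. finite E \<Longrightarrow> D \<subseteq> E \<Longrightarrow> (\<Sum>d\<in>E. hcomp as d v) = v"
proof -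
  define D where "D = (\<Union>t<length as. (\<lambda>d. d + as ! t) ` {d. hpart d (v t) \<noteq> 0})"
  have fin: "finite D" unfolding D_def using hpart_support_finite by blast
  have 0: "hpart (d - as ! t) (v t) = 0" if "d \<notin> D" "t < length as" for d t
  proof (rule ccontr)
    assume "hpart (d - as ! t) (v t) \<noteq> 0"
    then have "(d - as ! t) + as ! t \<in> D" unfolding D_def using that(2) by blast
    then show False using that(1) by simp
  qed
  have "(\<Sum>d\<in>E. hcomp as d v) = v" if "finite E" "D \<subseteq> E" for E
  proof
    fix t show "(\<Sum>d\<in>E. hcomp as d v) t = v t"
    proof (cases "t < length as")
      case True
      have inj: "inj_on (\<lambda>d. d - as ! t) E" by (simp add: inj_on_def)
      have "(\<Sum>d\<in>E. hcomp as d v) t = (\<Sum>d\<in>E. hpart (d - as ! t) (v t))"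
        using True by (simp add: sum_fun_apply hcomp_def)
      also have "\<dots> = (\<Sum>d\<in>(\<lambda>d. d - as ! t) ` E. hpart d (v t))"
        by (subst sum.reindex[OF inj]) simp
      also have "\<dots> = v t"
      proof (rule hpart_decomp_support)
        show "{d. hpart d (v t) \<noteq> 0} \<subseteq> (\<lambda>d. d - as ! t) ` E"
        proof
          fix d assume "d \<in> {d. hpart d (v t) \<noteq> 0}"
          then have "d + as ! t \<in> D" using 0[of "d + as ! t" t] True by auto
          then have "d + as ! t \<in> E" using that(2) by blast
          then have "(d + as ! t) - as ! t \<in> (\<lambda>d. d - as ! t) ` E" by (rule imageI)
          then show "d \<in> (\<lambda>d. d - as ! t) ` E" by simp
        qed
      qed (use that in simp)
      finally show ?thesis .
    qed (use assms in \<open>simp add: FM_iff sum_fun_apply hcomp_def\<close>)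
  qed
  moreover have "hcomp as d v = 0" if "d \<notin> D" for d
    using 0[OF that] by (auto simp: hcomp_def)
  ultimately show thesis using that[of D] fin by simp
qed

definition unit :: "nat \<Rightarrow> 'k::field mpoly \<Rightarrow> (nat \<Rightarrow> 'k mpoly)" where
  "unit t f = (\<lambda>s. if s = t then f else 0)"

lemma unit_FG: "t < length as \<Longrightarrow> f \<in> poly_homogeneous n (d - as ! t) \<Longrightarrow> unit t f \<in> FG n as d"
  by (auto simp: unit_def FG_iff)

lemma unit_FM: "t < length as \<Longrightarrow> f \<in> poly_carrier n \<Longrightarrow> unit t f \<in> FM n as"
  by (auto simp: unit_def FM_iff)

lemma pm_unit [simp]: "pm f (unit t g) = unit t (f * g)"
  by (auto simp: unit_def pm_def)

lemma unit_expand: "v \<in> FM n as \<Longrightarrow> v = (\<Sum>t<length as. unit t (v t))"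
  by (rule ext) (auto simp: sum_fun_apply unit_def FM_iff)

text \<open>\<open>comb r G\<close> is the homomorphism that sends the basis vectors to \<open>G 0, ..., G (r - 1)\<close>.\<close>

definition comb :: "nat \<Rightarrow> (nat \<Rightarrow> nat \<Rightarrow> 'k::field mpoly) \<Rightarrow> (nat \<Rightarrow> 'k mpoly) \<Rightarrow> (nat \<Rightarrow> 'k mpoly)" where
  "comb r G v = (\<Sum>s<r. pm (v s) (G s))"

text \<open>A matrix is given by its columns. Column \<open>s\<close> is homogeneous of the degree of the basis vector that
  is sent to it.\<close>

definition hmat :: "nat \<Rightarrow> int list \<Rightarrow> int list \<Rightarrow> (nat \<Rightarrow> nat \<Rightarrow> 'k::field mpoly) \<Rightarrow> bool" where
  "hmat n as bs G \<longleftrightarrow> (\<forall>s<length as. G s \<in> FG n bs (as ! s))"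

lemma comb_apply: "comb r G v t = (\<Sum>s<r. v s * G s t)"
  by (simp add: comb_def sum_fun_apply pm_apply)

lemma comb_simps [simp]: "comb r G 0 = 0" "comb r G (u + v) = comb r G u + comb r G v"
    "comb r G (pm f v) = pm f (comb r G v)" "comb r G (- v) = - comb r G v"
    "comb r G (u - v) = comb r G u - comb r G v"
  by (auto simp: comb_apply fun_eq_iff pm_apply sum.distrib sum_distrib_left algebra_simps sum_negf
      sum_subtractf)

lemma comb_unit: "s < r \<Longrightarrow> comb r G (unit s f) = pm f (G s)"
  by (rule ext) (simp add: comb_apply unit_def pm_apply if_distrib[of "\<lambda>x. x * _"] cong: if_cong)

lemma comb_linear: "Vector_Spaces.linear vscale vscale (comb r G)"
  by unfold_locales (simp_all add: vscale_def)

lemma comb_sum: "comb r G (sum v A) = (\<Sum>i\<in>A. comb r G (v i))"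
proof -
  interpret Vector_Spaces.linear vscale vscale "comb r G" by (rule comb_linear)
  show ?thesis by (rule sum)
qed

lemma pm_linear: "Vector_Spaces.linear vscale vscale (pm f)"
  by unfold_locales (simp_all add: vscale_def mult.commute)

lemma comb_FM: "hmat n as bs G \<Longrightarrow> v \<in> FM n as \<Longrightarrow> comb (length as) G v \<in> FM n bs"
  unfolding comb_def by (rule FM_sum) (auto simp: hmat_def FG_FM FM_coeff)

lemma comb_FG: "hmat n as bs G \<Longrightarrow> v \<in> FG n as d \<Longrightarrow> comb (length as) G v \<in> FG n bs d"
  unfolding comb_def
proof (rule FG_sum)
  fix s assume *: "hmat n as bs G" "v \<in> FG n as d" "s \<in> {..<length as}"
  show "pm (v s) (G s) \<in> FG n bs d"
    by (rule FG_pm[of _ _ "d - as ! s" _ _ "as ! s"]) (use * in \<open>auto simp: hmat_def FG_iff\<close>)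
qed

lemma hcomp_comb:
  assumes "hmat n as bs G" "v \<in> FM n as"
  shows "hcomp bs d (comb (length as) G v) = comb (length as) G (hcomp as d v)"
proof
  fix t
  show "hcomp bs d (comb (length as) G v) t = comb (length as) G (hcomp as d v) t"
  proof (cases "t < length bs")
    case True
    have "hcomp bs d (comb (length as) G v) t = (\<Sum>s<length as. hpart (d - bs ! t) (v s * G s t))"
      using True by (simp add: hcomp_def comb_apply hpart_sum)
    also have "\<dots> = (\<Sum>s<length as. hpart (d - as ! s) (v s) * G s t)"
    proof (rule sum.cong[OF refl])
      fix s assume s: "s \<in> {..<length as}"
      then have "G s t \<in> poly_homogeneous n (as ! s - bs ! t)"
        using assms(1) True by (auto simp: hmat_def FG_iff)
      then show "hpart (d - bs ! t) (v s * G s t) = hpart (d - as ! s) (v s) * G s t"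
        using hpart_mult[of "v s" n "G s t" "as ! s - bs ! t" "d - bs ! t"] FM_coeff[OF assms(2)] by simp
    qed
    finally show ?thesis by (simp add: comb_apply hcomp_def)
  next
    case False
    have "G s t = 0" if "s < length as" for s
      using assms(1) that False by (auto simp: hmat_def FG_iff)
    then show ?thesis using False by (simp add: comb_apply hcomp_def)
  qed
qed

lemma graded_hom_comb:
  fixes h :: "(nat \<Rightarrow> 'k::field mpoly) \<Rightarrow> (nat \<Rightarrow> 'k mpoly)"
  assumes h: "graded_hom n (free_module n as) (FG n as) (free_module n bs) (FG n bs) h"
  defines "G \<equiv> (\<lambda>s. h (unit s 1))"
  shows "hmat n as bs G" "\<And>v. v \<in> FM n as \<Longrightarrow> h v = comb (length as) G v"
proof -
  have add: "h (u + v) = h u + h v" if "u \<in> FM n as" "v \<in> FM n as" for u v :: "nat \<Rightarrow> 'k mpoly"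
    using h that unfolding graded_hom_def by (auto simp: free_module_def plus_fun_def)
  have sm: "h (pm f u) = pm f (h u)" if "u \<in> FM n as" "f \<in> poly_carrier n" for f and u :: "nat \<Rightarrow> 'k mpoly"
    using h that unfolding graded_hom_def by (auto simp: free_module_def pm_def)
  have 0: "h 0 = 0" using add[of 0 0] by simp
  show "hmat n as bs G"
    unfolding hmat_def
  proof (intro allI impI)
    fix s assume s: "s < length as"
    then have "unit s 1 \<in> FG n as (as ! s)" by (auto intro: unit_FG)
    then show "G s \<in> FG n bs (as ! s)" using h unfolding graded_hom_def G_def by blast
  qed
  fix v :: "nat \<Rightarrow> 'k mpoly" assume v: "v \<in> FM n as"
  have "h (\<Sum>t\<in>A. unit t (v t)) = (\<Sum>t\<in>A. pm (v t) (G t))" if "A \<subseteq> {..<length as}" "finite A" for A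
    using that(2,1)
  proof (induction A rule: finite_induct)
    case (insert x A)
    have "h (unit x (v x)) = pm (v x) (G x)"
      using sm[of "unit x 1" "v x"] FM_coeff[OF v] insert by (auto simp: G_def unit_FM)
    moreover have "unit x (v x) \<in> FM n as" "(\<Sum>t\<in>A. unit t (v t)) \<in> FM n as"
      using insert FM_coeff[OF v] by (auto intro!: FM_sum unit_FM)
    ultimately show ?case
      using insert.IH insert.prems add[of "unit x (v x)" "\<Sum>t\<in>A. unit t (v t)"]
      by (simp only: sum.insert[OF insert.hyps] insert_subset)
  qed (simp add: 0)
  from this[of "{..<length as}"] show "h v = comb (length as) G v"
    using unit_expand[OF v] by (simp add: comb_def)
qed

lemma graded_hom_of_comb:
  assumes "hmat n as bs G"
  shows "graded_hom n (free_module n as) (FG n as) (free_module n bs) (FG n bs) (comb (length as) G)"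
  unfolding graded_hom_def
proof (intro conjI ballI allI)
  fix x y :: "nat \<Rightarrow> 'a mpoly" assume "x \<in> FM n as" "y \<in> FM n as"
  show "comb (length as) G (x \<oplus>\<^bsub>free_module n as\<^esub> y)
      = comb (length as) G x \<oplus>\<^bsub>free_module n bs\<^esub> comb (length as) G y"
    using comb_simps(2)[of "length as" G x y] by (simp add: free_module_def plus_fun_def)
next
  fix f :: "'a mpoly" and x :: "nat \<Rightarrow> 'a mpoly" assume "f \<in> poly_carrier n" "x \<in> FM n as"
  show "comb (length as) G (f \<odot>\<^bsub>free_module n as\<^esub> x) = f \<odot>\<^bsub>free_module n bs\<^esub> comb (length as) G x"
    using comb_simps(3)[of "length as" G f x] by (simp add: free_module_def pm_def)
qed (use assms comb_FM comb_FG in auto)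

section \<open>Dimensions of the homogeneous parts\<close>

definition Mon :: "nat \<Rightarrow> int \<Rightarrow> monom set" where
  "Mon n j = {m. Poly_Mapping.keys m \<subseteq> {..<n} \<and> int (monom_degree m) = j}"

text \<open>The Hilbert function of the polynomial ring.\<close>

definition Hilb :: "nat \<Rightarrow> int \<Rightarrow> nat" where
  "Hilb n j = card (Mon n j)"

lemma Mon_bij: "bij_betw (\<lambda>m. map (lk m) [0..<n]) (Mon n (int k)) {l. length l = n \<and> sum_list l = k}"
proof (rule bij_betw_imageI)
  show "inj_on (\<lambda>m. map (lk m) [0..<n]) (Mon n (int k))"
  proof (rule inj_onI, rule poly_mapping_eqI)
    fix m m' x assume *: "m \<in> Mon n (int k)" "m' \<in> Mon n (int k)" "map (lk m) [0..<n] = map (lk m') [0..<n]"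
    show "lk m x = lk m' x"
    proof (cases "x < n")
      case False
      then have "x \<notin> Poly_Mapping.keys m" "x \<notin> Poly_Mapping.keys m'" using * by (auto simp: Mon_def)
      then show ?thesis by (simp add: in_keys_iff)
    qed (use * in auto)
  qed
  show "(\<lambda>m. map (lk m) [0..<n]) ` Mon n (int k) = {l. length l = n \<and> sum_list l = k}"
  proof (intro equalityI subsetI)
    fix l assume "l \<in> (\<lambda>m. map (lk m) [0..<n]) ` Mon n (int k)"
    then obtain m where m: "m \<in> Mon n (int k)" "l = map (lk m) [0..<n]" by blast
    have "sum_list l = (\<Sum>x<n. lk m x)"
      unfolding m(2) by (simp add: interv_sum_list_conv_sum_set_nat atLeast0LessThan)
    also have "\<dots> = monom_degree m" using m by (subst monom_degree_superset[of "{..<n}"]) (auto simp: Mon_def)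
    finally show "l \<in> {l. length l = n \<and> sum_list l = k}" using m by (auto simp: Mon_def)
  next
    fix l :: "nat list" assume l: "l \<in> {l. length l = n \<and> sum_list l = k}"
    define m where "m = Abs_poly_mapping (\<lambda>x. if x < n then l ! x else 0)"
    have lm: "lk m = (\<lambda>x. if x < n then l ! x else 0)"
      unfolding m_def by (rule lookup_Abs_poly_mapping) (rule finite_subset[of _ "{..<n}"], auto)
    have k: "Poly_Mapping.keys m \<subseteq> {..<n}" by (auto simp: in_keys_iff lm split: if_splits)
    have eq: "map (lk m) [0..<n] = l" using l by (auto simp: lm intro!: nth_equalityI)
    have "monom_degree m = (\<Sum>x<n. lk m x)" using k by (subst monom_degree_superset[of "{..<n}"]) auto
    also have "\<dots> = sum_list (map (lk m) [0..<n])"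
      by (simp add: interv_sum_list_conv_sum_set_nat atLeast0LessThan)
    finally have "m \<in> Mon n (int k)" using l k eq by (simp add: Mon_def)
    then show "l \<in> (\<lambda>m. map (lk m) [0..<n]) ` Mon n (int k)" using eq by force
  qed
qed

lemma Hilb_nat: "Hilb n (int k) = (k + n - 1) choose k"
  unfolding Hilb_def bij_betw_same_card[OF Mon_bij] by (rule card_length_sum_list)

lemma Hilb_neg: "j < 0 \<Longrightarrow> Hilb n j = 0"
  by (auto simp: Hilb_def Mon_def card_eq_0_iff)

lemma Hilb_0 [simp]: "Hilb n 0 = 1"
  using Hilb_nat[of n 0] by simp

lemma finite_Mon: "finite (Mon n j)"
proof (cases "j < 0")
  case True
  then have "Mon n j = {}" by (auto simp: Mon_def)
  then show ?thesis by simp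
next
  case False
  then obtain k where k: "j = int k" by (metis nonneg_int_cases not_less)
  have "x \<le> sum_list l" if "x \<in> set l" for x and l :: "nat list" using member_le_sum_list[OF that] by simp
  then have "{l :: nat list. length l = n \<and> sum_list l = k} \<subseteq> {l. set l \<subseteq> {..k} \<and> length l = n}" by auto
  moreover have "finite {l :: nat list. set l \<subseteq> {..k} \<and> length l = n}" by (rule finite_lists_length_eq) simp
  ultimately have "finite {l :: nat list. length l = n \<and> sum_list l = k}" by (rule finite_subset)
  then show ?thesis using bij_betw_finite[OF Mon_bij] k by blast
qed

lemma dim_FG: "V.dim (FG n as j :: (nat \<Rightarrow> 'k::field mpoly) set) = (\<Sum>a\<leftarrow>as. Hilb n (j - a))"
  and findim_FG: "V.findim (FG n as j :: (nat \<Rightarrow> 'k::field mpoly) set)"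
proof -
  define S where "S = (SIGMA t:{..<length as}. Mon n (j - as ! t))"
  define b :: "nat \<times> monom \<Rightarrow> nat \<Rightarrow> 'k mpoly" where "b = (\<lambda>(t, m). unit t (Poly_Mapping.single m 1))"
  have fin: "finite S" unfolding S_def by (simp add: finite_Mon)
  have b: "lk (b (t, m) t') m' = (if t' = t \<and> m' = m then 1 else 0)" for t m t' m'
    by (simp add: b_def unit_def lookup_single when_def)
  have inj: "inj_on b S"
  proof (rule inj_onI, clarify)
    fix t m t' m' assume "b (t, m) = b (t', m')"
    then have "lk (b (t, m) t) m = lk (b (t', m') t) m" by simp
    then show "t = t' \<and> m = m'" unfolding b by (simp split: if_splits)
  qed
  have bFG: "b x \<in> FG n as j" if "x \<in> S" for x
    using that unfolding S_def b_def
    by (auto intro!: unit_FG simp: poly_homogeneous_iff lookup_single when_def Mon_def split: if_splits)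
  have ind: "V.independent (b ` S)"
  proof (rule V.independent_if_scalars_zero)
    fix f x assume 0: "(\<Sum>x\<in>b ` S. vscale (f x) x) = 0" and "x \<in> b ` S"
    then obtain t m where tm: "(t, m) \<in> S" "x = b (t, m)" by auto
    have "0 = lk ((\<Sum>x\<in>b ` S. vscale (f x) x) t) m" using 0 by simp
    also have "\<dots> = (\<Sum>y\<in>S. f (b y) * lk (b y t) m)"
      by (simp add: sum.reindex[OF inj] sum_fun_apply lookup_sum vscale_def pm_apply)
    also have "\<dots> = (\<Sum>y\<in>S. if y = (t, m) then f (b y) else 0)"
      by (rule sum.cong[OF refl]) (auto simp: b split: if_splits)
    also have "\<dots> = f x" using tm fin by simp
    finally show "f x = 0" by simp
  qed (use fin in simp)
  have span: "FG n as j \<subseteq> V.span (b ` S)"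
  proof
    fix v :: "nat \<Rightarrow> 'k mpoly" assume v: "v \<in> FG n as j"
    have "v = (\<Sum>(t, m)\<in>S. vscale (lk (v t) m) (b (t, m)))"
    proof (rule ext, rule poly_mapping_eqI)
      fix t' m'
      have "lk ((\<Sum>(t, m)\<in>S. vscale (lk (v t) m) (b (t, m))) t') m'
          = (\<Sum>y\<in>S. if y = (t', m') then lk (v t') m' else 0)"
        unfolding sum_fun_apply lookup_sum
        by (rule sum.cong[OF refl]) (auto simp: vscale_def pm_apply b split: if_splits)
      also have "\<dots> = (if (t', m') \<in> S then lk (v t') m' else 0)" using fin by simp
      also have "\<dots> = lk (v t') m'"
        using v by (cases "t' < length as") (auto simp: S_def FG_iff Mon_def poly_homogeneous_iff)
      finally show "lk (v t') m' = lk ((\<Sum>(t, m)\<in>S. vscale (lk (v t) m) (b (t, m))) t') m'" by simp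
    qed
    also have "\<dots> \<in> V.span (b ` S)"
    proof (rule V.span_sum)
      fix y assume "y \<in> S"
      then have "b y \<in> V.span (b ` S)" by (intro V.span_base imageI)
      then show "(case y of (t, m) \<Rightarrow> vscale (lk (v t) m) (b (t, m))) \<in> V.span (b ` S)"
        by (cases y) (simp add: V.span_scale)
    qed
    finally show "v \<in> V.span (b ` S)" .
  qed
  then show "V.findim (FG n as j :: (nat \<Rightarrow> 'k mpoly) set)" unfolding V.findim_def using fin by blast
  have "V.dim (FG n as j :: (nat \<Rightarrow> 'k mpoly) set) = card (b ` S)"
    using V.dim_unique[OF _ span ind refl] bFG by blast
  also have "\<dots> = card S" by (rule card_image[OF inj])
  also have "\<dots> = (\<Sum>t<length as. Hilb n (j - as ! t))"
    unfolding S_def Hilb_def by (simp add: finite_Mon)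
  also have "\<dots> = (\<Sum>a\<leftarrow>as. Hilb n (j - a))"
    by (simp add: sum_list_sum_nth atLeast0LessThan)
  finally show "V.dim (FG n as j :: (nat \<Rightarrow> 'k mpoly) set) = (\<Sum>a\<leftarrow>as. Hilb n (j - a))" .
qed

section \<open>The Koszul complex\<close>

definition sg :: "nat \<Rightarrow> nat set \<Rightarrow> 'k::field mpoly" where
  "sg l A = Con ((- 1) ^ card {a \<in> A. a < l})"

text \<open>A chain of homological degree \<open>i\<close> assigns a vector to every set of \<open>i\<close> variables. The differential is
  written by its values: the set \<open>A\<close> receives the contributions of the sets with one more variable,
  with the sign \<open>sg\<close> of the position of that variable.\<close>

definition koszul :: "nat \<Rightarrow> (nat set \<Rightarrow> nat \<Rightarrow> 'k::field mpoly) \<Rightarrow> nat set \<Rightarrow> nat \<Rightarrow> 'k mpoly" where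
  "koszul n z A = (\<Sum>l\<in>{..<n} - A. pm (sg l A * X l) (z (insert l A)))"

definition vset :: "nat \<Rightarrow> nat \<Rightarrow> nat set \<Rightarrow> bool" where
  "vset n i A \<longleftrightarrow> A \<subseteq> {..<n} \<and> card A = i"

lemma vset_finite: "vset n i A \<Longrightarrow> finite A"
  unfolding vset_def using finite_subset by blast

lemma vset_insert: "vset n i A \<Longrightarrow> l \<in> {..<n} - A \<Longrightarrow> vset n (Suc i) (insert l A)"
  using vset_finite[of n i A] by (auto simp: vset_def)

lemma vset_0: "vset n 0 A \<longleftrightarrow> A = {}"
  by (auto simp: vset_def dest: finite_subset)

lemma vset_large: "vset n i A \<Longrightarrow> i \<le> n"
  unfolding vset_def using card_mono[of "{..<n}" A] by auto

lemma sg_empty [simp]: "sg l {} = 1"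
  by (simp add: sg_def)

lemma sg_insert:
  assumes "finite A" "l \<notin> A"
  shows "sg m (insert l A) = (if l < m then - sg m A else sg m A)"
proof (cases "l < m")
  case True
  then have "{a \<in> insert l A. a < m} = insert l {a \<in> A. a < m}" by auto
  then show ?thesis using assms True by (simp add: sg_def)
next
  case False
  then have "{a \<in> insert l A. a < m} = {a \<in> A. a < m}" by auto
  then show ?thesis using False by (simp add: sg_def)
qed

lemma sg_carrier [simp]: "sg l A \<in> poly_homogeneous n 0"
  by (simp add: sg_def)

lemma koszul_apply: "koszul n z A t = (\<Sum>l\<in>{..<n} - A. sg l A * X l * z (insert l A) t)"
  by (simp add: koszul_def sum_fun_apply pm_apply)

lemma koszul_FG:
  assumes "vset n i A" "\<And>A. vset n (Suc i) A \<Longrightarrow> z A \<in> FG n as (d - 1)"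
  shows "koszul n z A \<in> FG n as d"
  unfolding koszul_def
proof (rule FG_sum)
  fix l assume l: "l \<in> {..<n} - A"
  have "sg l A * X l \<in> poly_homogeneous n 1" using l by (intro poly_homogeneous_mult[of _ _ 0 _ 1]) auto
  then show "pm (sg l A * X l) (z (insert l A)) \<in> FG n as d"
    using assms(2)[OF vset_insert[OF assms(1) l]] by (rule FG_pm) simp
qed

lemma koszul_diff: "koszul n (\<lambda>A. y A - w A) A = koszul n y A - koszul n w A"
  by (simp add: koszul_def sum_subtractf)

lemma koszul_comb: "comb r G (koszul n z A) = koszul n (\<lambda>A. comb r G (z A)) A"
  by (simp add: koszul_def comb_sum)

lemma koszul_cong:
  "vset n i A \<Longrightarrow> (\<And>B. vset n (Suc i) B \<Longrightarrow> z B = w B) \<Longrightarrow> koszul n z A = koszul n w A"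
  unfolding koszul_def by (rule sum.cong[OF refl]) (simp add: vset_insert)

lemma koszul_koszul: 
  assumes "vset n i A" shows "koszul n (koszul n z) A = 0"
proof -
  let ?B = "{..<n} - A"
  define c where "c = (\<lambda>(l, m). pm (sg l A * X l * (sg m (insert l A) * X m)) (z (insert m (insert l A))))"
  have fA: "finite A" by (rule vset_finite[OF assms])
  have sym: "c (m, l) = - c (l, m)" if "l < m" "l \<in> ?B" "m \<in> ?B" for l m
    using that fA by (simp add: c_def sg_insert insert_commute ac_simps)
  have "koszul n (koszul n z) A = (\<Sum>l\<in>?B. \<Sum>m\<in>?B - {l}. c (l, m))"
    unfolding koszul_def pm_sum c_def by (intro sum.cong) (auto simp: pm_sum)
  also have "\<dots> = (\<Sum>p\<in>(SIGMA l:?B. ?B - {l}). c p)"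
    by (subst sum.Sigma) (auto simp: c_def)
  also have "(SIGMA l:?B. ?B - {l}) = {(l, m). l \<in> ?B \<and> m \<in> ?B \<and> l < m} \<union> {(l, m). l \<in> ?B \<and> m \<in> ?B \<and> m < l}"
    (is "_ = ?P \<union> ?Q") by auto
  also have "(\<Sum>p\<in>?P \<union> ?Q. c p) = (\<Sum>p\<in>?P. c p) + (\<Sum>p\<in>?Q. c p)"
    by (rule sum.union_disjoint) (auto intro: finite_subset[of _ "?B \<times> ?B"])
  also have "(\<Sum>p\<in>?Q. c p) = (\<Sum>p\<in>?P. c (prod.swap p))"
    by (rule sum.reindex_bij_witness[of _ prod.swap prod.swap]) auto
  also have "\<dots> = (\<Sum>p\<in>?P. - c p)" using sym by (intro sum.cong) auto
  finally show ?thesis by (simp only: sum_negf add.right_inverse)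
qed

text \<open>The Koszul complex of a free module is exact in positive degrees, and its image in degree \<open>0\<close>
  contains every vector with entries in the irrelevant ideal. The contraction removes the first
  element \<open>p\<close> of a set of variables and divides by \<open>x\<^sub>p\<close> those terms that have no earlier variable.\<close>

lemma koszul_exact:
  assumes z: "\<And>A. vset n i A \<Longrightarrow> z A \<in> FG n as d"
    and cyc: "\<And>A. 0 < i \<Longrightarrow> vset n (i - 1) A \<Longrightarrow> koszul n z A = 0"
    and irr: "\<And>t. i = 0 \<Longrightarrow> z {} t \<in> irrelevant_ideal n"
  obtains y where "\<And>A. vset n (Suc i) A \<Longrightarrow> y A \<in> FG n as (d - 1)"
    "\<And>A. vset n i A \<Longrightarrow> koszul n y A = z A"
proof -
  define y where "y A = (\<lambda>t. dvar (Min A) (z (A - {Min A}) t))" for A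
  have "y A \<in> FG n as (d - 1)" if A: "vset n (Suc i) A" for A
  proof -
    have "A \<noteq> {}" "finite A" using A vset_finite[OF A] by (auto simp: vset_def)
    then have "Min A \<in> A" by simp
    then have "vset n i (A - {Min A})" using A by (auto simp: vset_def)
    from z[OF this] have *: "z (A - {Min A}) t \<in> poly_homogeneous n (d - as ! t)" if "t < length as" for t
      using that by (auto simp: FG_iff)
    show ?thesis
      unfolding FG_iff
    proof (intro conjI allI impI)
      fix t assume t: "t < length as"
      have "d - 1 - as ! t = d - as ! t - 1" by simp
      then show "y A t \<in> poly_homogeneous n (d - 1 - as ! t)"
        unfolding y_def using dvar_homogeneous[OF *[OF t], of "Min A"] by (simp only:)
    next
      fix t assume "length as \<le> t"
      then have "z (A - {Min A}) t = 0" using z[OF \<open>vset n i (A - {Min A})\<close>] by (auto simp: FG_iff)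
      then show "y A t = 0" by (simp add: y_def)
    qed
  qed
  moreover have "koszul n y A = z A" if A: "vset n i A" for A
  proof
    fix t
    have zc: "z B t \<in> poly_carrier n" if "vset n i B" for B
      using FM_coeff[OF FG_FM[OF z[OF that]]] .
    show "koszul n y A t = z A t"
    proof (cases "i = 0")
      case True
      then have [simp]: "A = {}" using A by (simp add: vset_0)
      have "koszul n y A t = (\<Sum>l<n. X l * dvar l (z {} t))"
        by (simp add: koszul_apply y_def)
      then show ?thesis using var_expand[OF zc[OF A]] irr[OF True, of t] by (simp add: irrelevant_iff)
    next
      case False
      have fA: "finite A" by (rule vset_finite[OF A])
      have "A \<noteq> {}" using A False by (auto simp: vset_def)
      define p where "p = Min A"
      have p: "p \<in> A" "\<And>a. a \<in> A \<Longrightarrow> p \<le> a" using \<open>A \<noteq> {}\<close> fA by (auto simp: p_def)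
      have pn: "p < n" using p A by (auto simp: vset_def)
      define B where "B = A - {p}"
      have AB: "A = insert p B" "p \<notin> B" "finite B" using p fA by (auto simp: B_def)
      have Bp: "p < b" if "b \<in> B" for b using that p by (auto simp: B_def intro: le_neq_trans)
      define L where "L = {l. l < n \<and> p < l \<and> l \<notin> A}"
      have sgA: "sg l A = - sg l B" if "l \<in> L" for l
        using sg_insert[OF AB(3,2), of l] that by (simp add: L_def AB(1))
      have sg1: "sg l A = 1" if "l < p" for l
      proof -
        have "{a \<in> A. a < l} = {}" using p(2) that by force
        then show ?thesis by (simp only: sg_def card.empty) simp
      qed
      have sg2: "sg l B = 1" if "l \<le> p" for l
      proof -
        have "{b \<in> B. b < l} = {}" using Bp that by force
        then show ?thesis by (simp only: sg_def card.empty) simp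
      qed
      \<comment> \<open>applying the contraction to the cycle condition at \<open>A - {p}\<close>\<close>
      have "koszul n z B = 0"
        by (rule cyc) (use False A p(1) fA in \<open>auto simp: B_def vset_def\<close>)
      then have "(\<Sum>l\<in>{..<n} - B. sg l B * X l * z (insert l B) t) = 0"
        using koszul_apply[of n z B t] by simp
      then have "0 = dvar p (\<Sum>l\<in>{..<n} - B. sg l B * X l * z (insert l B) t)"
        by (simp only: dvar_0)
      also have "\<dots> = (\<Sum>l\<in>{..<n} - B. sg l B * dvar p (X l * z (insert l B) t))"
        by (simp add: dvar_sum sg_def dvar_Con_mult mult.assoc)
      also have "{..<n} - B = {..<p} \<union> ({p} \<union> L)"
      proof -
        have "l \<notin> B" if "l < p" for l using Bp[of l] that by auto
        then show ?thesis using pn AB(2) by (auto simp: L_def AB(1) not_less_iff_gr_or_eq) 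
      qed
      also have "(\<Sum>l\<in>\<dots>. sg l B * dvar p (X l * z (insert l B) t))
          = (\<Sum>l<p. sg l B * dvar p (X l * z (insert l B) t))
            + (tailpart p (z A t) + (\<Sum>l\<in>L. sg l B * dvar p (X l * z (insert l B) t)))"
      proof -
        have L: "finite L" "p \<notin> L" "{..<p} \<inter> ({p} \<union> L) = {}" by (auto simp: L_def)
        show ?thesis
          using L by (subst sum.union_disjoint) (auto simp: sg2 dvar_X_same AB(1)[symmetric])
      qed
      also have "(\<Sum>l<p. sg l B * dvar p (X l * z (insert l B) t)) = 0"
        by (simp add: dvar_X_lt)
      also have "(\<Sum>l\<in>L. sg l B * dvar p (X l * z (insert l B) t))
          = - (\<Sum>l\<in>L. sg l A * X l * dvar p (z (insert l B) t))"
        unfolding sum_negf[symmetric]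
        by (rule sum.cong[OF refl]) (simp add: sgA dvar_X_gt, simp add: L_def dvar_X_gt mult.assoc)
      finally have eq: "(\<Sum>l\<in>L. sg l A * X l * dvar p (z (insert l B) t)) = tailpart p (z A t)" by simp
      have ylt: "y (insert l A) t = dvar l (z A t)" if "l < p" for l
      proof -
        have "Min (insert l A) = l" using that p fA by (intro Min_eqI) (auto intro: less_imp_le less_le_trans)
        moreover have "insert l A - {l} = A" using that p(2)[of l] by auto
        ultimately show ?thesis by (simp add: y_def)
      qed
      have ygt: "y (insert l A) t = dvar p (z (insert l B) t)" if "l \<in> L" for l
      proof -
        have "Min (insert l A) = p" using that p fA by (intro Min_eqI) (auto simp: L_def)
        moreover have "insert l A - {p} = insert l B" using that by (auto simp: L_def B_def)
        ultimately show ?thesis by (simp add: y_def)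
      qed
      have "l \<notin> A" if "l < p" for l using p(2)[of l] that by auto
      moreover have "p < l" if "l \<notin> A" "\<not> l < p" for l
        using that p(1) by (cases "l = p") auto
      ultimately have "{..<n} - A = {..<p} \<union> L" using pn by (auto simp: L_def)
      then have "koszul n y A t = (\<Sum>l\<in>{..<p} \<union> L. sg l A * X l * y (insert l A) t)"
        by (simp only: koszul_apply)
      also have "\<dots> = (\<Sum>l<p. sg l A * X l * y (insert l A) t) + (\<Sum>l\<in>L. sg l A * X l * y (insert l A) t)"
        by (rule sum.union_disjoint) (auto simp: L_def)
      also have "\<dots> = (\<Sum>l<p. X l * dvar l (z A t)) + tailpart p (z A t)"
        using eq by (simp add: sg1 ylt ygt)
      finally show ?thesis using tailpart_expand[of "z A t" p] by simp
    qed
  qed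
  ultimately show thesis using that by blast
qed

section \<open>Minimal free resolutions\<close>

text \<open>Graded submodules of the free module with degrees \<open>as\<close>.\<close>

definition gsub :: "nat \<Rightarrow> int list \<Rightarrow> (nat \<Rightarrow> 'k::field mpoly) set \<Rightarrow> bool" where
  "gsub n as K \<longleftrightarrow> K \<subseteq> FM n as \<and> 0 \<in> K \<and> (\<forall>u\<in>K. \<forall>v\<in>K. u + v \<in> K) \<and>
     (\<forall>f\<in>poly_carrier n. \<forall>u\<in>K. pm f u \<in> K) \<and> (\<forall>u\<in>K. \<forall>d. hcomp as d u \<in> K)"

lemma gsubD:
  assumes "gsub n as K"
  shows "u \<in> K \<Longrightarrow> u \<in> FM n as" "0 \<in> K" "u \<in> K \<Longrightarrow> v \<in> K \<Longrightarrow> u + v \<in> K"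
    "f \<in> poly_carrier n \<Longrightarrow> u \<in> K \<Longrightarrow> pm f u \<in> K" "u \<in> K \<Longrightarrow> hcomp as d u \<in> K"
    "V.subspace K"
  using assms by (auto simp: gsub_def V.subspace_def vscale_def)

lemma gsub_sum: "gsub n as K \<Longrightarrow> (\<And>i. i \<in> A \<Longrightarrow> v i \<in> K) \<Longrightarrow> sum v A \<in> K"
  by (induction A rule: infinite_finite_induct) (auto simp: gsubD)

lemma gsub_image:
  fixes G :: "nat \<Rightarrow> nat \<Rightarrow> 'k::field mpoly"
  assumes "hmat n bs as G" shows "gsub n as (comb (length bs) G ` FM n bs)"
  unfolding gsub_def
proof (intro conjI ballI allI)
  show "0 \<in> comb (length bs) G ` FM n bs" by (rule image_eqI[of _ _ 0]) auto
next
  fix u v assume "u \<in> comb (length bs) G ` FM n bs" "v \<in> comb (length bs) G ` FM n bs"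
  then obtain x y where "x \<in> FM n bs" "y \<in> FM n bs" "u = comb (length bs) G x" "v = comb (length bs) G y" by auto
  then show "u + v \<in> comb (length bs) G ` FM n bs" by (intro image_eqI[of _ _ "x + y"]) auto
next
  fix f :: "'k mpoly" and u assume "u \<in> comb (length bs) G ` FM n bs" "f \<in> poly_carrier n"
  then obtain x where "x \<in> FM n bs" "u = comb (length bs) G x" by auto
  then show "pm f u \<in> comb (length bs) G ` FM n bs"
    using \<open>f \<in> poly_carrier n\<close> by (intro image_eqI[of _ _ "pm f x"]) auto
next
  fix u d assume "u \<in> comb (length bs) G ` FM n bs"
  then obtain x where "x \<in> FM n bs" "u = comb (length bs) G x" by auto
  then show "hcomp as d u \<in> comb (length bs) G ` FM n bs"
    using hcomp_comb[OF assms] by (intro image_eqI[of _ _ "hcomp bs d x"]) (auto intro: FG_FM)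
qed (use comb_FM[OF assms] in auto)

lemma gsub_kernel:
  assumes "hmat n bs as G" shows "gsub n bs {v \<in> FM n bs. comb (length bs) G v = 0}"
  unfolding gsub_def
proof (intro conjI ballI allI)
  fix u d assume u: "u \<in> {v \<in> FM n bs. comb (length bs) G v = 0}"
  then have "comb (length bs) G (hcomp bs d u) = 0" using hcomp_comb[OF assms, of u d] by simp
  then show "hcomp bs d u \<in> {v \<in> FM n bs. comb (length bs) G v = 0}" using u by (auto intro: FG_FM)
qed auto

text \<open>Vanishing of the Koszul homology of \<open>K\<close> in homological degree \<open>i\<close> and internal degree \<open>j\<close>. Every
  set of \<open>i\<close> variables contributes \<open>i\<close> to the internal degree, which leaves \<open>j - i\<close> for the values
  of a chain.\<close>

definition kvanish :: "nat \<Rightarrow> nat \<Rightarrow> int \<Rightarrow> int list \<Rightarrow> (nat \<Rightarrow> 'k::field mpoly) set \<Rightarrow> bool" where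
  "kvanish n i j as K \<longleftrightarrow> (\<forall>z. (\<forall>A. vset n i A \<longrightarrow> z A \<in> K \<inter> FG n as (j - int i)) \<and>
      (\<forall>A. 0 < i \<longrightarrow> vset n (i - 1) A \<longrightarrow> koszul n z A = 0) \<longrightarrow>
      (\<exists>w. (\<forall>A. vset n (Suc i) A \<longrightarrow> w A \<in> K \<inter> FG n as (j - int (Suc i))) \<and>
        (\<forall>A. vset n i A \<longrightarrow> koszul n w A = z A)))"

text \<open>A submodule \<open>K\<close> of a free module \<open>R\<close> that contains all elements of degree \<open>> r\<close> has no Koszul
  homology in high degrees: a cycle is a boundary in \<open>R\<close>, and the chain that it bounds lies in \<open>K\<close> for
  reasons of degree.\<close>

lemma kvanish_initial:
  assumes K: "\<forall>v\<in>K. \<forall>t. v t \<in> irrelevant_ideal n" and r: "\<forall>d>r. FG n as d \<subseteq> K"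
    and ij: "j > int i + 1 + r \<or> n \<le> i"
  shows "kvanish n i j as K"
  unfolding kvanish_def
proof (intro allI impI, elim conjE)
  fix z assume z: "\<forall>A. vset n i A \<longrightarrow> z A \<in> K \<inter> FG n as (j - int i)"
    and cyc: "\<forall>A. 0 < i \<longrightarrow> vset n (i - 1) A \<longrightarrow> koszul n z A = 0"
  obtain y where y: "\<And>A. vset n (Suc i) A \<Longrightarrow> y A \<in> FG n as (j - int i - 1)"
    "\<And>A. vset n i A \<Longrightarrow> koszul n y A = z A"
    by (rule koszul_exact[of n i z as "j - int i"]) (use z cyc K vset_0 in auto)
  have "y A \<in> K \<inter> FG n as (j - int (Suc i))" if "vset n (Suc i) A" for A
    using y(1)[OF that] r[rule_format, of "j - int i - 1"] ij vset_large[OF that] by (auto simp: algebra_simps)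
  then show "\<exists>w. (\<forall>A. vset n (Suc i) A \<longrightarrow> w A \<in> K \<inter> FG n as (j - int (Suc i))) \<and>
        (\<forall>A. vset n i A \<longrightarrow> koszul n w A = z A)" using y(2) by blast
qed

text \<open>Dimension shifting. In degree \<open>i = 0\<close>, where the Koszul complex of the free module is not exact,
  minimality of the cover takes over.\<close>

lemma kvanish_shift:
  assumes G: "hmat n bs as G" and K: "K = comb (length bs) G ` FM n bs"
    and min: "\<And>v t. v \<in> FM n bs \<Longrightarrow> comb (length bs) G v = 0 \<Longrightarrow> v t \<in> irrelevant_ideal n"
    and van: "kvanish n (Suc i) j as K"
  shows "kvanish n i j bs {v \<in> FM n bs. comb (length bs) G v = 0}"
  unfolding kvanish_def
proof (intro allI impI, elim conjE)
  let ?K = "{v \<in> FM n bs. comb (length bs) G v = 0}"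
  let ?c = "comb (length bs) G"
  fix z assume z: "\<forall>A. vset n i A \<longrightarrow> z A \<in> ?K \<inter> FG n bs (j - int i)"
    and cyc: "\<forall>A. 0 < i \<longrightarrow> vset n (i - 1) A \<longrightarrow> koszul n z A = 0"
  obtain y where y: "\<And>A. vset n (Suc i) A \<Longrightarrow> y A \<in> FG n bs (j - int i - 1)"
    "\<And>A. vset n i A \<Longrightarrow> koszul n y A = z A"
    by (rule koszul_exact[of n i z bs "j - int i"]) (use z cyc min vset_0 in auto)
  have "?c (y A) \<in> K \<inter> FG n as (j - int (Suc i))" if "vset n (Suc i) A" for A
    using comb_FG[OF G y(1)[OF that]] FG_FM[OF y(1)[OF that]] K by (auto simp: algebra_simps)
  moreover have "koszul n (\<lambda>A. ?c (y A)) A = 0" if "vset n i A" for A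
    unfolding koszul_comb[symmetric] y(2)[OF that] using z that by blast
  ultimately have "\<exists>w. (\<forall>A. vset n (Suc (Suc i)) A \<longrightarrow> w A \<in> K \<inter> FG n as (j - int (Suc (Suc i)))) \<and>
        (\<forall>A. vset n (Suc i) A \<longrightarrow> koszul n w A = ?c (y A))"
    using van[unfolded kvanish_def, rule_format, of "\<lambda>A. ?c (y A)"] by simp
  then obtain w where w: "\<And>A. vset n (Suc (Suc i)) A \<Longrightarrow> w A \<in> K \<inter> FG n as (j - int (Suc (Suc i)))"
    "\<And>A. vset n (Suc i) A \<Longrightarrow> koszul n w A = ?c (y A)" by blast
  have "\<exists>u. u \<in> FG n bs (j - int (Suc (Suc i))) \<and> ?c u = w A" if A: "vset n (Suc (Suc i)) A" for A
  proof -
    obtain x where x: "x \<in> FM n bs" "w A = ?c x" using w(1)[OF A] K by blast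
    let ?d = "j - int (Suc (Suc i))"
    have "?c (hcomp bs ?d x) = hcomp as ?d (w A)" using hcomp_comb[OF G x(1)] x(2) by simp
    also have "\<dots> = w A" using w(1)[OF A] hcomp_of_FG[of "w A" n as ?d ?d] by simp
    finally show ?thesis using x(1) by blast
  qed
  then obtain u where u: "\<And>A. vset n (Suc (Suc i)) A \<Longrightarrow> u A \<in> FG n bs (j - int (Suc (Suc i)))"
    "\<And>A. vset n (Suc (Suc i)) A \<Longrightarrow> ?c (u A) = w A" by metis
  define v where "v A = y A - koszul n u A" for A
  have "v A \<in> ?K \<inter> FG n bs (j - int (Suc i))" if A: "vset n (Suc i) A" for A
  proof -
    have "koszul n u A \<in> FG n bs (j - int (Suc i))"
      by (rule koszul_FG[OF A]) (use u(1) in \<open>simp add: algebra_simps\<close>)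
    then have 1: "v A \<in> FG n bs (j - int (Suc i))" using y(1)[OF A] by (simp add: v_def algebra_simps)
    have "?c (koszul n u A) = koszul n w A"
      unfolding koszul_comb by (rule koszul_cong[OF A]) (rule u(2))
    then have "?c (v A) = 0" using w(2)[OF A] by (simp add: v_def)
    then show ?thesis using 1 FG_FM[OF 1] by simp
  qed
  moreover have "koszul n v A = z A" if "vset n i A" for A
    unfolding v_def koszul_diff koszul_koszul[OF that] y(2)[OF that] by simp
  ultimately show "\<exists>w. (\<forall>A. vset n (Suc i) A \<longrightarrow> w A \<in> ?K \<inter> FG n bs (j - int (Suc i))) \<and>
        (\<forall>A. vset n i A \<longrightarrow> koszul n w A = z A)" by blast
qed

lemma kvanish_0D:
  assumes "kvanish n 0 j as K" "v \<in> K" "v \<in> FG n as j"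
  obtains y where "\<And>l. l < n \<Longrightarrow> y l \<in> K \<inter> FG n as (j - 1)" "v = (\<Sum>l<n. pm (X l) (y l))"
proof -
  obtain w where w: "\<And>A. vset n 1 A \<Longrightarrow> w A \<in> K \<inter> FG n as (j - 1)" "koszul n w {} = v"
    using assms(1)[unfolded kvanish_def, rule_format, of "\<lambda>_. v"] assms(2,3) by (auto simp: vset_0)
  show thesis
    by (rule that[of "\<lambda>l. w {l}"]) (use w in \<open>auto simp: vset_def koszul_def\<close>)
qed

text \<open>In degree \<open>j\<close>, extend a basis \<open>B\<close> of the part \<open>P\<close> of \<open>K\<close> that is generated in lower degree to a basis
  \<open>C\<close> of the whole part \<open>H\<close>; the new basis vectors are the generators. Outside the finite set \<open>J\<close>, the
  vanishing of the Koszul homology in homological degree \<open>0\<close> says that \<open>P\<close> is everything. A relation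
  with a nonzero constant coefficient would contradict the independence of \<open>C\<close>.\<close>

lemma minimal_cover:
  fixes K :: "(nat \<Rightarrow> 'k::field mpoly) set"
  assumes K: "gsub n as K" and J: "finite J" "\<And>j. j \<notin> J \<Longrightarrow> kvanish n 0 j as K"
    and lo: "\<And>d. d < lo \<Longrightarrow> FG n as d \<subseteq> {0 :: nat \<Rightarrow> 'k mpoly}"
  obtains bs G where "set bs \<subseteq> J" "hmat n bs as G" "comb (length bs) G ` FM n bs = K"
    "\<And>v t. v \<in> FM n bs \<Longrightarrow> comb (length bs) G v = 0 \<Longrightarrow> v t \<in> irrelevant_ideal n"
proof -
  define H where "H j = K \<inter> FG n as j" for j
  define P where "P j = {\<Sum>l<n. pm (X l) (y l) |y. \<forall>l<n. y l \<in> H (j - 1)}" for j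
  have Hs: "V.subspace (H j)" for j
    unfolding H_def by (intro V.subspace_inter gsubD(6)[OF K] FG_subspace)
  have Hfin: "V.findim (H j)" for j
    using V.findim_subset[OF findim_FG] unfolding H_def by blast
  have Ps: "V.subspace (P j)" for j
    unfolding V.subspace_def
  proof (intro conjI ballI allI)
    show "0 \<in> P j" unfolding P_def mem_Collect_eq
      by (rule exI[of _ "\<lambda>_. 0"]) (simp add: V.subspace_0[OF Hs])
  next
    fix x y assume "x \<in> P j" "y \<in> P j"
    then obtain u v where "\<forall>l<n. u l \<in> H (j - 1)" "\<forall>l<n. v l \<in> H (j - 1)"
      "x = (\<Sum>l<n. pm (X l) (u l))" "y = (\<Sum>l<n. pm (X l) (v l))" unfolding P_def by blast
    then show "x + y \<in> P j" unfolding P_def mem_Collect_eq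
      by (intro exI[of _ "\<lambda>l. u l + v l"]) (simp add: sum.distrib V.subspace_add[OF Hs])
  next
    fix c x assume "x \<in> P j"
    then obtain u where "\<forall>l<n. u l \<in> H (j - 1)" "x = (\<Sum>l<n. pm (X l) (u l))" unfolding P_def by blast
    then show "vscale c x \<in> P j" unfolding P_def mem_Collect_eq
      by (intro exI[of _ "\<lambda>l. vscale c (u l)"])
        (simp add: V.subspace_scale[OF Hs, unfolded vscale_def] vscale_def pm_sum mult.commute)
  qed
  have PH: "P j \<subseteq> H j" for j
  proof
    fix x assume "x \<in> P j"
    then obtain u where u: "\<forall>l<n. u l \<in> H (j - 1)" "x = (\<Sum>l<n. pm (X l) (u l))" unfolding P_def by blast
    have "pm (X l) (u l) \<in> H j" if "l < n" for l
      using u(1) that FG_X[OF that, of "u l" as "j - 1"] gsubD(4)[OF K, of "X l" "u l"]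
      unfolding H_def by auto
    then show "x \<in> H j" unfolding u(2) by (intro V.subspace_sum[OF Hs]) auto
  qed
  have "\<exists>B C. B \<subseteq> C \<and> V.independent C \<and> P j = V.span B \<and> H j = V.span C" for j
    by (rule V.basis_extension[OF Ps Hs PH, of j]) blast
  then obtain B C where BC: "\<And>j. B j \<subseteq> C j" "\<And>j. V.independent (C j)"
    "\<And>j. P j = V.span (B j)" "\<And>j. H j = V.span (C j)" by metis
  have CH: "C j \<subseteq> H j" for j unfolding BC(4) by (rule V.span_superset)
  have Cfin: "finite (C j)" for j by (rule V.findim_independent_finite[OF Hfin CH BC(2)])
  define S where "S = (SIGMA j:J. C j - B j)"
  have "finite S" unfolding S_def using J(1) Cfin by auto
  then obtain ps where ps: "set ps = S" "distinct ps" using finite_distinct_list by blast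
  define bs where "bs = map fst ps"
  define G where "G s = snd (ps ! s)" for s
  have nth: "bs ! s \<in> J" "G s \<in> C (bs ! s) - B (bs ! s)" "ps ! s = (bs ! s, G s)" if "s < length bs" for s
  proof -
    have "ps ! s \<in> S" using that ps(1) by (auto simp: bs_def)
    moreover show "ps ! s = (bs ! s, G s)" using that by (simp add: bs_def G_def)
    ultimately show "bs ! s \<in> J" "G s \<in> C (bs ! s) - B (bs ! s)" by (auto simp: S_def)
  qed
  have GH: "G s \<in> H (bs ! s)" if "s < length bs" for s using nth(2)[OF that] CH by blast
  have hm: "hmat n bs as G" using GH by (auto simp: hmat_def H_def)
  let ?c = "comb (length bs) G"
  let ?I = "?c ` FM n bs"
  have I: "gsub n as ?I" by (rule gsub_image[OF hm])
  have GI: "g \<in> ?I" if "j \<in> J" "g \<in> C j - B j" for j g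
  proof -
    have "(j, g) \<in> set ps" using that ps(1) by (simp add: S_def)
    then obtain s where s: "s < length bs" "ps ! s = (j, g)" by (auto simp: bs_def in_set_conv_nth)
    then have "?c (unit s 1) = g" by (simp add: comb_unit G_def)
    then show ?thesis using unit_FM[OF s(1), of 1 n] by (intro image_eqI[of _ _ "unit s 1"]) auto
  qed
  have IK: "?I \<subseteq> K"
  proof
    fix x assume "x \<in> ?I"
    then obtain v where "v \<in> FM n bs" "x = ?c v" by blast
    then have x: "x = (\<Sum>s<length bs. pm (v s) (G s))" "v \<in> FM n bs" by (simp_all add: comb_def)
    show "x \<in> K" unfolding x(1)
    proof (rule gsub_sum[OF K])
      fix s assume "s \<in> {..<length bs}"
      then have "G s \<in> K" using GH[of s] by (simp add: H_def)
      then show "pm (v s) (G s) \<in> K" by (rule gsubD(4)[OF K FM_coeff[OF x(2)]])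
    qed
  qed
  have PI: "H j \<subseteq> ?I" if P: "P j \<subseteq> ?I" for j
  proof (cases "j \<in> J")
    case True
    have "C j \<subseteq> ?I" using GI[OF True] P BC(3)[of j] V.span_superset[of "B j"] by blast
    then show ?thesis unfolding BC(4) by (rule V.span_minimal) (rule gsubD(6)[OF I])
  next
    case False
    show ?thesis
    proof
      fix v assume v: "v \<in> H j"
      then have v': "v \<in> K" "v \<in> FG n as j" by (auto simp: H_def)
      obtain y where "\<And>l. l < n \<Longrightarrow> y l \<in> K \<inter> FG n as (j - 1)" "v = (\<Sum>l<n. pm (X l) (y l))"
        by (rule kvanish_0D[OF J(2)[OF False] v']) (rule that)
      then have "v \<in> P j" unfolding P_def H_def by blast
      then show "v \<in> ?I" using P by blast
    qed
  qed
  have HI: "H j \<subseteq> ?I" if "j \<le> lo + int d" for d j using that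
  proof (induction d arbitrary: j)
    case 0
    then have 0: "H (j - 1) = {0}"
      using lo[of "j - 1"] V.subspace_0[OF Hs, of "j - 1"] by (auto simp: H_def)
    have "P j \<subseteq> {0}" by (auto simp: P_def 0)
    then show ?case using gsubD(2)[OF I] by (intro PI) blast
  next
    case (Suc d)
    have IH: "H (j - 1) \<subseteq> ?I" using Suc.IH[of "j - 1"] Suc.prems by simp
    show ?case
    proof (intro PI subsetI)
      fix x assume "x \<in> P j"
      then obtain u where u: "\<forall>l<n. u l \<in> H (j - 1)" "x = (\<Sum>l<n. pm (X l) (u l))" unfolding P_def by blast
      show "x \<in> ?I" unfolding u(2)
        by (rule gsub_sum[OF I], rule gsubD(4)[OF I]) (use u(1) IH in auto)
    qed
  qed
  have KI: "K \<subseteq> ?I"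
  proof
    fix v assume v: "v \<in> K"
    obtain D where D: "finite D" "\<And>d. d \<notin> D \<Longrightarrow> hcomp as d v = 0"
      "\<And>E. finite E \<Longrightarrow> D \<subseteq> E \<Longrightarrow> (\<Sum>d\<in>E. hcomp as d v) = v"
      by (rule hcomp_decomp[OF gsubD(1)[OF K v]]) (rule that)
    have "hcomp as d v \<in> ?I" for d
    proof -
      have "hcomp as d v \<in> H d" using gsubD(1,5)[OF K v] by (auto simp: H_def)
      moreover have "d \<le> lo + int (nat (d - lo))" by simp
      ultimately show ?thesis using HI by blast
    qed
    then have "(\<Sum>d\<in>D. hcomp as d v) \<in> ?I" by (intro gsub_sum[OF I])
    then show "v \<in> ?I" using D(3)[OF D(1) subset_refl] by simp
  qed
  have min: "v t \<in> irrelevant_ideal n" if v: "v \<in> FM n bs" "?c v = 0" for v t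
  proof (cases "t < length bs")
    case False
    then show ?thesis using v(1) by (simp add: FM_iff irrelevant_iff)
  next
    case t: True
    define j where "j = bs ! t"
    define u where "u = hcomp bs j v"
    have u: "u \<in> FG n bs j" unfolding u_def using v(1) by blast
    have "?c u = hcomp as j (?c v)" unfolding u_def using hcomp_comb[OF hm v(1)] by simp
    then have cu: "?c u = 0" using v(2) by simp
    have us: "u s \<in> poly_homogeneous n (j - bs ! s)" if "s < length bs" for s
      using u that by (simp add: FG_iff)
    define T where "T = {s. s < length bs \<and> bs ! s = j}"
    define T' where "T' = {s. s < length bs \<and> bs ! s \<noteq> j}"
    have TT: "finite T" "finite T'" "T \<inter> T' = {}" "{..<length bs} = T \<union> T'" by (auto simp: T_def T'_def)
    define x where "x = (\<Sum>s\<in>T. vscale (lk (u s) 0) (G s))"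
    have xT: "x = (\<Sum>s\<in>T. pm (u s) (G s))"
      unfolding x_def vscale_def
    proof (rule sum.cong[OF refl])
      fix s assume "s \<in> T"
      then have "u s \<in> poly_homogeneous n 0" using us[of s] by (auto simp: T_def)
      then show "pm (Con (lk (u s) 0)) (G s) = pm (u s) (G s)" by (metis poly_homogeneous_0D)
    qed
    have "pm (u s) (G s) \<in> P j" if "s \<in> T'" for s
    proof -
      have s: "s < length bs" "j - bs ! s \<noteq> 0" using that by (auto simp: T'_def)
      have "u s = (\<Sum>l<n. X l * dvar l (u s))"
        using var_expand[OF poly_homogeneous_carrier[OF us[OF s(1)]]]
          homogeneous_irrelevant[OF us[OF s(1)] s(2)] by (simp add: irrelevant_iff)
      then have "pm (u s) (G s) = (\<Sum>l<n. pm (X l) (pm (dvar l (u s)) (G s)))"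
        using pm_sum_left[of "\<lambda>l. X l * dvar l (u s)" "{..<n}" "G s"] by simp
      moreover have "pm (dvar l (u s)) (G s) \<in> H (j - 1)" for l
      proof -
        have d: "dvar l (u s) \<in> poly_homogeneous n (j - bs ! s - 1)" using us[OF s(1)] by blast
        have "G s \<in> K" "G s \<in> FG n as (bs ! s)" using GH[OF s(1)] by (auto simp: H_def)
        then show ?thesis
          using FG_pm[OF d] gsubD(4)[OF K poly_homogeneous_carrier[OF d]] by (simp add: H_def)
      qed
      ultimately show ?thesis unfolding P_def mem_Collect_eq
        by (intro exI[of _ "\<lambda>l. pm (dvar l (u s)) (G s)"]) simp
    qed
    then have "(\<Sum>s\<in>T'. pm (u s) (G s)) \<in> P j" by (intro V.subspace_sum[OF Ps])
    moreover have "x + (\<Sum>s\<in>T'. pm (u s) (G s)) = 0"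
      using cu unfolding xT comb_def TT(4) by (simp only: sum.union_disjoint[OF TT(1-3)])
    then have "x = - (\<Sum>s\<in>T'. pm (u s) (G s))" by (simp only: eq_neg_iff_add_eq_0)
    ultimately have "x \<in> V.span (B j)" using V.subspace_neg[OF Ps] BC(3) by metis
    moreover have GC: "G s \<in> C j - B j" if "s \<in> T" for s using nth(2)[of s] that by (auto simp: T_def)
    have "x \<in> V.span (C j - B j)"
      unfolding x_def by (intro V.span_sum V.span_scale V.span_base GC)
    ultimately have x0: "x = 0" using V.independent_span_Diff[OF BC(2,1)] by blast
    have inj: "inj_on G T"
    proof (rule inj_onI)
      fix s s' assume s: "s \<in> T" "s' \<in> T" "G s = G s'"
      then have "ps ! s = ps ! s'" using nth(3)[of s] nth(3)[of s'] by (simp add: T_def)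
      then show "s = s'" using s ps(2) by (simp add: T_def bs_def nth_eq_iff_index_eq)
    qed
    have "(\<Sum>g\<in>G ` T. vscale (lk (u (the_inv_into T G g)) 0) g) = x"
      unfolding x_def sum.reindex[OF inj] by (rule sum.cong[OF refl]) (simp add: the_inv_into_f_f[OF inj])
    then have sum0: "(\<Sum>g\<in>G ` T. vscale (lk (u (the_inv_into T G g)) 0) g) = 0" using x0 by simp
    have tT: "t \<in> T" using t by (simp add: T_def j_def)
    have "G ` T \<subseteq> C j" using GC by blast
    then have "lk (u (the_inv_into T G (G t))) 0 = 0"
      using V.independentD[OF BC(2)[of j] _ _ sum0, of "G t"] TT(1) tT by blast
    then have "lk (u t) 0 = 0" using the_inv_into_f_f[OF inj tT] by simp
    then have "lk (v t) 0 = 0" using t by (simp add: u_def hcomp_def lk_hpart monom_degree_def j_def)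
    then show ?thesis using FM_coeff[OF v(1)] by (simp add: irrelevant_iff)
  qed
  show thesis
    by (rule that[of bs G]) (use nth(1) hm IK KI min in \<open>auto simp: in_set_conv_nth\<close>)
qed

text \<open>Minimality and exactness at \<open>F 1, F 2, ...\<close>; the resolved module is the cokernel of \<open>G 0\<close>.\<close>

definition resolution :: "nat \<Rightarrow> (nat \<Rightarrow> int list) \<Rightarrow> (nat \<Rightarrow> nat \<Rightarrow> nat \<Rightarrow> 'k::field mpoly) \<Rightarrow> bool" where
  "resolution n F G \<longleftrightarrow> (\<forall>q. hmat n (F (Suc q)) (F q) (G q) \<and>
     (\<forall>s<length (F (Suc q)). \<forall>t. G q s t \<in> irrelevant_ideal n) \<and>
     {v \<in> FM n (F (Suc q)). comb (length (F (Suc q))) (G q) v = 0}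
       = comb (length (F (Suc (Suc q)))) (G (Suc q)) ` FM n (F (Suc (Suc q))))"

lemma FG_low_bound: "\<exists>lo. \<forall>d<lo. FG n as d \<subseteq> {0 :: nat \<Rightarrow> 'k::field mpoly}"
proof (intro exI allI impI subsetI)
  fix d and v :: "nat \<Rightarrow> 'k mpoly" assume d: "d < Min (insert 0 (set as))" and v: "v \<in> FG n as d"
  have "d < a" if "a \<in> set as" for a using d that by auto
  then show "v \<in> {0}" using FG_0_if_low[OF v] by blast
qed

text \<open>Iterating minimal covers resolves every submodule of finite colength. The generators of the
  \<open>q\<close>-th syzygy module occur only in degrees where the Koszul homology of \<open>K\<close> does not vanish.\<close>

theorem minimal_resolution_exists:
  fixes K :: "(nat \<Rightarrow> 'k::field mpoly) set"
  assumes K: "gsub n as K" and irr: "\<forall>v\<in>K. \<forall>t. v t \<in> irrelevant_ideal n"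
    and r: "\<forall>d>r. FG n as d \<subseteq> K"
  obtains F G where "F 0 = as" "resolution n F G" "comb (length (F 1)) (G 0) ` FM n (F 1) = K"
    "\<And>q j. j \<in> set (F (Suc q)) \<Longrightarrow> \<not> kvanish n q j as K" "\<And>q. n < q \<Longrightarrow> F q = []"
proof -
  define P where "P q x = (case x of (bs, L, G) \<Rightarrow> gsub n bs L \<and> (\<forall>v\<in>L. \<forall>t. v t \<in> irrelevant_ideal n) \<and>
      (\<forall>i j. kvanish n (i + q) j as K \<longrightarrow> kvanish n i j bs L) \<and> (q = 0 \<longrightarrow> bs = as \<and> L = K))"
    for q and x :: "int list \<times> (nat \<Rightarrow> 'k mpoly) set \<times> (nat \<Rightarrow> nat \<Rightarrow> 'k mpoly)"
  define Q where "Q q x x' = (case x of (bs, L, G) \<Rightarrow> case x' of (bs', L', G') \<Rightarrow>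
      hmat n bs' bs G' \<and> comb (length bs') G' ` FM n bs' = L \<and>
      L' = {v \<in> FM n bs'. comb (length bs') G' v = 0} \<and> (\<forall>j\<in>set bs'. \<not> kvanish n q j as K))"
    for q and x x' :: "int list \<times> (nat \<Rightarrow> 'k mpoly) set \<times> (nat \<Rightarrow> nat \<Rightarrow> 'k mpoly)"
  have van: "kvanish n q j as K" if "j > int q + 1 + r \<or> n \<le> q" for q j
    by (rule kvanish_initial[OF irr r that])
  have init: "\<exists>x. P 0 x" by (rule exI[of _ "(as, K, \<lambda>_ _. 0)"]) (use K irr in \<open>auto simp: P_def\<close>)
  have step: "\<exists>x'. P (Suc q) x' \<and> Q q x x'" if "P q x" for q x
  proof -
    obtain bs L G where x: "x = (bs, L, G)" by (cases x) auto
    have L: "gsub n bs L" "\<And>v t. v \<in> L \<Longrightarrow> v t \<in> irrelevant_ideal n"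
      "\<And>i j. kvanish n (i + q) j as K \<Longrightarrow> kvanish n i j bs L" using that by (auto simp: P_def x)
    obtain lo where lo: "\<And>d. d < lo \<Longrightarrow> FG n bs d \<subseteq> {0 :: nat \<Rightarrow> 'k mpoly}"
      using FG_low_bound by blast
    define J where "J = {j \<in> {lo..int q + 1 + r}. \<not> kvanish n q j as K}"
    have J: "kvanish n 0 j bs L" if "j \<notin> J" for j
    proof (cases "j < lo")
      case True
      then have "v = 0" if "v \<in> FG n bs j" for v :: "nat \<Rightarrow> 'k mpoly" using lo that by blast
      then show ?thesis unfolding kvanish_def
        by (intro allI impI exI[of _ "\<lambda>_. 0"]) (auto simp: koszul_def gsubD(2)[OF L(1)] vset_0)
    next
      case False
      then have "kvanish n q j as K"
        using that van[of q j] by (auto simp: J_def not_le)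
      then show ?thesis using L(3)[of 0 j] by simp
    qed
    obtain bs' G' where bs': "set bs' \<subseteq> J" "hmat n bs' bs G'" "comb (length bs') G' ` FM n bs' = L"
      "\<And>v t. v \<in> FM n bs' \<Longrightarrow> comb (length bs') G' v = 0 \<Longrightarrow> v t \<in> irrelevant_ideal n"
    proof (rule minimal_cover[where lo = lo, OF L(1)])
      show "finite J" unfolding J_def by (rule finite_subset[of _ "{lo..int q + 1 + r}"]) auto
    next
      fix j assume "j \<notin> J" then show "kvanish n 0 j bs L" by (rule J)
    next
      fix d assume "d < lo" then show "FG n bs d \<subseteq> {0 :: nat \<Rightarrow> 'k mpoly}" by (rule lo)
    qed (use that in blast)
    let ?L = "{v \<in> FM n bs'. comb (length bs') G' v = 0}"
    have "P (Suc q) (bs', ?L, G')"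
      unfolding P_def prod.case
    proof (intro conjI allI impI)
      show "gsub n bs' ?L" by (rule gsub_kernel[OF bs'(2)])
    next
      fix i j assume "kvanish n (i + Suc q) j as K"
      then have kv: "kvanish n (Suc i) j bs L" using L(3)[of "Suc i" j] by simp
      show "kvanish n i j bs' ?L"
      proof (rule kvanish_shift[OF bs'(2) bs'(3)[symmetric] _ kv])
        fix v t assume "v \<in> FM n bs'" "comb (length bs') G' v = 0"
        then show "v t \<in> irrelevant_ideal n" by (rule bs'(4))
      qed
    qed (use bs'(4) in auto)
    moreover have "Q q x (bs', ?L, G')" using bs' by (auto simp: Q_def x J_def)
    ultimately show ?thesis by blast
  qed
  obtain f where f: "\<And>q. P q (f q)" "\<And>q. Q q (f q) (f (Suc q))"
    using dependent_nat_choice[of P Q, OF init step] by blast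
  define F where "F q = fst (f q)" for q
  define G where "G q = snd (snd (f (Suc q)))" for q
  define L where "L q = fst (snd (f q))" for q
  have PL: "\<And>v t. v \<in> L q \<Longrightarrow> v t \<in> irrelevant_ideal n" "q = 0 \<Longrightarrow> F q = as \<and> L q = K" for q
    using f(1)[of q] by (auto simp: P_def F_def L_def split: prod.splits)
  have QL: "hmat n (F (Suc q)) (F q) (G q)" "comb (length (F (Suc q))) (G q) ` FM n (F (Suc q)) = L q"
    "L (Suc q) = {v \<in> FM n (F (Suc q)). comb (length (F (Suc q))) (G q) v = 0}"
    "\<And>j. j \<in> set (F (Suc q)) \<Longrightarrow> \<not> kvanish n q j as K" for q
    using f(2)[of q] by (auto simp: Q_def F_def G_def L_def split: prod.splits)
  have "G q s t \<in> irrelevant_ideal n" if s: "s < length (F (Suc q))" for q s t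
  proof -
    have "comb (length (F (Suc q))) (G q) (unit s 1) \<in> L q"
      unfolding QL(2)[symmetric] by (rule imageI) (rule unit_FM[OF s], simp)
    then show ?thesis using PL(1) comb_unit[OF s, of "G q" 1] by simp
  qed
  then have res: "resolution n F G"
    unfolding resolution_def using QL by metis
  have nil: "F q = []" if nq: "n < q" for q
  proof -
    obtain q' where q: "q = Suc q'" using nq by (cases q) auto
    have "kvanish n q' j as K" for j using van[of q' j] nq q by simp
    then show ?thesis using QL(4)[of _ q'] q by (metis list.set_intros(1) neq_Nil_conv)
  qed
  have 0: "F 0 = as" "L 0 = K" using PL(2) by blast+
  show thesis
  proof (rule that[of F G])
    show "comb (length (F 1)) (G 0) ` FM n (F 1) = K" using QL(2)[of 0] 0 by simp
  qed (use 0 res nil QL(4) in blast)+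
qed

section \<open>Euler characteristics and degrees of a minimal resolution\<close>

lemma image_degree:
  assumes "hmat n as bs G"
  shows "comb (length as) G ` FG n as j = comb (length as) G ` FM n as \<inter> FG n bs j"
proof (intro equalityI subsetI)
  fix x assume "x \<in> comb (length as) G ` FG n as j"
  then show "x \<in> comb (length as) G ` FM n as \<inter> FG n bs j" using comb_FG[OF assms] FG_FM by blast
next
  fix x assume x: "x \<in> comb (length as) G ` FM n as \<inter> FG n bs j"
  then obtain v where v: "v \<in> FM n as" "x = comb (length as) G v" by blast
  have "comb (length as) G (hcomp as j v) = hcomp bs j x" using hcomp_comb[OF assms v(1)] v(2) by simp
  also have "\<dots> = x" using x hcomp_of_FG[of x n bs j j] by simp
  finally show "x \<in> comb (length as) G ` FG n as j" using hcomp_FG[OF v(1), of j] by (metis image_eqI)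
qed

definition syz :: "nat \<Rightarrow> (nat \<Rightarrow> int list) \<Rightarrow> (nat \<Rightarrow> nat \<Rightarrow> nat \<Rightarrow> 'k::field mpoly) \<Rightarrow> nat \<Rightarrow> int
    \<Rightarrow> (nat \<Rightarrow> 'k mpoly) set" where
  "syz n F G q j = comb (length (F (Suc q))) (G q) ` FG n (F (Suc q)) j"

lemma resolutionD:
  assumes "resolution n F G"
  shows "hmat n (F (Suc q)) (F q) (G q)" "s < length (F (Suc q)) \<Longrightarrow> G q s t \<in> irrelevant_ideal n"
    "{v \<in> FM n (F (Suc q)). comb (length (F (Suc q))) (G q) v = 0}
       = comb (length (F (Suc (Suc q)))) (G (Suc q)) ` FM n (F (Suc (Suc q)))"
  using assms unfolding resolution_def by blast+

lemma syz_kernel: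
  assumes "resolution n F G"
  shows "syz n F G (Suc q) j = {v \<in> FG n (F (Suc q)) j. comb (length (F (Suc q))) (G q) v = 0}"
  unfolding syz_def image_degree[OF resolutionD(1)[OF assms]] resolutionD(3)[OF assms, symmetric]
  using FG_FM by blast

lemma syz_FG: "resolution n F G \<Longrightarrow> syz n F G q j \<subseteq> FG n (F q) j"
  unfolding syz_def by (metis image_degree resolutionD(1) inf_le2)

lemma syz_subspace: "V.subspace (syz n F G q j)"
proof -
  interpret c: Vector_Spaces.linear vscale vscale "comb (length (F (Suc q))) (G q)" by (rule comb_linear)
  show ?thesis unfolding syz_def by (rule c.subspace_image[OF FG_subspace])
qed

lemma syz_findim: "resolution n F G \<Longrightarrow> V.findim (syz n F G q j)"
  by (rule V.findim_subset[OF findim_FG syz_FG])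

lemma syz_dim:
  assumes "resolution n F G"
  shows "V.dim (syz n F G q j) + V.dim (syz n F G (Suc q) j) = (\<Sum>a\<leftarrow>F (Suc q). Hilb n (j - a))"
  using V.rank_nullity[OF comb_linear[of "length (F (Suc q))" "G q"] FG_subspace[of n "F (Suc q)" j] findim_FG]
  unfolding syz_kernel[OF assms] by (simp add: syz_def dim_FG)

lemma FG_Nil: "FG n [] j = {0}"
  by (auto simp: FG_iff fun_eq_iff)

lemma syz_Nil: "F (Suc q) = [] \<Longrightarrow> V.dim (syz n F G q j) = 0"
  unfolding syz_def using V.dim_le_card[of "{0}" "{}"] by (simp add: FG_Nil)

lemma resolution_kernel_irrelevant:
  assumes "resolution n F G" "v \<in> FM n (F (Suc q))" "comb (length (F (Suc q))) (G q) v = 0"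
  shows "v t \<in> irrelevant_ideal n"
proof -
  have "v \<in> comb (length (F (Suc (Suc q)))) (G (Suc q)) ` FM n (F (Suc (Suc q)))"
    using assms(2,3) resolutionD(3)[OF assms(1)] by blast
  then obtain u where u: "u \<in> FM n (F (Suc (Suc q)))" "v = comb (length (F (Suc (Suc q)))) (G (Suc q)) u" by blast
  show ?thesis unfolding u(2) comb_apply
    by (rule irrelevant_sum, rule irrelevant_mult) (use FM_coeff[OF u(1)] resolutionD(2)[OF assms(1)] in auto)
qed

lemma resolution_column_nonzero:
  assumes "resolution n F G" "s < length (F (Suc q))" shows "G q s \<noteq> 0"
proof
  assume "G q s = 0"
  then have "comb (length (F (Suc q))) (G q) (unit s 1) = 0" using assms(2) by (simp add: comb_unit)
  moreover have "unit s 1 \<in> FM n (F (Suc q))" using assms(2) by (intro unit_FM) auto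
  ultimately have "unit s (1 :: 'a mpoly) s \<in> irrelevant_ideal n"
    using resolution_kernel_irrelevant[OF assms(1)] by blast
  then show False by (simp add: unit_def irrelevant_iff)
qed

lemma FG_irrelevant_low:
  assumes "v \<in> FG n as d" "\<And>t. v t \<in> irrelevant_ideal n" "\<And>a. a \<in> set as \<Longrightarrow> d \<le> a"
  shows "v = 0"
proof
  fix t show "v t = 0 t"
  proof (cases "t < length as")
    case True
    then have h: "v t \<in> poly_homogeneous n (d - as ! t)" using assms(1) by (simp add: FG_iff)
    have "d \<le> as ! t" using True assms(3) by simp
    then consider "d - as ! t < 0" | "d - as ! t = 0" by linarith
    then show ?thesis
    proof cases
      case 1 then show ?thesis using poly_homogeneous_neg[OF h] by simp
    next
      case 2
      then have "v t = Con (lk (v t) 0)" using h by (intro poly_homogeneous_0D[of _ n]) simp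
      then show ?thesis using assms(2)[of t] by (simp add: irrelevant_iff)
    qed
  qed (use assms(1) in \<open>simp add: FG_iff\<close>)
qed

text \<open>By minimality no entry of a matrix is a nonzero constant, so a column of degree at most \<open>m\<close> is zero.\<close>

lemma resolution_degree_bound:
  assumes "resolution n F G" "\<And>a. a \<in> set (F q) \<Longrightarrow> m \<le> a" "b \<in> set (F (Suc q))"
  shows "m + 1 \<le> b"
proof (rule ccontr)
  assume "\<not> m + 1 \<le> b"
  then have b: "b \<le> m" by simp
  obtain s where s: "s < length (F (Suc q))" "F (Suc q) ! s = b" using assms(3) by (auto simp: in_set_conv_nth)
  have "G q s \<in> FG n (F q) b" using resolutionD(1)[OF assms(1), of q] s by (auto simp: hmat_def)
  then have "G q s = 0"
    by (rule FG_irrelevant_low) (use resolutionD(2)[OF assms(1) s(1)] assms(2) b in force)+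
  then show False using resolution_column_nonzero[OF assms(1) s(1)] by simp
qed

text \<open>By minimality the entries of a syzygy have no constant terms, so they have positive degree.\<close>

lemma syz_lowest:
  assumes "resolution n F G" "\<And>a. a \<in> set (F (Suc q)) \<Longrightarrow> j \<le> a"
  shows "syz n F G (Suc q) j = {0}"
proof -
  have "v = 0" if "v \<in> FG n (F (Suc q)) j" "comb (length (F (Suc q))) (G q) v = 0" for v
    using that(1) resolution_kernel_irrelevant[OF assms(1) FG_FM[OF that(1)] that(2)] assms(2)
    by (rule FG_irrelevant_low)
  then show ?thesis unfolding syz_kernel[OF assms(1)] by auto
qed

section \<open>Direct sums of resolutions\<close>

definition glue :: "nat \<Rightarrow> (nat \<Rightarrow> 'k::field mpoly) \<Rightarrow> (nat \<Rightarrow> 'k mpoly) \<Rightarrow> (nat \<Rightarrow> 'k mpoly)" where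
  "glue a u w = (\<lambda>t. if t < a then u t else w (t - a))"

definition left_part :: "nat \<Rightarrow> (nat \<Rightarrow> 'k::field mpoly) \<Rightarrow> (nat \<Rightarrow> 'k mpoly)" where
  "left_part a v = (\<lambda>t. if t < a then v t else 0)"

definition right_part :: "nat \<Rightarrow> (nat \<Rightarrow> 'k::field mpoly) \<Rightarrow> (nat \<Rightarrow> 'k mpoly)" where
  "right_part a v = (\<lambda>t. v (t + a))"

lemma glue_FG: "u \<in> FG n as d \<Longrightarrow> w \<in> FG n bs d \<Longrightarrow> glue (length as) u w \<in> FG n (as @ bs) d"
  by (auto simp: FG_iff glue_def nth_append)

lemma glue_FM: "u \<in> FM n as \<Longrightarrow> w \<in> FM n bs \<Longrightarrow> glue (length as) u w \<in> FM n (as @ bs)"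
  by (auto simp: FM_iff glue_def)

lemma split_FM:
  assumes "v \<in> FM n (as @ bs)"
  shows "left_part (length as) v \<in> FM n as" "right_part (length as) v \<in> FM n bs"
    "v = glue (length as) (left_part (length as) v) (right_part (length as) v)"
  using assms by (auto simp: FM_iff glue_def left_part_def right_part_def fun_eq_iff)

lemma glue_0_iff:
  assumes "u \<in> FM n as" shows "glue (length as) u w = 0 \<longleftrightarrow> u = 0 \<and> w = 0"
proof
  assume j: "glue (length as) u w = 0"
  have "u t = 0" for t using fun_cong[OF j, of t] assms by (cases "t < length as") (auto simp: glue_def FM_iff)
  moreover have "w t = 0" for t using fun_cong[OF j, of "t + length as"] by (simp add: glue_def)
  ultimately show "u = 0 \<and> w = 0" by (auto simp: fun_eq_iff)
qed (simp add: glue_def fun_eq_iff)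

text \<open>The matrices \<open>G\<close>, with \<open>a\<close> rows and \<open>r\<close> columns, and \<open>H\<close> on the diagonal.\<close>

definition block_diag :: "nat \<Rightarrow> nat \<Rightarrow> (nat \<Rightarrow> nat \<Rightarrow> 'k::field mpoly) \<Rightarrow> (nat \<Rightarrow> nat \<Rightarrow> 'k mpoly)
    \<Rightarrow> nat \<Rightarrow> nat \<Rightarrow> 'k mpoly" where
  "block_diag a r G H s = (if s < r then glue a (G s) 0 else glue a 0 (H (s - r)))"

lemma comb_block_diag:
  assumes "hmat n bs as G"
  shows "comb (length bs + m) (block_diag (length as) (length bs) G H) (glue (length bs) u w)
     = glue (length as) (comb (length bs) G u) (comb m H w)"
proof
  fix t
  let ?r = "length bs" and ?a = "length as"
  have "comb (?r + m) (block_diag ?a ?r G H) (glue ?r u w) t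
      = (\<Sum>s<?r. u s * glue ?a (G s) 0 t) + (\<Sum>s<m. w s * glue ?a 0 (H s) t)"
  proof -
    have "comb (?r + m) (block_diag ?a ?r G H) (glue ?r u w) t = (\<Sum>s<?r + m. glue ?r u w s * block_diag ?a ?r G H s t)"
      by (simp add: comb_apply)
    also have "{..<?r + m} = {..<?r} \<union> (\<lambda>s. s + ?r) ` {..<m}"
    proof (intro equalityI subsetI)
      fix x assume "x \<in> {..<?r + m}"
      then show "x \<in> {..<?r} \<union> (\<lambda>s. s + ?r) ` {..<m}"
        by (cases "x < ?r") (auto intro!: image_eqI[of x _ "x - ?r"])
    qed auto
    also have "(\<Sum>s\<in>\<dots>. glue ?r u w s * block_diag ?a ?r G H s t)
        = (\<Sum>s<?r. glue ?r u w s * block_diag ?a ?r G H s t)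
          + (\<Sum>s\<in>(\<lambda>s. s + ?r) ` {..<m}. glue ?r u w s * block_diag ?a ?r G H s t)"
      by (rule sum.union_disjoint) auto
    also have "(\<Sum>s\<in>(\<lambda>s. s + ?r) ` {..<m}. glue ?r u w s * block_diag ?a ?r G H s t) = (\<Sum>s<m. w s * glue ?a 0 (H s) t)"
      by (subst sum.reindex) (auto simp: inj_on_def glue_def block_diag_def)
    also have "(\<Sum>s<?r. glue ?r u w s * block_diag ?a ?r G H s t) = (\<Sum>s<?r. u s * glue ?a (G s) 0 t)"
      by (rule sum.cong) (auto simp: glue_def block_diag_def)
    finally show ?thesis .
  qed
  then show "comb (?r + m) (block_diag ?a ?r G H) (glue ?r u w) t = glue ?a (comb ?r G u) (comb m H w) t"
    by (simp add: glue_def comb_apply)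
qed

lemma resolution_direct_sum:
  assumes "resolution n F G" "resolution n F' G'"
  shows "resolution n (\<lambda>q. F q @ F' q) (\<lambda>q. block_diag (length (F q)) (length (F (Suc q))) (G q) (G' q))"
    (is "resolution n ?F ?G")
  unfolding resolution_def
proof (intro allI conjI impI)
  fix q
  note h = resolutionD(1)[OF assms(1)] and h' = resolutionD(1)[OF assms(2)]
  let ?r = "\<lambda>q. length (F q)" and ?r' = "\<lambda>q. length (F' q)"
  show "hmat n (?F (Suc q)) (?F q) (?G q)"
    unfolding hmat_def block_diag_def
    using h[of q] h'[of q] by (auto simp: hmat_def nth_append intro!: glue_FG)
  show "?G q s t \<in> irrelevant_ideal n" if "s < length (?F (Suc q))" for s t
    using that resolutionD(2)[OF assms(1), of s q] resolutionD(2)[OF assms(2), of "s - ?r (Suc q)" q]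
    by (auto simp: block_diag_def glue_def irrelevant_iff)
  have c: "comb (length (?F (Suc q))) (?G q) (glue (?r (Suc q)) u w)
      = glue (?r q) (comb (?r (Suc q)) (G q) u) (comb (?r' (Suc q)) (G' q) w)" for q u w
    using comb_block_diag[OF h[of q]] by simp
  show "{v \<in> FM n (?F (Suc q)). comb (length (?F (Suc q))) (?G q) v = 0}
      = comb (length (?F (Suc (Suc q)))) (?G (Suc q)) ` FM n (?F (Suc (Suc q)))"
  proof (intro equalityI subsetI)
    fix v assume "v \<in> {v \<in> FM n (?F (Suc q)). comb (length (?F (Suc q))) (?G q) v = 0}"
    then have v: "v \<in> FM n (?F (Suc q))" "comb (length (?F (Suc q))) (?G q) v = 0" by auto
    define u where "u = left_part (?r (Suc q)) v"
    define w where "w = right_part (?r (Suc q)) v"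
    have uw: "u \<in> FM n (F (Suc q))" "w \<in> FM n (F' (Suc q))" "v = glue (?r (Suc q)) u w"
      using split_FM[OF v(1)] by (simp_all add: u_def w_def)
    have "comb (?r (Suc q)) (G q) u = 0 \<and> comb (?r' (Suc q)) (G' q) w = 0"
      using v(2) unfolding uw(3) c glue_0_iff[OF comb_FM[OF h uw(1)]] .
    then have "u \<in> comb (?r (Suc (Suc q))) (G (Suc q)) ` FM n (F (Suc (Suc q)))"
      "w \<in> comb (?r' (Suc (Suc q))) (G' (Suc q)) ` FM n (F' (Suc (Suc q)))"
      using uw(1,2) unfolding resolutionD(3)[OF assms(1), of q, symmetric]
        resolutionD(3)[OF assms(2), of q, symmetric] by simp_all
    then obtain u' w' where uw': "u' \<in> FM n (F (Suc (Suc q)))" "w' \<in> FM n (F' (Suc (Suc q)))"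
      "u = comb (?r (Suc (Suc q))) (G (Suc q)) u'" "w = comb (?r' (Suc (Suc q))) (G' (Suc q)) w'" by blast
    have veq: "v = comb (length (?F (Suc (Suc q)))) (?G (Suc q)) (glue (?r (Suc (Suc q))) u' w')"
      unfolding uw(3) uw'(3,4) c ..
    show "v \<in> comb (length (?F (Suc (Suc q)))) (?G (Suc q)) ` FM n (?F (Suc (Suc q)))"
      unfolding veq by (rule imageI) (rule glue_FM[OF uw'(1,2)])
  next
    fix v assume "v \<in> comb (length (?F (Suc (Suc q)))) (?G (Suc q)) ` FM n (?F (Suc (Suc q)))"
    then obtain x where x: "x \<in> FM n (?F (Suc (Suc q)))" "v = comb (length (?F (Suc (Suc q)))) (?G (Suc q)) x" by blast
    define u where "u = left_part (?r (Suc (Suc q))) x"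
    define w where "w = right_part (?r (Suc (Suc q))) x"
    have uw: "u \<in> FM n (F (Suc (Suc q)))" "w \<in> FM n (F' (Suc (Suc q)))" "x = glue (?r (Suc (Suc q))) u w"
      using split_FM[OF x(1)] by (simp_all add: u_def w_def)
    let ?u = "comb (?r (Suc (Suc q))) (G (Suc q)) u" and ?w = "comb (?r' (Suc (Suc q))) (G' (Suc q)) w"
    have v: "v = glue (?r (Suc q)) ?u ?w" using x(2) uw(3) c by simp
    have "?u \<in> {v \<in> FM n (F (Suc q)). comb (?r (Suc q)) (G q) v = 0}"
      unfolding resolutionD(3)[OF assms(1), of q] by (rule imageI[OF uw(1)])
    moreover have "?w \<in> {v \<in> FM n (F' (Suc q)). comb (?r' (Suc q)) (G' q) v = 0}"
      unfolding resolutionD(3)[OF assms(2), of q] by (rule imageI[OF uw(2)])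
    ultimately show "v \<in> {v \<in> FM n (?F (Suc q)). comb (length (?F (Suc q))) (?G q) v = 0}"
      unfolding v mem_Collect_eq c using glue_FM[of ?u n "F (Suc q)" ?w "F' (Suc q)"]
      by (simp add: glue_def fun_eq_iff)
  qed
qed

(* the record fields mult and smult of a module are meant from here on *)
hide_const (open) Multiset.mult Polynomial.smult

section \<open>Quotients of graded free modules\<close>

lemma poly_ring_simps [simp]:
  "carrier (poly_ring n) = poly_carrier n" "f \<otimes>\<^bsub>poly_ring n\<^esub> g = f * g" "\<one>\<^bsub>poly_ring n\<^esub> = 1"
  "\<zero>\<^bsub>poly_ring n\<^esub> = 0" "f \<oplus>\<^bsub>poly_ring n\<^esub> g = f + g"
  by (simp_all add: poly_ring_def)

lemma poly_ring_cring: "cring (poly_ring n :: 'k::field mpoly ring)"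
proof (rule cringI)
  show "abelian_group (poly_ring n :: 'k mpoly ring)"
  proof (rule abelian_groupI)
    fix x :: "'k mpoly" assume "x \<in> carrier (poly_ring n)"
    then show "\<exists>y\<in>carrier (poly_ring n). y \<oplus>\<^bsub>poly_ring n\<^esub> x = \<zero>\<^bsub>poly_ring n\<^esub>"
      by (intro bexI[of _ "- x"]) auto
  qed (auto simp: add_ac)
  show "comm_monoid (poly_ring n :: 'k mpoly ring)"
    by (rule comm_monoidI) (auto simp: mult_ac)
qed (auto simp: distrib_right)

context
  fixes n as and K :: "(nat \<Rightarrow> 'k::field mpoly) set"
  assumes K: "gsub n as K"
begin

text \<open>The coset of \<open>v\<close> modulo \<open>K\<close>, and the quotient of the free module by \<open>K\<close> on these cosets. Multiplication
  by \<open>f\<close> adds \<open>K\<close> to the multiples, as \<open>f\<close> times a coset is only a part of a coset.\<close>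

definition cs :: "(nat \<Rightarrow> 'k mpoly) \<Rightarrow> (nat \<Rightarrow> 'k mpoly) set" where
  "cs v = {u. u - v \<in> K}"

definition qmod :: "('k mpoly, (nat \<Rightarrow> 'k mpoly) set) module" where
  "qmod = \<lparr>carrier = cs ` FM n as, mult = undefined, one = undefined, zero = cs 0,
     add = (\<lambda>A B. {a + b |a b. a \<in> A \<and> b \<in> B}), smult = (\<lambda>f A. {u. \<exists>a\<in>A. u - pm f a \<in> K})\<rparr>"

lemma K_diff: "u \<in> K \<Longrightarrow> v \<in> K \<Longrightarrow> u - v \<in> K"
  using gsubD(6)[OF K] V.subspace_diff by blast

lemma cs_eq_iff: "cs u = cs v \<longleftrightarrow> u - v \<in> K"
proof
  assume "cs u = cs v"
  moreover have "u \<in> cs u" using gsubD(2)[OF K] by (simp add: cs_def)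
  ultimately show "u - v \<in> K" by (simp add: cs_def)
next
  assume uv: "u - v \<in> K"
  have "w - u \<in> K \<longleftrightarrow> w - v \<in> K" for w
    using gsubD(3)[OF K _ uv, of "w - u"] K_diff[OF _ uv, of "w - v"] by auto
  then show "cs u = cs v" by (simp add: cs_def)
qed

lemma cs_add: "cs u \<oplus>\<^bsub>qmod\<^esub> cs v = cs (u + v)"
proof -
  have "{a + b |a b. a \<in> cs u \<and> b \<in> cs v} = cs (u + v)"
  proof (intro equalityI subsetI)
    fix x assume "x \<in> {a + b |a b. a \<in> cs u \<and> b \<in> cs v}"
    then obtain a b where ab: "x = a + b" "a - u \<in> K" "b - v \<in> K" by (auto simp: cs_def)
    have eq: "x - (u + v) = (a - u) + (b - v)" unfolding ab(1) by (rule add_diff_add)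
    show "x \<in> cs (u + v)" unfolding cs_def mem_Collect_eq eq by (rule gsubD(3)[OF K ab(2,3)])
  next
    fix x assume "x \<in> cs (u + v)"
    then have "x - v - u \<in> K" by (simp add: cs_def diff_diff_eq add.commute)
    moreover have "x = (x - v) + v" by (rule diff_add_cancel[symmetric])
    moreover have "v - v \<in> K" using gsubD(2)[OF K] by simp
    ultimately show "x \<in> {a + b |a b. a \<in> cs u \<and> b \<in> cs v}" unfolding cs_def by blast
  qed
  then show ?thesis by (simp add: qmod_def)
qed

lemma cs_smult: "f \<in> poly_carrier n \<Longrightarrow> f \<odot>\<^bsub>qmod\<^esub> cs v = cs (pm f v)"
proof -
  assume f: "f \<in> poly_carrier n"
  have "{u. \<exists>a\<in>cs v. u - pm f a \<in> K} = cs (pm f v)"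
  proof (intro equalityI subsetI)
    fix u assume "u \<in> {u. \<exists>a\<in>cs v. u - pm f a \<in> K}"
    then obtain a where a: "u - pm f a \<in> K" "a - v \<in> K" by (auto simp: cs_def)
    have "u - pm f v = (u - pm f a) + pm f (a - v)" by (simp only: pm_simps) simp
    then show "u \<in> cs (pm f v)" using gsubD(3)[OF K a(1) gsubD(4)[OF K f a(2)]] by (simp add: cs_def)
  next
    fix u assume "u \<in> cs (pm f v)"
    moreover have "v \<in> cs v" using gsubD(2)[OF K] by (simp add: cs_def)
    ultimately show "u \<in> {u. \<exists>a\<in>cs v. u - pm f a \<in> K}" unfolding cs_def by blast
  qed
  then show ?thesis by (simp add: qmod_def)
qed

lemma qmod_carrier: "carrier qmod = cs ` FM n as" and qmod_zero: "\<zero>\<^bsub>qmod\<^esub> = cs 0"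
  by (simp_all add: qmod_def)

lemma cs_zero_iff: "cs v = \<zero>\<^bsub>qmod\<^esub> \<longleftrightarrow> v \<in> K"
  by (simp add: qmod_zero cs_eq_iff)

lemma qmod_abelian_group: "abelian_group qmod"
proof (rule abelian_groupI)
  fix x assume "x \<in> carrier qmod"
  then obtain v where v: "v \<in> FM n as" "x = cs v" by (auto simp: qmod_carrier)
  then show "\<exists>y\<in>carrier qmod. y \<oplus>\<^bsub>qmod\<^esub> x = \<zero>\<^bsub>qmod\<^esub>"
    by (intro bexI[of _ "cs (- v)"]) (auto simp: cs_add qmod_zero qmod_carrier)
next
  fix x assume "x \<in> carrier qmod"
  then show "\<zero>\<^bsub>qmod\<^esub> \<oplus>\<^bsub>qmod\<^esub> x = x" by (auto simp: cs_add qmod_zero qmod_carrier)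
next
  fix x y z assume "x \<in> carrier qmod" "y \<in> carrier qmod" "z \<in> carrier qmod"
  then show "x \<oplus>\<^bsub>qmod\<^esub> y \<oplus>\<^bsub>qmod\<^esub> z = x \<oplus>\<^bsub>qmod\<^esub> (y \<oplus>\<^bsub>qmod\<^esub> z)"
    by (auto simp: cs_add qmod_carrier add.assoc)
next
  fix x y assume "x \<in> carrier qmod" "y \<in> carrier qmod"
  then show "x \<oplus>\<^bsub>qmod\<^esub> y = y \<oplus>\<^bsub>qmod\<^esub> x" by (auto simp: cs_add qmod_carrier add.commute)
qed (auto simp: cs_add qmod_carrier qmod_zero)

lemma qmod_module: "module (poly_ring n) qmod"
proof (rule moduleI[OF poly_ring_cring qmod_abelian_group])
  fix a :: "'k mpoly" and x assume "a \<in> carrier (poly_ring n)" "x \<in> carrier qmod"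
  then show "a \<odot>\<^bsub>qmod\<^esub> x \<in> carrier qmod" by (auto simp: qmod_carrier cs_smult)
next
  fix a b :: "'k mpoly" and x
  assume "a \<in> carrier (poly_ring n)" "b \<in> carrier (poly_ring n)" "x \<in> carrier qmod"
  then show "(a \<oplus>\<^bsub>poly_ring n\<^esub> b) \<odot>\<^bsub>qmod\<^esub> x = a \<odot>\<^bsub>qmod\<^esub> x \<oplus>\<^bsub>qmod\<^esub> b \<odot>\<^bsub>qmod\<^esub> x"
    by (auto simp: qmod_carrier cs_smult cs_add pm_add_left)
next
  fix a :: "'k mpoly" and x y
  assume "a \<in> carrier (poly_ring n)" "x \<in> carrier qmod" "y \<in> carrier qmod"
  then show "a \<odot>\<^bsub>qmod\<^esub> (x \<oplus>\<^bsub>qmod\<^esub> y) = a \<odot>\<^bsub>qmod\<^esub> x \<oplus>\<^bsub>qmod\<^esub> a \<odot>\<^bsub>qmod\<^esub> y"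
    by (auto simp: qmod_carrier cs_smult cs_add)
next
  fix a b :: "'k mpoly" and x
  assume "a \<in> carrier (poly_ring n)" "b \<in> carrier (poly_ring n)" "x \<in> carrier qmod"
  then show "a \<otimes>\<^bsub>poly_ring n\<^esub> b \<odot>\<^bsub>qmod\<^esub> x = a \<odot>\<^bsub>qmod\<^esub> (b \<odot>\<^bsub>qmod\<^esub> x)"
    by (auto simp: qmod_carrier cs_smult)
next
  fix x assume "x \<in> carrier qmod"
  then show "\<one>\<^bsub>poly_ring n\<^esub> \<odot>\<^bsub>qmod\<^esub> x = x" by (auto simp: qmod_carrier cs_smult)
qed

lemma qmod_finsum:
  assumes "finite D" "\<And>d. d \<in> D \<Longrightarrow> v d \<in> FM n as"
  shows "(\<Oplus>\<^bsub>qmod\<^esub>d\<in>D. cs (v d)) = cs (\<Sum>d\<in>D. v d)"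
proof -
  interpret abelian_group qmod by (rule qmod_abelian_group)
  show ?thesis using assms
  proof (induction D rule: finite_induct)
    case empty then show ?case by (simp only: sum.empty finsum_empty qmod_zero)
  next
    case (insert x D)
    have "(\<Oplus>\<^bsub>qmod\<^esub>d\<in>insert x D. cs (v d)) = cs (v x) \<oplus>\<^bsub>qmod\<^esub> (\<Oplus>\<^bsub>qmod\<^esub>d\<in>D. cs (v d))"
      by (rule finsum_insert) (use insert in \<open>auto simp: qmod_carrier\<close>)
    also have "\<dots> = cs (v x + (\<Sum>d\<in>D. v d))" using insert by (simp add: cs_add)
    finally show ?case by (simp only: sum.insert[OF insert.hyps])
  qed
qed

lemma qmod_subgroup:
  "subgroup (cs ` FG n as d) (add_monoid qmod)"
proof -
  interpret abelian_group qmod by (rule qmod_abelian_group)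
  show ?thesis
  proof
    fix x assume "x \<in> cs ` FG n as d"
    then obtain v where v: "v \<in> FG n as d" "x = cs v" by blast
    have "\<ominus>\<^bsub>qmod\<^esub> cs v = cs (- v)"
      by (rule minus_equality) (use FG_FM[OF v(1)] in \<open>auto simp: cs_add qmod_zero qmod_carrier\<close>)
    then show "inv\<^bsub>add_monoid qmod\<^esub> x \<in> cs ` FG n as d" using v by (auto simp: a_inv_def)
  next
    fix x y assume "x \<in> cs ` FG n as d" "y \<in> cs ` FG n as d"
    then show "x \<otimes>\<^bsub>add_monoid qmod\<^esub> y \<in> cs ` FG n as d" by (auto simp: cs_add)
  qed (auto simp: qmod_carrier qmod_zero dest: FG_FM)
qed

lemma qmod_decomposition:
  assumes "x \<in> carrier qmod"
  shows "\<exists>!c. (\<forall>d. c d \<in> cs ` FG n as d) \<and> finite {d. c d \<noteq> \<zero>\<^bsub>qmod\<^esub>} \<and>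
    x = (\<Oplus>\<^bsub>qmod\<^esub>d\<in>{d. c d \<noteq> \<zero>\<^bsub>qmod\<^esub>}. c d)"
proof -
  obtain v where v: "v \<in> FM n as" "x = cs v" using assms by (auto simp: qmod_carrier)
  obtain D where D: "finite D" "\<And>d. d \<notin> D \<Longrightarrow> hcomp as d v = 0"
    "\<And>E. finite E \<Longrightarrow> D \<subseteq> E \<Longrightarrow> (\<Sum>d\<in>E. hcomp as d v) = v"
    by (rule hcomp_decomp[OF v(1)]) (rule that)
  let ?c = "\<lambda>d. cs (hcomp as d v)"
  let ?E = "{d. ?c d \<noteq> \<zero>\<^bsub>qmod\<^esub>}"
  have ED: "?E \<subseteq> D" using D(2) gsubD(2)[OF K] by (force simp: cs_zero_iff)
  show ?thesis
  proof (rule ex1I[of _ ?c], intro conjI allI)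
    show "?c d \<in> cs ` FG n as d" for d using v(1) by blast
    show fE: "finite ?E" using ED D(1) by (rule finite_subset)
    have "(\<Sum>d\<in>D. hcomp as d v) - (\<Sum>d\<in>?E. hcomp as d v) = (\<Sum>d\<in>D - ?E. hcomp as d v)"
      using sum.subset_diff[OF ED D(1), of "\<lambda>d. hcomp as d v"] by (simp only: add_diff_cancel_right')
    also have "\<dots> \<in> K" by (rule gsub_sum[OF K]) (auto simp: cs_zero_iff)
    finally have "cs v = cs (\<Sum>d\<in>?E. hcomp as d v)" using D(3)[OF D(1)] by (simp add: cs_eq_iff)
    also have "\<dots> = (\<Oplus>\<^bsub>qmod\<^esub>d\<in>?E. ?c d)"
      by (rule qmod_finsum[symmetric, OF fE]) (use v(1) FG_FM in blast)
    finally show "x = (\<Oplus>\<^bsub>qmod\<^esub>d\<in>?E. ?c d)" unfolding v(2) .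
  next
    fix c assume c: "(\<forall>d. c d \<in> cs ` FG n as d) \<and> finite {d. c d \<noteq> \<zero>\<^bsub>qmod\<^esub>} \<and>
        x = (\<Oplus>\<^bsub>qmod\<^esub>d\<in>{d. c d \<noteq> \<zero>\<^bsub>qmod\<^esub>}. c d)"
    then have "\<forall>d. \<exists>u. u \<in> FG n as d \<and> c d = cs u" by blast
    then obtain u where u: "\<And>d. u d \<in> FG n as d" "\<And>d. c d = cs (u d)" by metis
    define C where "C = {d. c d \<noteq> \<zero>\<^bsub>qmod\<^esub>}"
    have C: "finite C" "x = (\<Oplus>\<^bsub>qmod\<^esub>d\<in>C. c d)" using c by (simp_all add: C_def)
    have "x = (\<Oplus>\<^bsub>qmod\<^esub>d\<in>C. cs (u d))" unfolding C(2) u(2) ..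
    also have "\<dots> = cs (\<Sum>d\<in>C. u d)" by (rule qmod_finsum[OF C(1)]) (rule FG_FM[OF u(1)])
    finally have *: "(\<Sum>d\<in>C. u d) - v \<in> K" using v(2) by (metis cs_eq_iff)
    show "c = ?c"
    proof
      fix d
      have "hcomp as d ((\<Sum>d\<in>C. u d) - v) \<in> K" by (rule gsubD(5)[OF K *])
      also have "hcomp as d ((\<Sum>d\<in>C. u d) - v) = (\<Sum>e\<in>C. hcomp as d (u e)) - hcomp as d v"
        using hcomp_add[of as d "(\<Sum>d\<in>C. u d) - v" v] by (simp add: hcomp_sum eq_diff_eq)
      also have "(\<Sum>e\<in>C. hcomp as d (u e)) = (\<Sum>e\<in>C. if d = e then u e else 0)"
        using hcomp_of_FG[OF u(1)] by (intro sum.cong) auto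
      also have "\<dots> = (if d \<in> C then u d else 0)" using C(1) by simp
      finally have 1: "(if d \<in> C then u d else 0) - hcomp as d v \<in> K" .
      show "c d = ?c d"
      proof (cases "d \<in> C")
        case True
        then show ?thesis using 1 by (simp add: u(2) cs_eq_iff)
      next
        case False
        then have "c d = cs 0" using qmod_zero by (simp add: C_def)
        then show ?thesis using 1 False by (simp add: cs_eq_iff)
      qed
    qed
  qed
qed

lemma qmod_graded: "graded_module n qmod (\<lambda>d. cs ` FG n as d)"
  unfolding graded_module_def
proof (intro conjI allI ballI)
  fix e d and f :: "'k mpoly" and x assume f: "f \<in> poly_homogeneous n e" and "x \<in> cs ` FG n as d"
  then obtain v where v: "v \<in> FG n as d" "x = cs v" by blast
  show "f \<odot>\<^bsub>qmod\<^esub> x \<in> cs ` FG n as (e + d)"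
    unfolding v(2) cs_smult[OF poly_homogeneous_carrier[OF f]] using FG_pm[OF f v(1) refl] by blast
qed (use qmod_module qmod_subgroup qmod_decomposition in auto)

lemma qmod_fg: "finitely_generated n qmod"
  unfolding finitely_generated_def
proof (intro exI conjI allI impI)
  let ?A = "(\<lambda>t. cs (unit t 1)) ` {..<length as}"
  show "finite ?A" by simp
  show "?A \<subseteq> carrier qmod" by (auto simp: qmod_carrier intro!: imageI unit_FM)
  fix N assume N: "submodule N (poly_ring n) qmod \<and> ?A \<subseteq> N"
  then have sub: "subgroup N (add_monoid qmod)" and sm: "\<And>f x. f \<in> poly_carrier n \<Longrightarrow> x \<in> N \<Longrightarrow> f \<odot>\<^bsub>qmod\<^esub> x \<in> N"
    by (auto simp: submodule_def submodule_axioms_def)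
  have "cs (\<Sum>t\<in>T. unit t (v t)) \<in> N" if "finite T" "T \<subseteq> {..<length as}" "v \<in> FM n as" for T v
    using that
  proof (induction T rule: finite_induct)
    case empty
    have "\<zero>\<^bsub>qmod\<^esub> \<in> N" using subgroup.one_closed[OF sub] by simp
    then show ?case by (simp only: sum.empty qmod_zero)
  next
    case (insert t T)
    have "v t \<odot>\<^bsub>qmod\<^esub> cs (unit t 1) \<in> N" using N insert FM_coeff by (intro sm) auto
    then have "cs (unit t (v t)) \<in> N" using cs_smult[OF FM_coeff[OF insert.prems(2)]] by simp
    moreover have "cs (\<Sum>t\<in>T. unit t (v t)) \<in> N" using insert by simp
    ultimately have "cs (unit t (v t)) \<oplus>\<^bsub>qmod\<^esub> cs (\<Sum>t\<in>T. unit t (v t)) \<in> N"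
      using subgroup.m_closed[OF sub] by simp
    then show ?case by (simp only: sum.insert[OF insert.hyps] cs_add)
  qed
  then have "cs v \<in> N" if "v \<in> FM n as" for v
    using unit_expand[OF that] that by (metis finite_lessThan subset_refl)
  then show "N = carrier qmod" using subgroup.subset[OF sub] by (auto simp: qmod_carrier)
qed

lemma qmod_hom: "graded_hom n (free_module n as) (FG n as) qmod (\<lambda>d. cs ` FG n as d) cs"
  unfolding graded_hom_def
proof (intro conjI ballI allI)
  fix x y :: "nat \<Rightarrow> 'k mpoly"
  show "cs (x \<oplus>\<^bsub>free_module n as\<^esub> y) = cs x \<oplus>\<^bsub>qmod\<^esub> cs y"
    unfolding cs_add by (simp add: free_module_def plus_fun_def)
next
  fix f :: "'k mpoly" and x :: "nat \<Rightarrow> 'k mpoly" assume "f \<in> poly_carrier n"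
  then show "cs (f \<odot>\<^bsub>free_module n as\<^esub> x) = f \<odot>\<^bsub>qmod\<^esub> cs x"
    by (simp add: cs_smult free_module_def pm_def)
qed (auto simp: qmod_carrier)

end

section \<open>Betti diagrams and resolutions\<close>

definition betti :: "(nat \<Rightarrow> int list) \<Rightarrow> diagram" where
  "betti F = (\<lambda>i j. of_nat (count_list (F i) j))"

lemma betti_nonzero: "betti F i j \<noteq> 0 \<longleftrightarrow> j \<in> set (F i)"
  by (simp add: betti_def count_list_0_iff)

text \<open>Homomorphisms of degree \<open>0\<close> between graded free modules are matrices, and the module is recovered
  as the cokernel of the first one, realized on cosets.\<close>

theorem B_mod_iff:
  "b \<in> B_mod TYPE('k::field) n p dl du \<longleftrightarrow>
    (\<exists>F (G :: nat \<Rightarrow> nat \<Rightarrow> nat \<Rightarrow> 'k mpoly). resolution n F G \<and> b = betti F \<and>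
      (\<forall>i. \<forall>j\<in>set (F i). i \<le> p \<and> int (dl i) \<le> j \<and> j \<le> int (du i)))" (is "_ \<longleftrightarrow> ?R")
proof
  assume "b \<in> B_mod TYPE('k::field) n p dl du"
  then obtain M :: "('k mpoly, (nat \<Rightarrow> 'k mpoly) set) module" and Gr
    where b: "is_betti_diagram n M Gr b" "\<forall>i j. b i j \<noteq> 0 \<longrightarrow> i \<le> p \<and> int (dl i) \<le> j \<and> j \<le> int (du i)"
    unfolding B_mod_def by blast
  then obtain F \<phi> \<epsilon> where F: "minimal_graded_free_resolution n M Gr F \<phi> \<epsilon>"
    and bF: "b = (\<lambda>i j. of_nat (count_list (F i) j))"
    unfolding is_betti_diagram_def by blast
  define G where "G q = (\<lambda>s. \<phi> q (unit s (1 :: 'k mpoly)))" for q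
  have h: "graded_hom n (free_module n (F (Suc q))) (FG n (F (Suc q))) (free_module n (F q)) (FG n (F q)) (\<phi> q)"
    and ex: "{v \<in> FM n (F (Suc q)). \<phi> q v = 0} = \<phi> (Suc q) ` FM n (F (Suc (Suc q)))" for q
    using F unfolding minimal_graded_free_resolution_def graded_free_resolution_def zero_fun_def by blast+
  have hm: "hmat n (F (Suc q)) (F q) (G q)" for q unfolding G_def by (rule graded_hom_comb(1)[OF h])
  have eq: "\<phi> q v = comb (length (F (Suc q))) (G q) v" if "v \<in> FM n (F (Suc q))" for q v
    unfolding G_def by (rule graded_hom_comb(2)[OF h that])
  have "resolution n F G"
    unfolding resolution_def
  proof (intro allI conjI impI)
    fix q s t assume "s < length (F (Suc q))"
    then have "unit s 1 \<in> FM n (F (Suc q))" by (intro unit_FM) auto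
    then show "G q s t \<in> irrelevant_ideal n"
      using F unfolding minimal_graded_free_resolution_def G_def by blast
  next
    fix q
    have "{v \<in> FM n (F (Suc q)). comb (length (F (Suc q))) (G q) v = 0} = {v \<in> FM n (F (Suc q)). \<phi> q v = 0}"
      using eq by auto
    also have "\<dots> = comb (length (F (Suc (Suc q)))) (G (Suc q)) ` FM n (F (Suc (Suc q)))"
      unfolding ex by (rule image_cong[OF refl]) (rule eq)
    finally show "{v \<in> FM n (F (Suc q)). comb (length (F (Suc q))) (G q) v = 0}
        = comb (length (F (Suc (Suc q)))) (G (Suc q)) ` FM n (F (Suc (Suc q)))" .
  qed (rule hm)
  moreover have "b = betti F" unfolding bF betti_def ..
  ultimately show ?R using b(2) betti_nonzero by blast
next
  assume ?R
  then obtain F and G :: "nat \<Rightarrow> nat \<Rightarrow> nat \<Rightarrow> 'k mpoly" where F: "resolution n F G" "b = betti F"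
    "\<And>i j. j \<in> set (F i) \<Longrightarrow> i \<le> p \<and> int (dl i) \<le> j \<and> j \<le> int (du i)" by blast
  let ?c = "\<lambda>q. comb (length (F (Suc q))) (G q)"
  define K where "K = ?c 0 ` FM n (F 1)"
  have K: "gsub n (F 0) K" unfolding K_def One_nat_def by (rule gsub_image[OF resolutionD(1)[OF F(1)]])
  let ?M = "qmod n (F 0) K" and ?G = "\<lambda>d. cs K ` FG n (F 0) d"
  have res: "graded_free_resolution n ?M ?G F ?c (cs K)"
    unfolding graded_free_resolution_def
  proof (intro conjI allI)
    show "{v \<in> FM n (F 0). cs K v = \<zero>\<^bsub>?M\<^esub>} = ?c 0 ` FM n (F 1)"
      unfolding K_def[symmetric] using gsubD(1)[OF K] by (auto simp: cs_zero_iff[OF K])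
  next
    fix i show "{v \<in> FM n (F (Suc i)). ?c i v = (\<lambda>t. 0)} = ?c (Suc i) ` FM n (F (Suc (Suc i)))"
      using resolutionD(3)[OF F(1), of i] by (simp add: zero_fun_def)
  qed (use qmod_hom[OF K] graded_hom_of_comb[OF resolutionD(1)[OF F(1)]] qmod_carrier[OF K] in auto)
  have "minimal_graded_free_resolution n ?M ?G F ?c (cs K)"
    unfolding minimal_graded_free_resolution_def
  proof (intro conjI res allI ballI)
    fix i t and v :: "nat \<Rightarrow> 'k mpoly" assume v: "v \<in> FM n (F (Suc i))"
    show "?c i v t \<in> irrelevant_ideal n" unfolding comb_apply
      by (rule irrelevant_sum, rule irrelevant_mult) (use FM_coeff[OF v] resolutionD(2)[OF F(1)] in auto)
  qed
  then have "is_betti_diagram n ?M ?G b" unfolding is_betti_diagram_def F(2) betti_def by blast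
  moreover have "F i = []" if "p < i" for i
    using F(3)[of _ i] that by (metis leD list.set_intros(1) neq_Nil_conv)
  then have "projective_dimension_le n ?M ?G p" unfolding projective_dimension_le_def using res by blast
  moreover have "\<forall>i j. b i j \<noteq> 0 \<longrightarrow> i \<le> p \<and> int (dl i) \<le> j \<and> j \<le> int (du i)"
    unfolding F(2) betti_nonzero using F(3) by blast
  ultimately show "b \<in> B_mod TYPE('k) n p dl du"
    unfolding B_mod_def mem_Collect_eq using qmod_graded[OF K] qmod_fg[OF K] by blast
qed

lemma B_mod_add:
  assumes "b \<in> B_mod TYPE('k::field) n p dl du" "b' \<in> B_mod TYPE('k) n p dl du"
  shows "b + b' \<in> B_mod TYPE('k) n p dl du"
proof -
  obtain F F' and G G' :: "nat \<Rightarrow> nat \<Rightarrow> nat \<Rightarrow> 'k mpoly" where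
    "resolution n F G" "b = betti F" "\<forall>i. \<forall>j\<in>set (F i). i \<le> p \<and> int (dl i) \<le> j \<and> j \<le> int (du i)"
    "resolution n F' G'" "b' = betti F'" "\<forall>i. \<forall>j\<in>set (F' i). i \<le> p \<and> int (dl i) \<le> j \<and> j \<le> int (du i)"
    using assms unfolding B_mod_iff by blast
  moreover have "betti F + betti F' = betti (\<lambda>i. F i @ F' i)" by (simp add: betti_def fun_eq_iff)
  ultimately show ?thesis
    unfolding B_mod_iff using resolution_direct_sum by (intro exI[of _ "\<lambda>i. F i @ F' i"]) fastforce
qed

section \<open>Modules over three variables with generators in degree 0 that vanish in degree 2\<close>

definition lin :: "(nat \<Rightarrow> 'k::field mpoly) \<Rightarrow> nat \<Rightarrow> nat \<Rightarrow> 'k" where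
  "lin v t l = lk (v t) (Poly_Mapping.single l 1)"

lemma lk_mult_single:
  fixes f g :: "'k::field mpoly"
  assumes "f \<in> poly_carrier n" "lk g 0 = 0" "l < n"
  shows "lk (f * g) (Poly_Mapping.single l 1) = lk f 0 * lk g (Poly_Mapping.single l 1)"
proof -
  let ?m = "Poly_Mapping.single l (1::nat)"
  have "f * g = (\<Sum>l<n. X l * (dvar l f * g)) + Con (lk f 0) * g"
    by (subst var_expand[OF assms(1)]) (simp add: distrib_right sum_distrib_right mult.assoc)
  then have eq: "lk (f * g) ?m = (\<Sum>i<n. lk (X i * (dvar i f * g)) ?m) + lk f 0 * lk g ?m"
    by (simp add: lookup_add lookup_sum)
  have "lk (X i * (dvar i f * g)) ?m = 0" for i
    by (cases "i = l") (simp_all add: lk_X_mult lk_mult_0 assms(2) lookup_single when_def)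
  then show ?thesis unfolding eq by simp
qed

lemma lin_simps:
  "lin (u + v) t l = lin u t l + lin v t l" "lin (vscale c v) t l = c * lin v t l" "lin 0 t l = 0"
  "lin (unit s f) t l = (if t = s then lk f (Poly_Mapping.single l 1) else 0)"
  by (auto simp: lin_def lookup_add vscale_def pm_apply unit_def)

lemma lk_X: "lk (X l :: 'k::field mpoly) m = (if m = Poly_Mapping.single l 1 then 1 else 0)"
  by (auto simp: X_def lookup_single when_def)

lemma single_1_eq_iff: "Poly_Mapping.single a (1::nat) = Poly_Mapping.single b 1 \<longleftrightarrow> a = b"
    "Poly_Mapping.single a (Suc 0) = Poly_Mapping.single b (Suc 0) \<longleftrightarrow> a = b"
  by (metis One_nat_def lookup_single_eq lookup_single_not_eq zero_neq_one)+

text \<open>A module with generators in degree \<open>0\<close> that vanishes in degree \<open>2\<close> is determined by the linear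
  relations; these are the linear vectors annihilated by the functionals \<open>\<Lambda> 0, ..., \<Lambda> (w - 1)\<close>, which
  thus are a basis of the dual of the part of degree \<open>1\<close>.\<close>

definition K1 :: "nat \<Rightarrow> nat \<Rightarrow> (nat \<Rightarrow> (nat \<Rightarrow> 'k::field mpoly) \<Rightarrow> 'k) \<Rightarrow> (nat \<Rightarrow> 'k mpoly) set" where
  "K1 a w \<Lambda> = {v \<in> FM 3 (replicate a 0). (\<forall>t. lk (v t) 0 = 0) \<and> (\<forall>s<w. \<Lambda> s v = 0)}"

text \<open>The letters \<open>a, b, c, e\<close> stand for the homological degrees \<open>0, 1, 2, 3\<close>, the digits for the internal
  degrees. A module that lives in degrees \<open>0\<close> and \<open>1\<close>, is generated in degree \<open>0\<close> and has no socle there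
  has a diagram of this form.\<close>

definition dgm :: "nat \<Rightarrow> nat \<Rightarrow> nat \<Rightarrow> nat \<Rightarrow> nat \<Rightarrow> nat \<Rightarrow> diagram" where
  "dgm a b1 b2 c2 c3 e4 = (\<lambda>i j. of_nat (if i = 0 \<and> j = 0 then a else if i = 1 \<and> j = 1 then b1
     else if i = 1 \<and> j = 2 then b2 else if i = 2 \<and> j = 2 then c2 else if i = 2 \<and> j = 3 then c3
     else if i = 3 \<and> j = 4 then e4 else 0))"

lemma sum_list_two_values:
  assumes "set xs \<subseteq> {d, d + 1 :: int}"
  shows "(\<Sum>a\<leftarrow>xs. f a) = count_list xs d * f d + count_list xs (d + 1) * (f (d + 1) :: nat)"
  using assms by (induction xs) auto

lemma Hilb_3: "Hilb 3 1 = 3" "Hilb 3 2 = 6" "Hilb 3 3 = 10" "Hilb 3 4 = 15"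
  using Hilb_nat[of 3 1] Hilb_nat[of 3 2] Hilb_nat[of 3 3] Hilb_nat[of 3 4]
  by (simp_all add: numeral_eq_Suc)

lemma kvanish_trivial: "gsub n as K \<Longrightarrow> K \<inter> FG n as (j - int i) \<subseteq> {0} \<Longrightarrow> kvanish n i j as K"
  unfolding kvanish_def
  by (intro allI impI exI[of _ "\<lambda>_. 0"]) (auto simp: koszul_def gsubD(2))

text \<open>The Koszul homology that produces third syzygies of degree 3 consists of the generators killed
  by all variables.\<close>

lemma kvanish_no_socle:
  fixes K :: "(nat \<Rightarrow> 'k::field mpoly) set"
  assumes K: "gsub 3 as K"
    and nk: "\<And>v. v \<in> FG 3 as 0 \<Longrightarrow> (\<And>l. l < 3 \<Longrightarrow> pm (X l) v \<in> K) \<Longrightarrow> v = 0"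
  shows "kvanish 3 2 3 as K"
  unfolding kvanish_def
proof (intro allI impI, elim conjE)
  fix z :: "nat set \<Rightarrow> nat \<Rightarrow> 'k mpoly"
  assume z: "\<forall>A. vset 3 2 A \<longrightarrow> z A \<in> K \<inter> FG 3 as (3 - int 2)"
    and cyc: "\<forall>A. 0 < (2::nat) \<longrightarrow> vset 3 (2 - 1) A \<longrightarrow> koszul 3 z A = 0"
  obtain y where y: "\<And>A. vset 3 (Suc 2) A \<Longrightarrow> y A \<in> FG 3 as (3 - int 2 - 1)"
    "\<And>A. vset 3 2 A \<Longrightarrow> koszul 3 y A = z A"
    by (rule koszul_exact[of 3 2 z as "3 - int 2"]) (use z cyc in auto)
  have v: "y {..<3} \<in> FG 3 as 0" using y(1)[of "{..<3}"] by (simp add: vset_def)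
  have k: "koszul 3 y ({..<3} - {l}) = pm (sg l ({..<3} - {l}) * X l) (y {..<3})" if "l < 3" for l
  proof -
    have "{..<3} - ({..<3} - {l}) = {l}" "insert l ({..<3} - {l}) = {..<3}" using that by auto
    then show ?thesis by (simp add: koszul_def)
  qed
  have "y {..<3} = 0"
  proof (rule nk[OF v])
    fix l :: nat assume l: "l < 3"
    let ?A = "{..<3} - {l}"
    have A: "vset 3 2 ?A" using l by (auto simp: vset_def)
    have "z ?A \<in> K" using z A by blast
    then have zK: "pm (sg l ?A * X l) (y {..<3}) \<in> K" using y(2)[OF A] k[OF l] by simp
    have "sg l ?A * sg l ?A = (1 :: 'k mpoly)"
      by (simp add: sg_def power_mult_distrib[symmetric] Con_simps(4)[symmetric] del: Con_simps(4))
    then have "pm (X l) (y {..<3}) = pm (sg l ?A) (pm (sg l ?A * X l) (y {..<3}))"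
      by (simp add: mult.assoc[symmetric])
    also have "\<dots> \<in> K"
      using gsubD(4)[OF K poly_homogeneous_carrier[OF sg_carrier] zK] .
    finally show "pm (X l) (y {..<3}) \<in> K" .
  qed
  moreover have "\<exists>l<3. A = {..<3} - {l}" if "vset 3 2 A" for A
  proof -
    have "card ({..<3} - A) = 1"
      using that vset_finite[OF that] by (auto simp: vset_def card_Diff_subset)
    then obtain l where l: "{..<3} - A = {l}" by (rule card_1_singletonE)
    have "A = {..<3} - ({..<3} - A)" using that by (auto simp: vset_def)
    then show ?thesis using l by (intro exI[of _ l]) auto
  qed
  ultimately have "z A = 0" if "vset 3 2 A" for A using y(2)[OF that] k that by (metis pm_simps(1))
  then show "\<exists>w. (\<forall>A. vset 3 (Suc 2) A \<longrightarrow> w A \<in> K \<inter> FG 3 as (3 - int (Suc 2))) \<and>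
        (\<forall>A. vset 3 2 A \<longrightarrow> koszul 3 w A = z A)"
    by (intro exI[of _ "\<lambda>_. 0"]) (simp add: koszul_def gsubD(2)[OF K])
qed

text \<open>The linear functionals \<open>\<Lambda> s\<close> depend only on linear coefficients and are independent, and no vector of
  degree \<open>0\<close> is sent into the relations by all variables.\<close>

locale two_step =
  fixes a w :: nat and \<Lambda> :: "nat \<Rightarrow> (nat \<Rightarrow> 'k::field mpoly) \<Rightarrow> 'k"
  assumes add: "\<And>s u v. \<Lambda> s (u + v) = \<Lambda> s u + \<Lambda> s v"
    and lin_only: "\<And>s u v c. (\<And>t l. t < a \<Longrightarrow> l < 3 \<Longrightarrow> lin u t l = c * lin v t l) \<Longrightarrow> \<Lambda> s u = c * \<Lambda> s v"
    and dual: "\<And>s. s < w \<Longrightarrow> \<exists>v\<in>FG 3 (replicate a 0) 1. \<forall>s'<w. \<Lambda> s' v = (if s' = s then 1 else 0)"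
    and no_socle: "\<And>v. v \<in> FG 3 (replicate a 0) 0 \<Longrightarrow> (\<And>l s. l < 3 \<Longrightarrow> s < w \<Longrightarrow> \<Lambda> s (pm (X l) v) = 0) \<Longrightarrow> v = 0"
begin

abbreviation "as \<equiv> replicate a (0::int)"
abbreviation "K \<equiv> K1 a w \<Lambda>"

lemma scale: "\<Lambda> s (vscale c v) = c * \<Lambda> s v"
  by (rule lin_only) (simp add: lin_simps)

lemma zero: "\<Lambda> s 0 = 0"
  using lin_only[of 0 0 0 s] by (simp add: lin_simps)

lemma K_gsub: "gsub 3 as K"
  unfolding gsub_def
proof (intro conjI ballI allI)
  fix f :: "'k mpoly" and u assume f: "f \<in> poly_carrier 3" and u: "u \<in> K"
  have "\<Lambda> s (pm f u) = lk f 0 * \<Lambda> s u" for s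
    by (rule lin_only) (use u lk_mult_single[OF f] in \<open>simp add: lin_def pm_apply K1_def\<close>)
  then show "pm f u \<in> K" using u f by (auto simp: K1_def pm_apply lk_mult_0)
next
  fix u d assume u: "u \<in> K"
  have "\<Lambda> s (hcomp as d u) = (if d = 1 then 1 else 0) * \<Lambda> s u" for s
    by (rule lin_only) (simp add: lin_def hcomp_def lk_hpart)
  moreover have "hcomp as d u \<in> FM 3 as" using u by (intro FG_FM[OF hcomp_FG]) (simp add: K1_def)
  moreover have "lk (hcomp as d u t) 0 = 0" for t
    using u by (auto simp: K1_def hcomp_def lk_hpart)
  ultimately show "hcomp as d u \<in> K" using u by (auto simp: K1_def)
qed (auto simp: K1_def zero add lookup_add)

lemma K_high: "d > 1 \<Longrightarrow> FG 3 as d \<subseteq> K"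
proof
  fix v :: "nat \<Rightarrow> 'k mpoly" assume d: "d > 1" and v: "v \<in> FG 3 as d"
  have lv: "lk (v t) m = 0" if "int (monom_degree m) < d" for t m
  proof (cases "t < a")
    case True
    then have "v t \<in> poly_homogeneous 3 d" using v by (simp add: FG_iff)
    then show ?thesis using that by (auto simp: poly_homogeneous_iff)
  qed (use v in \<open>simp add: FG_iff\<close>)
  have "\<Lambda> s v = 0 * \<Lambda> s 0" for s by (rule lin_only) (simp add: lin_def lv d)
  then show "v \<in> K" using FG_FM[OF v] lv[of 0] d by (simp add: K1_def monom_degree_def)
qed

lemma dim_K_1: "V.dim (K \<inter> FG 3 as 1) + w = 3 * a"
proof -
  define f where "f v = (\<lambda>s. if s < w then Con (\<Lambda> s v) else 0)" for v :: "nat \<Rightarrow> 'k mpoly"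
  have f: "Vector_Spaces.linear vscale vscale f"
    by unfold_locales (auto simp: f_def fun_eq_iff add scale vscale_def pm_apply
        scale[unfolded vscale_def])
  interpret f: Vector_Spaces.linear vscale vscale f by (rule f)
  have "f ` FG 3 as 1 = FG 3 (replicate w 0) 0"
  proof (intro equalityI subsetI)
    fix x assume "x \<in> f ` FG 3 as 1"
    then show "x \<in> FG 3 (replicate w 0) 0" by (auto simp: f_def FG_iff)
  next
    fix x :: "nat \<Rightarrow> 'k mpoly" assume x: "x \<in> FG 3 (replicate w 0) 0"
    from dual obtain e where e: "\<And>s. s < w \<Longrightarrow> e s \<in> FG 3 as 1"
      "\<And>s s'. s < w \<Longrightarrow> s' < w \<Longrightarrow> \<Lambda> s' (e s) = (if s' = s then 1 else 0)" by metis
    let ?v = "\<Sum>s<w. vscale (lk (x s) 0) (e s)"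
    have "f ?v = (\<Sum>s<w. vscale (lk (x s) 0) (f (e s)))" by (simp only: f.sum f.scale)
    also have "\<dots> = x"
    proof
      fix t show "(\<Sum>s<w. vscale (lk (x s) 0) (f (e s))) t = x t"
      proof (cases "t < w")
        case True
        then have "(\<Sum>s<w. vscale (lk (x s) 0) (f (e s))) t = (\<Sum>s<w. if s = t then Con (lk (x s) 0) else 0)"
          unfolding sum_fun_apply by (intro sum.cong) (auto simp: vscale_def pm_apply f_def e(2))
        also have "\<dots> = Con (lk (x t) 0)" using True by simp
        also have "\<dots> = x t" using x True by (intro poly_homogeneous_0D[of _ 3, symmetric]) (simp add: FG_iff)
        finally show ?thesis .
      next
        case False
        then show ?thesis using x by (simp add: sum_fun_apply vscale_def pm_apply f_def FG_iff)
      qed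
    qed
    finally show "x \<in> f ` FG 3 as 1"
      using e(1) by (intro image_eqI[of _ _ ?v]) (auto intro!: FG_sum FG_vscale)
  qed
  moreover have "{v \<in> FG 3 as 1. f v = 0} = K \<inter> FG 3 as 1"
  proof -
    have "lk (v t) 0 = 0" if "v \<in> FG 3 as 1" for v :: "nat \<Rightarrow> 'k mpoly" and t
      using that homogeneous_irrelevant[of "v t" 3 1] by (cases "t < a") (auto simp: FG_iff irrelevant_iff)
    moreover have "f v = 0 \<longleftrightarrow> (\<forall>s<w. \<Lambda> s v = 0)" for v
    proof
      assume 0: "f v = 0"
      show "\<forall>s<w. \<Lambda> s v = 0"
      proof (intro allI impI)
        fix s assume "s < w"
        then have "Con (\<Lambda> s v) = 0" using fun_cong[OF 0, of s] by (simp add: f_def)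
        then have "lk (Con (\<Lambda> s v)) 0 = 0" by simp
        then show "\<Lambda> s v = 0" by (simp add: lk_Con)
      qed
    qed (simp add: f_def fun_eq_iff)
    ultimately show ?thesis by (auto simp: K1_def FG_FM)
  qed
  ultimately have "V.dim (FG 3 as 1 :: (nat \<Rightarrow> 'k mpoly) set)
      = V.dim (FG 3 (replicate w 0) 0 :: (nat \<Rightarrow> 'k mpoly) set) + V.dim (K \<inter> FG 3 as 1)"
    using V.rank_nullity[OF f FG_subspace[of 3 as 1] findim_FG] by simp
  then show ?thesis by (simp add: dim_FG Hilb_3 sum_list_replicate)
qed

text \<open>The Koszul homology confines the resolution to the six positions of the diagram, the last one by
  \<open>no_socle\<close>. The Euler characteristics in degrees \<open>1\<close> to \<open>4\<close> then determine all Betti numbers from \<open>a\<close>,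
  \<open>w\<close> and one of the two numbers that may cancel in degree \<open>2\<close>.\<close>

theorem betti_two_step:
  obtains F and G :: "nat \<Rightarrow> nat \<Rightarrow> nat \<Rightarrow> 'k mpoly" and b1 b2 c2 c3
  where "resolution 3 F G" "betti F = dgm a b1 b2 c2 c3 w"
    "b1 + w = 3 * a" "b2 + 3 * a = 3 * w + c2" "c3 + a = 3 * w"
    "kvanish 3 1 2 as K \<Longrightarrow> c2 = 0" "kvanish 3 0 2 as K \<Longrightarrow> b2 = 0"
proof -
  have irr: "\<forall>v\<in>K. \<forall>t. v t \<in> irrelevant_ideal 3"
    using FM_coeff by (auto simp: K1_def irrelevant_iff)
  have high: "\<forall>d>1. FG 3 as d \<subseteq> K" using K_high by blast
  obtain F G where F: "F 0 = as" "resolution 3 F G" "comb (length (F 1)) (G 0) ` FM 3 (F 1) = K"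
    "\<And>q j. j \<in> set (F (Suc q)) \<Longrightarrow> \<not> kvanish 3 q j as K" "\<And>q. 3 < q \<Longrightarrow> F q = []"
    by (rule minimal_resolution_exists[OF K_gsub irr high]) (rule that)
  have up: "b \<le> int q + 2" if "b \<in> set (F (Suc q))" for q b
  proof (rule ccontr)
    assume "\<not> b \<le> int q + 2"
    then have "kvanish 3 q b as K" by (intro kvanish_initial[OF irr high]) auto
    then show False using F(4)[OF that] by simp
  qed
  have l1: "1 \<le> b" if "b \<in> set (F 1)" for b
    using resolution_degree_bound[OF F(2), of 0 0 b] that by (auto simp: F(1))
  have l2: "2 \<le> b" if "b \<in> set (F 2)" for b
    using resolution_degree_bound[OF F(2), of 1 1 b] that l1 by (auto simp: numeral_2_eq_2)
  have l3: "3 \<le> b" if "b \<in> set (F 3)" for b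
    using resolution_degree_bound[OF F(2), of 2 2 b] that l2 by (auto simp: numeral_3_eq_3)
  have s1: "set (F 1) \<subseteq> {1, 1 + 1}" using l1 up[of _ 0] by fastforce
  have s2: "set (F 2) \<subseteq> {2, 2 + 1}" using l2 up[of _ 1] by (fastforce simp: numeral_2_eq_2)
  have "kvanish 3 2 3 as K"
  proof (rule kvanish_no_socle[OF K_gsub])
    fix v assume "v \<in> FG 3 as 0" "\<And>l. l < 3 \<Longrightarrow> pm (X l) v \<in> K"
    then show "v = 0" by (intro no_socle) (auto simp: K1_def)
  qed
  then have "3 \<notin> set (F 3)" using F(4)[of 3 2] by (auto simp: numeral_3_eq_3)
  moreover have "b \<le> 4" if "b \<in> set (F 3)" for b using up[of b 2] that by simp
  ultimately have "b = 4" if "b \<in> set (F 3)" for b using l3[of b] that by (cases "b = 3") force+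
  then have s3: "set (F 3) \<subseteq> {4}" by blast
  define b1 b2 c2 c3 e4 where "b1 = count_list (F 1) 1" and "b2 = count_list (F 1) 2"
    and "c2 = count_list (F 2) 2" and "c3 = count_list (F 2) 3" and "e4 = count_list (F 3) 4"
  define k where "k q j = V.dim (syz 3 F G q j)" for q j
  have k0: "syz 3 F G 0 j = K \<inter> FG 3 as j" for j
    unfolding syz_def using image_degree[OF resolutionD(1)[OF F(2)], of 0 j] F(1,3) by simp
  have k01: "k 0 1 + w = 3 * a" unfolding k_def k0 by (rule dim_K_1)
  have k0j: "k 0 j = a * Hilb 3 j" if "j > 1" for j
  proof -
    have "K \<inter> FG 3 as j = FG 3 as j" using K_high[OF that] by blast
    then show ?thesis unfolding k_def k0 by (simp add: dim_FG sum_list_replicate)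
  qed
  have E1: "k 0 j + k 1 j = b1 * Hilb 3 (j - 1) + b2 * Hilb 3 (j - 2)" for j
    using syz_dim[OF F(2), of 0 j] sum_list_two_values[OF s1, of "\<lambda>a. Hilb 3 (j - a)"]
    by (simp add: k_def b1_def b2_def)
  have E2: "k 1 j + k 2 j = c2 * Hilb 3 (j - 2) + c3 * Hilb 3 (j - 3)" for j
    using syz_dim[OF F(2), of 1 j] sum_list_two_values[OF s2, of "\<lambda>a. Hilb 3 (j - a)"]
    by (simp add: k_def c2_def c3_def numeral_2_eq_2)
  have "(\<Sum>a\<leftarrow>F 3. Hilb 3 (j - a)) = e4 * Hilb 3 (j - 4)" for j
  proof -
    have "count_list (F 3) (4 + 1) = 0" using s3 by (auto simp: count_list_0_iff)
    then show ?thesis using sum_list_two_values[of "F 3" 4 "\<lambda>a. Hilb 3 (j - a)"] s3 by (auto simp: e4_def)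
  qed
  then have E3: "k 2 j = e4 * Hilb 3 (j - 4)" for j
    using syz_dim[OF F(2), of 2 j] syz_Nil[of F 3 3 G j] F(5)[of "Suc 3"] by (simp add: k_def numeral_3_eq_3)
  have n1: "b1 + w = 3 * a"
    using E1[of 1] E2[of 1] E3[of 1] k01 by (simp add: Hilb_neg)
  moreover have n2: "b2 + 3 * a = 3 * w + c2"
    using E1[of 2] E2[of 2] E3[of 2] k0j[of 2] n1 by (simp add: Hilb_neg Hilb_3)
  moreover have n3: "c3 + a = 3 * w"
    using E1[of 3] E2[of 3] E3[of 3] k0j[of 3] n1 n2 by (simp add: Hilb_neg Hilb_3)
  moreover have n4: "e4 = w"
    using E1[of 4] E2[of 4] E3[of 4] k0j[of 4] n1 n2 n3 by (simp add: Hilb_neg Hilb_3)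
  moreover have "betti F = dgm a b1 b2 c2 c3 w"
  proof (rule ext, rule ext)
    fix i :: nat and j
    consider "i = 0" | "i = 1" | "i = 2" | "i = 3" | "i > 3" by linarith
    then show "betti F i j = dgm a b1 b2 c2 c3 w i j"
    proof cases
      case 1
      have "count_list (replicate a (0::int)) j = (if j = 0 then a else 0)" by (induction a) auto
      then show ?thesis using 1 by (simp add: betti_def dgm_def F(1))
    next
      case 2
      then have "count_list (F i) j = 0" if "j \<noteq> 1" "j \<noteq> 2" using that s1 by (auto simp: count_list_0_iff)
      then show ?thesis using 2 by (auto simp: betti_def dgm_def b1_def b2_def)
    next
      case 3
      then have "count_list (F i) j = 0" if "j \<noteq> 2" "j \<noteq> 3" using that s2 by (auto simp: count_list_0_iff)
      then show ?thesis using 3 by (auto simp: betti_def dgm_def c2_def c3_def)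
    next
      case 4
      then have "count_list (F i) j = 0" if "j \<noteq> 4" using that s3 by (auto simp: count_list_0_iff)
      then show ?thesis using 4 n4 by (auto simp: betti_def dgm_def e4_def)
    next
      case 5 then show ?thesis using F(5) by (simp add: betti_def dgm_def)
    qed
  qed
  moreover have "c2 = 0" if "kvanish 3 1 2 as K"
    using F(4)[of 2 1] that by (auto simp: c2_def count_list_0_iff numeral_2_eq_2)
  moreover have "b2 = 0" if "kvanish 3 0 2 as K"
    using F(4)[of 2 0] that by (auto simp: b2_def count_list_0_iff)
  ultimately show thesis using that[OF F(2), of b1 b2 c2 c3] by blast
qed

end

section \<open>Examples in three variables\<close>

lemma linear_form_expand:
  assumes "f \<in> poly_homogeneous n 1"
  shows "f = (\<Sum>l<n. X l * Con (lk f (Poly_Mapping.single l 1)))"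
proof -
  have "dvar l f = Con (lk f (Poly_Mapping.single l 1))" for l
    using poly_homogeneous_0D[of "dvar l f" n] dvar_homogeneous[OF assms, of l] by (simp add: lk_dvar)
  moreover have "lk f 0 = 0" using homogeneous_irrelevant[OF assms] by (simp add: irrelevant_iff)
  ultimately show ?thesis using var_expand[OF poly_homogeneous_carrier[OF assms]] by simp
qed

lemma linear_vector_eq_0:
  assumes "v \<in> FG n (replicate a 0) 1" "\<And>t l. t < a \<Longrightarrow> l < n \<Longrightarrow> lin v t l = 0"
  shows "v = 0"
proof
  fix t show "v t = 0 t"
  proof (cases "t < a")
    case True
    then have "v t \<in> poly_homogeneous n 1" using assms(1) by (simp add: FG_iff)
    from linear_form_expand[OF this] show ?thesis using assms(2)[OF True] by (simp add: lin_def)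
  qed (use assms(1) in \<open>simp add: FG_iff\<close>)
qed

lemma lin_X_mult:
  "v \<in> FG n (replicate a 0) 0 \<Longrightarrow> lin (pm (X l) v) t m = (if m = l then lk (v t) 0 else 0)"
  by (auto simp: lin_def pm_apply lk_X_mult lookup_single when_def)

lemma const_vector_eq_0:
  assumes "v \<in> FG n (replicate a 0) 0" "\<And>t. t < a \<Longrightarrow> lk (v t) 0 = 0" shows "v = 0"
proof
  fix t show "v t = 0 t"
  proof (cases "t < a")
    case True
    then have "v t \<in> poly_homogeneous n 0" using assms(1) by (simp add: FG_iff)
    from poly_homogeneous_0D[OF this] show ?thesis using assms(2)[OF True] by simp
  qed (use assms(1) in \<open>simp add: FG_iff\<close>)
qed

text \<open>The degree sequences \<open>(0, 1, 2, 4)\<close> and \<open>(0, 2, 3, 4)\<close>, whose window consists of the positions of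
  \<open>dgm\<close>.\<close>

definition window_lo :: "nat \<Rightarrow> nat" where "window_lo i = (if i = 3 then 4 else i)"
definition window_hi :: "nat \<Rightarrow> nat" where "window_hi i = (if i = 0 then 0 else i + 1)"

lemma window: "degree_bounds 3 window_lo window_hi"
  by (auto simp: degree_bounds_def degree_sequence_def window_lo_def window_hi_def)

lemma dgm_in_B_mod:
  fixes G :: "nat \<Rightarrow> nat \<Rightarrow> nat \<Rightarrow> 'k::field mpoly"
  assumes "resolution 3 F G" "betti F = dgm a b1 b2 c2 c3 e4"
  shows "dgm a b1 b2 c2 c3 e4 \<in> B_mod TYPE('k) 3 3 window_lo window_hi"
proof -
  have "i \<le> 3 \<and> int (window_lo i) \<le> j \<and> j \<le> int (window_hi i)" if "j \<in> set (F i)" for i j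
    using that unfolding betti_nonzero[symmetric] assms(2)
    by (auto simp: dgm_def window_lo_def window_hi_def split: if_splits)
  then show ?thesis unfolding B_mod_iff using assms by metis
qed

text \<open>The ring modulo the square of the irrelevant ideal: there are no linear relations, and the functionals
  are the coefficients of the variables.\<close>

lemma square_zero_in_B_mod: "dgm 1 0 6 0 8 3 \<in> B_mod TYPE('k::field) 3 3 window_lo window_hi"
proof -
  define \<Lambda> where "\<Lambda> s v = (if s < 3 then lin v 0 s else 0)" for s and v :: "nat \<Rightarrow> 'k mpoly"
  interpret two_step 1 3 \<Lambda>
  proof
    show "\<Lambda> s (u + v) = \<Lambda> s u + \<Lambda> s v" for s u v by (simp add: \<Lambda>_def lin_simps)
    show "\<Lambda> s u = c * \<Lambda> s v" if "\<And>t l. t < 1 \<Longrightarrow> l < 3 \<Longrightarrow> lin u t l = c * lin v t l" for s u v c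
      using that[of 0 s] by (simp add: \<Lambda>_def)
    show "\<exists>v\<in>FG 3 (replicate 1 0) 1. \<forall>s'<3. \<Lambda> s' v = (if s' = s then 1 else 0)" if "s < 3" for s
      using that by (intro bexI[of _ "unit 0 (X s)"]) (auto simp: \<Lambda>_def lin_simps lk_X single_1_eq_iff intro!: unit_FG)
    show "v = 0" if v: "v \<in> FG 3 (replicate 1 0) 0" and 0: "\<And>l s. l < 3 \<Longrightarrow> s < 3 \<Longrightarrow> \<Lambda> s (pm (X l) v) = 0" for v
      using 0[of 0 0] by (intro const_vector_eq_0[OF v]) (simp add: \<Lambda>_def lin_X_mult[OF v])
  qed
  have "K \<inter> FG 3 as 1 \<subseteq> {0}"
    using linear_vector_eq_0[of _ 3 1] by (fastforce simp: K1_def \<Lambda>_def)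
  then have "kvanish 3 1 2 as K" by (intro kvanish_trivial[OF K_gsub]) simp
  then obtain F and G :: "nat \<Rightarrow> nat \<Rightarrow> nat \<Rightarrow> 'k mpoly" and b1 b2 c2 c3
    where F: "resolution 3 F G" "betti F = dgm 1 b1 b2 c2 c3 3"
    "b1 + 3 = 3 * 1" "b2 + 3 * 1 = 3 * 3 + c2" "c3 + 1 = 3 * 3" "c2 = 0"
    using betti_two_step by metis
  then have "b1 = 0" "b2 = 6" "c2 = 0" "c3 = 8" by auto
  then show ?thesis using dgm_in_B_mod[OF F(1,2)] by simp
qed

text \<open>The further quotient by \<open>x\<^sub>0\<close>, which is the only linear relation. One relation has no linear syzygy,
  because multiplication by a linear form is injective.\<close>

lemma square_zero_quotient_in_B_mod: "dgm 1 1 3 0 5 2 \<in> B_mod TYPE('k::field) 3 3 window_lo window_hi"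
proof -
  define \<Lambda> where "\<Lambda> s v = (if s < 2 then lin v 0 (Suc s) else 0)" for s and v :: "nat \<Rightarrow> 'k mpoly"
  interpret two_step 1 2 \<Lambda>
  proof
    show "\<Lambda> s (u + v) = \<Lambda> s u + \<Lambda> s v" for s u v by (simp add: \<Lambda>_def lin_simps)
    show "\<Lambda> s u = c * \<Lambda> s v" if "\<And>t l. t < 1 \<Longrightarrow> l < 3 \<Longrightarrow> lin u t l = c * lin v t l" for s u v c
      using that[of 0 "Suc s"] by (simp add: \<Lambda>_def)
    show "\<exists>v\<in>FG 3 (replicate 1 0) 1. \<forall>s'<2. \<Lambda> s' v = (if s' = s then 1 else 0)" if "s < 2" for s
      using that by (intro bexI[of _ "unit 0 (X (Suc s))"])
        (auto simp: \<Lambda>_def lin_simps lk_X single_1_eq_iff intro!: unit_FG)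
    show "v = 0" if v: "v \<in> FG 3 (replicate 1 0) 0" and 0: "\<And>l s. l < 3 \<Longrightarrow> s < 2 \<Longrightarrow> \<Lambda> s (pm (X l) v) = 0" for v
      using 0[of 1 0] by (intro const_vector_eq_0[OF v]) (simp add: \<Lambda>_def lin_X_mult[OF v])
  qed
  have mult: "\<exists>c. v = unit 0 (Con c * X 0)" if v: "v \<in> K \<inter> FG 3 as 1" for v
  proof -
    have 0: "lin v 0 (Suc 0) = 0" "lin v 0 2 = 0" using v by (force simp: K1_def \<Lambda>_def numeral_2_eq_2)+
    have "v 0 \<in> poly_homogeneous 3 1" using v by (simp add: FG_iff)
    from linear_form_expand[OF this] have "v 0 = Con (lin v 0 0) * X 0"
      using 0 by (simp add: lin_def numeral_3_eq_3 numeral_2_eq_2 mult.commute)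
    moreover have "v t = 0" if "t > 0" for t using v that by (simp add: FG_iff)
    ultimately have "v = unit 0 (Con (lin v 0 0) * X 0)" by (auto simp: unit_def fun_eq_iff)
    then show ?thesis by blast
  qed
  have "kvanish 3 1 2 as K"
    unfolding kvanish_def
  proof (intro allI impI, elim conjE)
    fix z assume z: "\<forall>A. vset 3 1 A \<longrightarrow> z A \<in> K \<inter> FG 3 as (2 - int 1)"
      and cyc: "\<forall>A. 0 < (1::nat) \<longrightarrow> vset 3 (1 - 1) A \<longrightarrow> koszul 3 z A = 0"
    have "\<exists>c. z {l} = unit 0 (Con c * X 0)" if "l < 3" for l
      using z that mult[of "z {l}"] by (simp add: vset_def)
    then obtain c where c: "\<And>l. l < 3 \<Longrightarrow> z {l} = unit 0 (Con (c l) * X 0)" by metis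
    have "0 = koszul 3 z {} 0" using cyc by (simp add: vset_0)
    also have "\<dots> = (\<Sum>l<3. Con (c l) * X l) * X 0"
      unfolding koszul_apply sum_distrib_right by (rule sum.cong) (auto simp: c unit_def mult_ac)
    finally have 0: "(\<Sum>l<3. Con (c l) * X l) = 0" by simp
    have "c m = 0" if "m < 3" for m
    proof -
      have "0 = lk (\<Sum>l<3. Con (c l) * X l) (Poly_Mapping.single m 1)" unfolding 0 by simp
      also have "\<dots> = (\<Sum>l<3. if l = m then c l else 0)"
        unfolding lookup_sum by (rule sum.cong) (auto simp: lk_X single_1_eq_iff)
      finally show ?thesis using that by simp
    qed
    then have "z {l} = 0" if "l < 3" for l using c[OF that] that by (simp add: unit_def fun_eq_iff)
    then have "z A = 0" if "vset 3 1 A" for A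
      using that by (auto simp: vset_def card_1_singleton_iff)
    then show "\<exists>w. (\<forall>A. vset 3 (Suc 1) A \<longrightarrow> w A \<in> K \<inter> FG 3 as (2 - int (Suc 1))) \<and>
        (\<forall>A. vset 3 1 A \<longrightarrow> koszul 3 w A = z A)"
      by (intro exI[of _ "\<lambda>_. 0"]) (simp add: koszul_def gsubD(2)[OF K_gsub, simplified])
  qed
  then obtain F and G :: "nat \<Rightarrow> nat \<Rightarrow> nat \<Rightarrow> 'k mpoly" and b1 b2 c2 c3
    where F: "resolution 3 F G" "betti F = dgm 1 b1 b2 c2 c3 2"
    "b1 + 2 = 3 * 1" "b2 + 3 * 1 = 3 * 2 + c2" "c3 + 1 = 3 * 2" "c2 = 0"
    using betti_two_step by metis
  then have "b1 = 1" "b2 = 3" "c2 = 0" "c3 = 5" by auto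
  then show ?thesis using dgm_in_B_mod[OF F(1,2)] by simp
qed

text \<open>The graded dual of the ring modulo the square of the irrelevant ideal: the variables pair its three
  generators perfectly with its socle, which is one-dimensional. The relations are \<open>x\<^sub>m e\<^sub>t = 0\<close> for
  \<open>m \<noteq> t\<close> and \<open>x\<^sub>t e\<^sub>t = x\<^sub>s e\<^sub>s\<close>. They generate everything in degree \<open>2\<close>, since
  \<open>x\<^sub>t x\<^sub>t e\<^sub>t = x\<^sub>t (x\<^sub>t e\<^sub>t - x\<^sub>s e\<^sub>s) + x\<^sub>s (x\<^sub>t e\<^sub>s)\<close>.\<close>

lemma dual_in_B_mod: "dgm 3 8 0 6 0 1 \<in> B_mod TYPE('k::field) 3 3 window_lo window_hi"
proof -
  define \<Lambda> where "\<Lambda> s v = lin v 0 0 + lin v 1 1 + lin v 2 2" for s :: nat and v :: "nat \<Rightarrow> 'k mpoly"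
  interpret two_step 3 1 \<Lambda>
  proof
    show "\<Lambda> s (u + v) = \<Lambda> s u + \<Lambda> s v" for s u v by (simp add: \<Lambda>_def lin_simps)
    show "\<Lambda> s u = c * \<Lambda> s v" if "\<And>t l. t < 3 \<Longrightarrow> l < 3 \<Longrightarrow> lin u t l = c * lin v t l" for s u v c
      using that by (simp add: \<Lambda>_def algebra_simps)
    show "\<exists>v\<in>FG 3 (replicate 3 0) 1. \<forall>s'<1. \<Lambda> s' v = (if s' = s then 1 else 0)" if "s < 1" for s
      using that by (intro bexI[of _ "unit 0 (X 0)"]) (auto simp: \<Lambda>_def lin_simps lk_X intro!: unit_FG)
    show "v = 0" if v: "v \<in> FG 3 (replicate 3 0) 0" and 0: "\<And>l s. l < 3 \<Longrightarrow> s < 1 \<Longrightarrow> \<Lambda> s (pm (X l) v) = 0" for v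
    proof (rule const_vector_eq_0[OF v])
      fix t :: nat assume "t < 3"
      then have "t = 0 \<or> t = 1 \<or> t = 2" by auto
      then show "lk (v t) 0 = 0" using 0[of t 0] by (auto simp: \<Lambda>_def lin_X_mult[OF v])
    qed
  qed
  let ?H = "K \<inter> FG 3 as 1"
  \<comment> \<open>the part of degree \<open>2\<close> that the linear relations generate\<close>
  define P where "P = {\<Sum>l<3. pm (X l) (y l) |y. \<forall>l<3. y l \<in> ?H}"
  have H: "V.subspace ?H" by (intro V.subspace_inter gsubD(6)[OF K_gsub] FG_subspace)
  have P_add: "u + v \<in> P" if "u \<in> P" "v \<in> P" for u v
  proof -
    from that obtain x y where "\<forall>l<3. x l \<in> ?H" "\<forall>l<3. y l \<in> ?H"
      "u = (\<Sum>l<3. pm (X l) (x l))" "v = (\<Sum>l<3. pm (X l) (y l))" unfolding P_def by blast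
    then show ?thesis unfolding P_def mem_Collect_eq
      by (intro exI[of _ "\<lambda>l. x l + y l"] conjI allI impI V.subspace_add[OF H])
        (simp_all only: sum.distrib pm_simps)
  qed
  have P_0: "0 \<in> P" unfolding P_def mem_Collect_eq
    by (intro exI[of _ "\<lambda>_. 0"] conjI allI impI V.subspace_0[OF H]) simp
  have P_sum: "(\<Sum>i\<in>A. u i) \<in> P" if "\<And>i. i \<in> A \<Longrightarrow> u i \<in> P" for A :: "nat set" and u
    using that by (induction A rule: infinite_finite_induct) (simp_all only: sum.infinite sum.empty sum.insert P_0 P_add insert_iff simp_thms)
  have P_X: "pm (X l) y \<in> P" if "l < 3" "y \<in> ?H" for l y
  proof -
    have "(\<Sum>i<3. pm (X i) (if i = l then y else 0)) = (\<Sum>i<3. if i = l then pm (X i) y else 0)"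
      by (rule sum.cong) auto
    also have "\<dots> = pm (X l) y" using that(1) by (subst sum.delta) auto
    finally show ?thesis unfolding P_def mem_Collect_eq
      by (intro exI[of _ "\<lambda>i. if i = l then y else 0"]) (use that(2) V.subspace_0[OF H] in auto)
  qed
  have H_I: "v \<in> ?H" if v: "v \<in> FG 3 as 1" "\<Lambda> 0 v = 0" for v
  proof -
    have "lk (v t) 0 = 0" for t
      using v(1) homogeneous_irrelevant[of "v t" 3 1] by (cases "t < 3") (auto simp: FG_iff irrelevant_iff)
    then show ?thesis using v FG_FM[OF v(1)] by (simp add: K1_def)
  qed
  have mono: "unit t (Con c * X m) \<in> FG 3 as 1" if "t < 3" "m < 3" for t m and c :: 'k
    using that by (auto intro!: unit_FG poly_homogeneous_mult[of _ _ 0 _ 1])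
  have off: "unit t (Con c * X m) \<in> ?H" if "t < 3" "m < 3" "t \<noteq> m" for t m and c :: 'k
  proof (rule H_I[OF mono[OF that(1,2)]])
    have "t = 0 \<or> t = 1 \<or> t = 2" using that(1) by auto
    then show "\<Lambda> 0 (unit t (Con c * X m)) = 0"
      using that(3) by (auto simp: \<Lambda>_def lin_simps lk_X single_1_eq_iff)
  qed
  have diag: "unit t (Con c * X t) - unit s (Con c * X s) \<in> ?H" if "t < 3" "s < 3" "t \<noteq> s" for s t and c :: 'k
  proof (rule H_I)
    show "unit t (Con c * X t) - unit s (Con c * X s) \<in> FG 3 as 1" using mono that by simp
    have "t = 0 \<or> t = 1 \<or> t = 2" "s = 0 \<or> s = 1 \<or> s = 2" using that by auto
    then show "\<Lambda> 0 (unit t (Con c * X t) - unit s (Con c * X s)) = 0"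
      using that(3) by (auto simp: \<Lambda>_def lin_def unit_def lookup_minus lk_X)
  qed
  have mon: "unit t (X l * (Con c * X m)) \<in> P" if "t < 3" "l < 3" "m < 3" for t l m and c :: 'k
  proof (cases "t = m")
    case False
    then show ?thesis using P_X[OF that(2) off[OF that(1,3), of c]] by simp
  next
    case tm: True
    show ?thesis
    proof (cases "t = l")
      case False
      then have "pm (X m) (unit t (Con c * X l)) \<in> P" using P_X[OF that(3) off[OF that(1,2), of c]] by simp
      then show ?thesis by (simp add: mult_ac)
    next
      case True
      define s where "s = (if t = 0 then 1 else 0 :: nat)"
      have s: "s < 3" "s \<noteq> t" "t \<noteq> s" by (auto simp: s_def)
      have "pm (X t) (unit t (Con c * X t) - unit s (Con c * X s)) + pm (X s) (unit s (Con c * X t)) \<in> P"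
        using P_add P_X diag off s that(1) by presburger
      also have "pm (X t) (unit t (Con c * X t) - unit s (Con c * X s)) + pm (X s) (unit s (Con c * X t))
          = unit t (X l * (Con c * X m))"
        unfolding pm_simps pm_unit True[symmetric] tm[symmetric]
        by (simp add: mult_ac)
      finally show ?thesis .
    qed
  qed
  have "FG 3 as 2 \<subseteq> P"
  proof
    fix v :: "nat \<Rightarrow> 'k mpoly" assume v: "v \<in> FG 3 as 2"
    have ex: "v t = (\<Sum>l<3. \<Sum>m<3. X l * (Con (lk (dvar l (v t)) (Poly_Mapping.single m 1)) * X m))" if "t < 3" for t
    proof -
      have h: "v t \<in> poly_homogeneous 3 2" using v that by (simp add: FG_iff)
      have "dvar l (v t) \<in> poly_homogeneous 3 1" for l using dvar_homogeneous[OF h, of l] by simp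
      note d = linear_form_expand[OF this]
      have "v t = (\<Sum>l<3. X l * dvar l (v t))"
        using var_expand[OF poly_homogeneous_carrier[OF h]] homogeneous_irrelevant[OF h]
        by (simp add: irrelevant_iff)
      also have "\<dots> = (\<Sum>l<3. \<Sum>m<3. X l * (Con (lk (dvar l (v t)) (Poly_Mapping.single m 1)) * X m))"
        by (rule sum.cong[OF refl], subst d) (simp only: sum_distrib_left mult_ac)
      finally show ?thesis .
    qed
    have unit_sum: "unit t (\<Sum>i\<in>A. f i) = (\<Sum>i\<in>A. unit t (f i))" for t A and f :: "nat \<Rightarrow> 'k mpoly"
      by (rule ext) (simp add: unit_def sum_fun_apply)
    have "unit t (v t) \<in> P" if "t < 3" for t
      by (subst ex[OF that]) (simp only: unit_sum, intro P_sum mon, use that in auto)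
    then have "(\<Sum>t<3. unit t (v t)) \<in> P" by (intro P_sum) simp
    then show "v \<in> P" using unit_expand[OF FG_FM[OF v]] by simp
  qed
  then have P2: "\<exists>y. (\<forall>l<3. y l \<in> ?H) \<and> v = (\<Sum>l<3. pm (X l) (y l))" if "v \<in> FG 3 as 2" for v
    using that unfolding P_def by blast
  have "kvanish 3 0 2 as K"
    unfolding kvanish_def
  proof (intro allI impI, elim conjE)
    fix z assume z: "\<forall>A. vset 3 0 A \<longrightarrow> z A \<in> K \<inter> FG 3 as (2 - int 0)"
    then have "z {} \<in> FG 3 as 2" by (simp add: vset_0)
    then obtain y where y: "\<forall>l<3. y l \<in> ?H" "z {} = (\<Sum>l<3. pm (X l) (y l))" using P2 by blast
    have "vset 3 (Suc 0) A \<Longrightarrow> y (the_elem A) \<in> ?H" for A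
      using y(1) by (auto simp: vset_def card_1_singleton_iff)
    then show "\<exists>w. (\<forall>A. vset 3 (Suc 0) A \<longrightarrow> w A \<in> K \<inter> FG 3 as (2 - int (Suc 0))) \<and>
        (\<forall>A. vset 3 0 A \<longrightarrow> koszul 3 w A = z A)"
      using y(2) by (intro exI[of _ "\<lambda>A. y (the_elem A)"]) (simp add: vset_0 koszul_def)
  qed
  then obtain F and G :: "nat \<Rightarrow> nat \<Rightarrow> nat \<Rightarrow> 'k mpoly" and b1 b2 c2 c3
    where F: "resolution 3 F G" "betti F = dgm 3 b1 b2 c2 c3 1"
    "b1 + 1 = 3 * 3" "b2 + 3 * 3 = 3 * 1 + c2" "c3 + 3 = 3 * 1" "b2 = 0"
    using betti_two_step by metis
  then have "b1 = 8" "b2 = 0" "c2 = 6" "c3 = 0" by auto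
  then show ?thesis using dgm_in_B_mod[OF F(1,2)] by simp
qed

section \<open>A Dedekind-Mertens lemma\<close>

primrec prods :: "(nat \<Rightarrow> 'k::field mpoly) \<Rightarrow> nat \<Rightarrow> nat \<Rightarrow> 'k mpoly set" where
  "prods x m 0 = {1}"
| "prods x m (Suc d) = {x i * w |i w. i < m \<and> w \<in> prods x m d}"

text \<open>The coefficients of the product of the polynomials with coefficients \<open>x 0, ..., x (m - 1)\<close> and
  \<open>e 0, ..., e d\<close>.\<close>

definition conv :: "(nat \<Rightarrow> 'k::field mpoly) \<Rightarrow> nat \<Rightarrow> nat \<Rightarrow> (nat \<Rightarrow> nat \<Rightarrow> 'k mpoly) \<Rightarrow> nat \<Rightarrow> nat \<Rightarrow> 'k mpoly" where
  "conv x m d e j = (\<Sum>t\<le>d. if t \<le> j \<and> j - t < m then pm (x (j - t)) (e t) else 0)"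

lemma prods_mult: "w \<in> prods x m d \<Longrightarrow> i < m \<Longrightarrow> x i * w \<in> prods x m (Suc d)"
  by auto

lemma prods_Suc_cases:
  "w \<in> prods x (Suc m) (Suc d) \<Longrightarrow> w \<in> prods x m (Suc d) \<or> (\<exists>w'\<in>prods x (Suc m) d. w = x m * w')"
proof (induction d arbitrary: w)
  case 0
  then show ?case by (auto simp: less_Suc_eq)
next
  case (Suc d)
  then obtain i u where u: "w = x i * u" "i < Suc m" "u \<in> prods x (Suc m) (Suc d)" by auto
  show ?case
  proof (cases "i = m")
    case True
    then show ?thesis using u by blast
  next
    case False
    then have im: "i < m" using u(2) by simp
    from Suc.IH[OF u(3)] show ?thesis
    proof
      assume "u \<in> prods x m (Suc d)"
      then show ?thesis using prods_mult[OF _ im] u(1) by blast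
    next
      assume "\<exists>w'\<in>prods x (Suc m) d. u = x m * w'"
      then obtain w' where w': "w' \<in> prods x (Suc m) d" "u = x m * w'" by blast
      have "w = x m * (x i * w')" using u(1) w'(2) by (simp add: mult_ac)
      then show ?thesis using prods_mult[OF w'(1) u(2)] by blast
    qed
  qed
qed

text \<open>Both families are regarded as coefficients of polynomials. If \<open>w\<close> contains the leading coefficient
  of the first polynomial, multiply the second one by it: the top coefficient of the product then lies
  in \<open>K\<close>, and splitting it off lowers the degree. Otherwise this leading coefficient can be dropped,
  since the terms of \<open>conv\<close> with it lie in \<open>K\<close> by the first case.\<close>

lemma dedekind_mertens:
  fixes x :: "nat \<Rightarrow> 'k::field mpoly"
  assumes K: "gsub n as K" and x: "\<And>i. i < m \<Longrightarrow> x i \<in> poly_carrier n"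
    and "\<And>w j. w \<in> prods x m d \<Longrightarrow> pm w (conv x m d e j) \<in> K"
    and "w \<in> prods x m (Suc d)" "t \<le> d"
  shows "pm w (e t) \<in> K"
  using assms(2-)
proof (induction d arbitrary: m e w t rule: less_induct)
  case (less d)
  note IHd = less.IH
  show ?case using less.prems
  proof (induction m arbitrary: w t)
    case 0
    then show ?case by simp
  next
    case (Suc m)
    note H = Suc.prems(2)
    have K_diff: "u - v \<in> K" if "u \<in> K" "v \<in> K" for u v
      using gsubD(6)[OF K] V.subspace_diff that by blast
    have top: "conv x (Suc m) d e (m + d) = pm (x m) (e d)"
    proof -
      have "conv x (Suc m) d e (m + d) = (\<Sum>t\<le>d. if t = d then pm (x m) (e t) else 0)"
        unfolding conv_def by (rule sum.cong) auto
      then show ?thesis by (subst (asm) sum.delta) auto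
    qed
    \<comment> \<open>products that contain the leading coefficient of the first factor\<close>
    have lead: "pm (w * x m) (e t) \<in> K" if w: "w \<in> prods x (Suc m) d" and t: "t \<le> d" for w t
    proof (cases "t = d")
      case True
      then show ?thesis using H[OF w, of "m + d"] unfolding top by simp
    next
      case False
      then obtain d' where d': "d = Suc d'" "t \<le> d'" using t by (cases d) auto
      let ?e = "\<lambda>t. pm (x m) (e t)"
      have "pm u (conv x (Suc m) d' ?e j) \<in> K" if u: "u \<in> prods x (Suc m) d'" for u j
      proof -
        have um: "u * x m \<in> prods x (Suc m) d"
          unfolding d'(1) using prods_mult[OF u, of m] by (simp add: mult.commute)
        have "pm (x m) (conv x (Suc m) d e j) = (\<Sum>t\<le>d. if t \<le> j \<and> j - t < Suc m then pm (x (j - t)) (?e t) else 0)"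
          unfolding conv_def pm_sum by (rule sum.cong) (auto simp: mult.commute)
        also have "\<dots> = conv x (Suc m) d' ?e j + (if d \<le> j \<and> j - d < Suc m then pm (x (j - d)) (?e d) else 0)"
          unfolding conv_def d'(1) by (rule sum.atMost_Suc)
        finally have eq: "conv x (Suc m) d' ?e j = pm (x m) (conv x (Suc m) d e j)
            - (if d \<le> j \<and> j - d < Suc m then pm (x (j - d)) (?e d) else 0)"
          by (simp only: add_diff_cancel_right')
        have 1: "pm u (pm (x m) (conv x (Suc m) d e j)) \<in> K" using H[OF um, of j] by simp
        have 2: "pm u (if d \<le> j \<and> j - d < Suc m then pm (x (j - d)) (?e d) else 0) \<in> K"
        proof (cases "d \<le> j \<and> j - d < Suc m")
          case True
          then have jd: "j - d < Suc m" by blast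
          have "u * x (j - d) \<in> prods x (Suc m) d"
            using prods_mult[OF u jd] d'(1) by (metis mult.commute)
          from H[OF this, of "m + d"] show ?thesis unfolding top using True by (simp add: mult.assoc)
        next
          case False
          show ?thesis unfolding if_not_P[OF False] pm_simps by (rule gsubD(2)[OF K])
        qed
        show ?thesis unfolding eq pm_simps(5) by (rule K_diff[OF 1 2])
      qed
      then have "pm w (?e t) \<in> K"
        using IHd[of d' "Suc m" ?e w t] d' w Suc.prems(1) by simp
      then show ?thesis by simp
    qed
    have "pm w (e t) \<in> K" if w: "w \<in> prods x m (Suc d)" for w
    proof (rule Suc.IH)
      fix u j assume u: "u \<in> prods x m d"
      have sub: "prods x m d \<subseteq> prods x (Suc m) d" for d by (induction d) fastforce+
      then have u': "u \<in> prods x (Suc m) d" using u by blast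
      have "conv x (Suc m) d e j = conv x m d e j + (if m \<le> j \<and> j - m \<le> d then pm (x m) (e (j - m)) else 0)"
      proof -
        have "conv x (Suc m) d e j = conv x m d e j + (\<Sum>t\<le>d. if t = j - m \<and> m \<le> j then pm (x m) (e t) else 0)"
          unfolding conv_def sum.distrib[symmetric] by (rule sum.cong) (auto simp: less_Suc_eq)
        also have "(\<Sum>t\<le>d. if t = j - m \<and> m \<le> j then pm (x m) (e t) else 0)
            = (if m \<le> j \<and> j - m \<le> d then pm (x m) (e (j - m)) else 0)"
        proof (cases "m \<le> j")
          case True
          then show ?thesis by (simp only: simp_thms) (subst sum.delta, auto)
        next
          case False
          then have "(\<Sum>t\<le>d. if t = j - m \<and> m \<le> j then pm (x m) (e t) else 0) = (\<Sum>t\<le>d. 0)"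
            by (intro sum.cong) auto
          then show ?thesis using False by (simp only: sum.neutral_const) simp
        qed
        finally show ?thesis .
      qed
      then have eq: "conv x m d e j = conv x (Suc m) d e j - (if m \<le> j \<and> j - m \<le> d then pm (x m) (e (j - m)) else 0)"
        by (simp only: add_diff_cancel_right')
      have 2: "pm u (if m \<le> j \<and> j - m \<le> d then pm (x m) (e (j - m)) else 0) \<in> K"
        using lead[OF u', of "j - m"] gsubD(2)[OF K] by simp
      show "pm u (conv x m d e j) \<in> K" unfolding eq pm_simps(5) by (rule K_diff[OF H[OF u'] 2])
    qed (use Suc.prems w in auto)
    moreover have "pm w (e t) \<in> K" if "w' \<in> prods x (Suc m) d" "w = x m * w'" for w'
      using lead[OF that(1) Suc.prems(4)] that(2) by (simp add: mult.commute)
    ultimately show ?case using prods_Suc_cases[OF Suc.prems(3)] by blast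
  qed
qed

text \<open>The products of \<open>d\<close> variables generate the forms of degree \<open>d\<close>: split off one variable from every
  term.\<close>

lemma prods_X_generate:
  fixes f :: "'k::field mpoly"
  assumes K: "gsub n as K" and "\<And>w. w \<in> prods X n d \<Longrightarrow> pm w e \<in> K" "f \<in> poly_homogeneous n (int d)"
  shows "pm f e \<in> K"
  using assms(2,3)
proof (induction d arbitrary: f e)
  case 0
  have "f = Con (lk f 0)" by (rule poly_homogeneous_0D[of _ n]) (use 0 in simp)
  then obtain c where c: "f = Con c" by blast
  have "e \<in> K" using "0.prems"(1)[of 1] by simp
  then show ?case unfolding c using gsubD(4)[OF K, of "Con c" e] by simp
next
  case (Suc d)
  have "pm (dvar l f) (pm (X l) e) \<in> K" if l: "l < n" for l
  proof (rule Suc.IH)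
    fix w :: "'k mpoly" assume "w \<in> prods X n d"
    then have "X l * w \<in> prods X n (Suc d)" using l by (rule prods_mult)
    from Suc.prems(1)[OF this] show "pm w (pm (X l) e) \<in> K" by (simp add: mult.commute)
  next
    show "dvar l f \<in> poly_homogeneous n (int d)" using dvar_homogeneous[OF Suc.prems(2), of l] by simp
  qed
  then have "(\<Sum>l<n. pm (dvar l f) (pm (X l) e)) \<in> K" by (intro gsub_sum[OF K]) simp
  moreover have "f = (\<Sum>l<n. dvar l f * X l)"
    using var_expand[OF poly_homogeneous_carrier[OF Suc.prems(2)]] homogeneous_irrelevant[OF Suc.prems(2)]
    by (simp add: irrelevant_iff mult.commute)
  then have "pm f e = (\<Sum>l<n. pm (dvar l f) (pm (X l) e))"
    using pm_sum_left[of "\<lambda>l. dvar l f * X l" "{..<n}" e] by simp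
  ultimately show ?case by simp
qed

section \<open>A pure resolution of type \<open>(0, 1, n, n + 1, ..., 2 n - 2)\<close>\<close>

lemma sum_list_one_value: "set xs \<subseteq> {d} \<Longrightarrow> (\<Sum>a\<leftarrow>xs. f a) = length xs * (f d :: nat)"
  by (induction xs) auto

text \<open>The generic instance: the first factor has the variables as coefficients and the second one, of degree
  \<open>n - 2\<close>, the basis vectors. The \<open>2 (n - 1)\<close> coefficients of the product are the columns of a matrix of
  linear forms with \<open>n - 1\<close> rows.\<close>

definition conv_col :: "nat \<Rightarrow> nat \<Rightarrow> nat \<Rightarrow> 'k::field mpoly" where
  "conv_col n j = conv X n (n - 2) (\<lambda>t. unit t 1) j"

context
  fixes n :: nat
  assumes n: "2 \<le> n"
begin

private abbreviation "as \<equiv> replicate (n - 1) (0::int)"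
private abbreviation "bs \<equiv> replicate (2 * (n - 1)) (1::int)"
private abbreviation "K0 \<equiv> comb (length bs) (conv_col n) ` FM n bs"

lemma conv_col_FG: "conv_col n j \<in> FG n as 1"
  unfolding conv_col_def conv_def
  by (intro FG_sum) (use n in \<open>auto intro!: unit_FG\<close>)

lemma conv_hmat: "hmat n bs as (conv_col n)"
  using conv_col_FG by (auto simp: hmat_def)

lemma K0_gsub: "gsub n as (K0 :: (nat \<Rightarrow> 'k::field mpoly) set)"
  by (rule gsub_image[OF conv_hmat])

lemma conv_col_K0: "(conv_col n j :: nat \<Rightarrow> 'k::field mpoly) \<in> K0"
proof (cases "j < length bs")
  case True
  have "comb (length bs) (conv_col n) (unit j 1) \<in> (K0 :: (nat \<Rightarrow> 'k mpoly) set)"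
    by (rule imageI) (rule unit_FM[OF True], simp)
  then show ?thesis unfolding comb_unit[OF True] pm_simps .
next
  case False
  then have "(conv_col n j :: nat \<Rightarrow> 'k mpoly) = (\<Sum>t\<le>n - 2. 0)"
    unfolding conv_col_def conv_def using n by (intro sum.cong) auto
  then show ?thesis using gsubD(2)[OF K0_gsub] by (simp only: sum.neutral_const)
qed

lemma prods_X_carrier: "w \<in> prods X n d \<Longrightarrow> w \<in> poly_carrier n"
  by (induction d arbitrary: w) auto

text \<open>The Dedekind-Mertens lemma reduces to degrees in which the coefficients of the product lie in \<open>K0\<close>
  by definition, and gives degree \<open>n - 1\<close>; the higher degrees follow by multiplication.\<close>

lemma K0_high: "j > int n - 2 \<Longrightarrow> FG n as j \<subseteq> (K0 :: (nat \<Rightarrow> 'k::field mpoly) set)"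
proof
  fix v :: "nat \<Rightarrow> 'k mpoly" assume j: "j > int n - 2" and v: "v \<in> FG n as j"
  have "pm w (unit t 1) \<in> (K0 :: (nat \<Rightarrow> 'k mpoly) set)" if "w \<in> prods X n (n - 1 + k)" "t < n - 1" for w t k
    using that(1)
  proof (induction k arbitrary: w)
    case 0
    have n2: "Suc (n - 2) = n - 1" using n by simp
    show ?case
    proof (rule dedekind_mertens[OF K0_gsub, where x = X and m = n and d = "n - 2" and e = "\<lambda>t. unit t 1"])
      show "pm w (conv X n (n - 2) (\<lambda>t. unit t 1) j) \<in> (K0 :: (nat \<Rightarrow> 'k mpoly) set)"
        if "w \<in> prods X n (n - 2)" for w j
        using gsubD(4)[OF K0_gsub prods_X_carrier[OF that] conv_col_K0[of j]] unfolding conv_col_def .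
      show "w \<in> prods X n (Suc (n - 2))" using 0 n2 by simp
    qed (use that(2) n2 in auto)
  next
    case (Suc k)
    then obtain l u where u: "w = X l * u" "l < n" "u \<in> prods X n (n - 1 + k)" by auto
    have "pm (X l) (pm u (unit t 1)) \<in> K0"
      by (rule gsubD(4)[OF K0_gsub]) (use u Suc.IH in auto)
    then show ?case using u(1) by simp
  qed
  note gen = this
  define k where "k = nat (j - (int n - 1))"
  have jk: "j = int (n - 1 + k)" using j n by (simp add: k_def)
  have "unit t (v t) \<in> K0" if t: "t < n - 1" for t
  proof -
    have "v t \<in> poly_homogeneous n (int (n - 1 + k))" using v t jk by (simp add: FG_iff)
    from prods_X_generate[OF K0_gsub gen[OF _ t] this] show ?thesis by simp
  qed
  then have "(\<Sum>t<length as. unit t (v t)) \<in> K0" by (intro gsub_sum[OF K0_gsub]) simp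
  then show "v \<in> K0" using unit_expand[OF FG_FM[OF v]] by simp
qed

text \<open>Both sides of the convolution map have the same dimension in degree \<open>n - 1\<close>, where it is onto.\<close>

lemma Hilb_double: "2 * Hilb n (int n - 2) = Hilb n (int n - 1)"
proof -
  obtain k where k: "n = Suc (Suc k)" using n by (metis add_2_eq_Suc le_Suc_ex)
  have "(Suc (2 * k)) choose (Suc k) = (Suc (2 * k)) choose k"
    using binomial_symmetric[of k "Suc (2 * k)"] by (simp add: Suc_diff_le)
  moreover have "Hilb n (int n - 2) = (Suc (2 * k)) choose k" "Hilb n (int n - 1) = (Suc (Suc (2 * k))) choose (Suc k)"
    using Hilb_nat[of n k] Hilb_nat[of n "Suc k"] by (simp_all add: k mult_2)
  ultimately show ?thesis by simp
qed

text \<open>In degree \<open>n - 1\<close> the map is onto between spaces of equal dimension, hence injective; a power of \<open>x\<^sub>0\<close>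
  carries a kernel element of lower degree into this degree.\<close>

lemma comb_conv_inj:
  assumes "v \<in> FG n bs j" "j \<le> int n - 1" "comb (length bs) (conv_col n) v = (0 :: nat \<Rightarrow> 'k::field mpoly)"
  shows "v = 0"
proof -
  let ?c = "comb (length bs) (conv_col n :: nat \<Rightarrow> nat \<Rightarrow> 'k mpoly)"
  let ?A = "FG n bs (int n - 1) :: (nat \<Rightarrow> 'k mpoly) set"
  have sub: "FG n as (int n - 1) \<subseteq> (K0 :: (nat \<Rightarrow> 'k mpoly) set)" by (rule K0_high) simp
  have "?c ` ?A = FG n as (int n - 1)"
    unfolding image_degree[OF conv_hmat] using sub by blast
  then have "V.dim {v \<in> ?A. ?c v = 0} = 0"
    using V.rank_nullity[OF comb_linear[of "length bs" "conv_col n :: nat \<Rightarrow> nat \<Rightarrow> 'k mpoly"]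
        FG_subspace[of n bs "int n - 1"] findim_FG] Hilb_double
    by (simp add: dim_FG sum_list_replicate algebra_simps)
  moreover have "V.subspace {v \<in> ?A. ?c v = 0}"
  proof -
    have eq: "{v \<in> ?A. ?c v = 0} = {v \<in> FM n bs. ?c v = 0} \<inter> ?A" by (auto dest: FG_FM)
    show ?thesis
      unfolding eq by (intro V.subspace_inter gsubD(6)[OF gsub_kernel[OF conv_hmat]] FG_subspace)
  qed
  moreover have "V.findim {v \<in> ?A. ?c v = 0}" by (rule V.findim_subset[OF findim_FG]) blast
  ultimately have 0: "{v \<in> ?A. ?c v = 0} = {0}" using V.dim_eq_0_iff by blast
  define k where "k = nat (int n - 1 - j)"
  have pw: "pm (X 0 ^ i) v \<in> FG n bs (j + int i)" for i
  proof (induction i)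
    case (Suc i)
    have "pm (X 0) (pm (X 0 ^ i) v) \<in> FG n bs (j + int i + 1)" using Suc n by (intro FG_X) auto
    then show ?case by (simp add: algebra_simps)
  qed (use assms(1) in simp)
  have "pm (X 0 ^ k) v \<in> {v \<in> ?A. ?c v = 0}" using pw[of k] assms by (simp add: k_def)
  then have "pm (X 0 ^ k) v = 0" using 0 by blast
  then show ?thesis by (simp add: pm_eq_0)
qed

lemma dim_K0_low:
  assumes "j \<le> int n - 1"
  shows "V.dim ((K0 :: (nat \<Rightarrow> 'k::field mpoly) set) \<inter> FG n as j) = 2 * (n - 1) * Hilb n (j - 1)"
proof -
  let ?c = "comb (length bs) (conv_col n :: nat \<Rightarrow> nat \<Rightarrow> 'k mpoly)"
  have "{v \<in> FG n bs j. ?c v = 0} = {0}" using comb_conv_inj[OF _ assms] by auto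
  moreover have "V.dim {0} = 0" using V.dim_le_card[of "{0}" "{}"] by simp
  ultimately show ?thesis
    using V.rank_nullity[OF comb_linear[of "length bs" "conv_col n :: nat \<Rightarrow> nat \<Rightarrow> 'k mpoly"]
        FG_subspace[of n bs j] findim_FG]
    unfolding image_degree[OF conv_hmat] by (simp add: dim_FG sum_list_replicate)
qed

lemma dim_K0_high:
  assumes "j \<ge> int n - 1"
  shows "V.dim ((K0 :: (nat \<Rightarrow> 'k::field mpoly) set) \<inter> FG n as j) = (n - 1) * Hilb n j"
proof -
  have "(K0 :: (nat \<Rightarrow> 'k mpoly) set) \<inter> FG n as j = FG n as j" using K0_high[of j] assms by auto
  then show ?thesis by (simp add: dim_FG sum_list_replicate)
qed

text \<open>Injectivity in degrees below \<open>n\<close> forbids second syzygies there, so from \<open>F 2\<close> on the degrees are at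
  least \<open>n, n + 1, ...\<close>; the Koszul homology of \<open>K0\<close> gives the same numbers as upper bounds. As the
  resolution is pure, each rank is the dimension of a syzygy space, and all these dimensions are
  multiples of \<open>n - 1\<close> because those of \<open>K0\<close> are.\<close>

theorem pure_resolution:
  obtains F and G :: "nat \<Rightarrow> nat \<Rightarrow> nat \<Rightarrow> 'k::field mpoly" where
    "resolution n F G" "F 0 = as" "F 1 = bs" "\<And>q. set (F (q + 2)) \<subseteq> {int n + int q}"
    "\<And>q. n < q \<Longrightarrow> F q = []" "\<And>q. n - 1 dvd length (F q)"
    "\<And>j. j \<ge> int n - 1 \<Longrightarrow> V.dim (syz n F G 0 j) = (n - 1) * Hilb n j"
proof -
  let ?K = "K0 :: (nat \<Rightarrow> 'k mpoly) set"
  have irr: "\<forall>v\<in>?K. \<forall>t. v t \<in> irrelevant_ideal n"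
  proof (intro ballI allI)
    fix v t assume "v \<in> ?K"
    then obtain u where u: "u \<in> FM n bs" "v = comb (length bs) (conv_col n) u" by blast
    have cf: "(conv_col n j :: nat \<Rightarrow> 'k mpoly) \<in> FG n as 1" for j by (rule conv_col_FG)
    have c: "(conv_col n j t :: 'k mpoly) \<in> irrelevant_ideal n" for j
    proof (cases "t < n - 1")
      case True
      then have "(conv_col n j t :: 'k mpoly) \<in> poly_homogeneous n 1"
        using cf[of j] by (simp add: FG_iff)
      then show ?thesis by (rule homogeneous_irrelevant) simp
    next
      case False
      then have "(conv_col n j t :: 'k mpoly) = 0" using cf[of j] by (simp add: FG_iff)
      then show ?thesis by (simp add: irrelevant_iff)
    qed
    show "v t \<in> irrelevant_ideal n" unfolding u(2) comb_apply
      by (rule irrelevant_sum, rule irrelevant_mult) (use FM_coeff[OF u(1)] c in auto)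
  qed
  have high: "\<forall>j>int n - 2. FG n as j \<subseteq> ?K" using K0_high by blast
  obtain F G where F: "F 0 = as" "resolution n F G" "comb (length (F 1)) (G 0) ` FM n (F 1) = ?K"
    "\<And>q j. j \<in> set (F (Suc q)) \<Longrightarrow> \<not> kvanish n q j as ?K" "\<And>q. n < q \<Longrightarrow> F q = []"
    by (rule minimal_resolution_exists[OF K0_gsub irr high]) (rule that)
  have up: "b \<le> int q + int n - 1" if "b \<in> set (F (Suc q))" for q b
  proof (rule ccontr)
    assume "\<not> b \<le> int q + int n - 1"
    then have "kvanish n q b as ?K" by (intro kvanish_initial[OF irr high]) auto
    then show False using F(4)[OF that] by simp
  qed
  define k where "k q j = V.dim (syz n F G q j)" for q j
  have k0: "syz n F G 0 j = ?K \<inter> FG n as j" for j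
    unfolding syz_def using image_degree[OF resolutionD(1)[OF F(2)], of 0 j] F(1,3) by simp
  have kl: "k 0 j = 2 * (n - 1) * Hilb n (j - 1)" if "j \<le> int n - 1" for j
    unfolding k_def k0 by (rule dim_K0_low[OF that])
  have kh: "k 0 j = (n - 1) * Hilb n j" if "j \<ge> int n - 1" for j
    unfolding k_def k0 by (rule dim_K0_high[OF that])
  have low: "1 \<le> b" if "b \<in> set (F 1)" for b
    using resolution_degree_bound[OF F(2), of 0 0 b] that by (auto simp: F(1))
  \<comment> \<open>\<open>K0\<close> is generated in degree \<open>1\<close>\<close>
  have van: "kvanish n 0 b as ?K" if b: "b \<ge> 2" for b
    unfolding kvanish_def
  proof (intro allI impI, elim conjE)
    fix z assume z: "\<forall>A. vset n 0 A \<longrightarrow> z A \<in> ?K \<inter> FG n as (b - int 0)"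
    let ?c = "comb (length bs) (conv_col n :: nat \<Rightarrow> nat \<Rightarrow> 'k mpoly)"
    have "z {} \<in> ?c ` FG n bs b" unfolding image_degree[OF conv_hmat] using z by (simp add: vset_0)
    then obtain u where u: "u \<in> FG n bs b" "z {} = ?c u" by blast
    have "u t \<in> irrelevant_ideal n" for t
    proof (cases "t < length bs")
      case True
      then have "u t \<in> poly_homogeneous n (b - 1)" using u(1) by (simp add: FG_iff)
      then show ?thesis by (rule homogeneous_irrelevant) (use b in simp)
    qed (use u(1) in \<open>simp add: FG_iff irrelevant_iff\<close>)
    then obtain y where y: "\<And>A. vset n (Suc 0) A \<Longrightarrow> y A \<in> FG n bs (b - 1)"
      "\<And>A. vset n 0 A \<Longrightarrow> koszul n y A = u"
      by (rule koszul_exact[of n 0 "\<lambda>_. u" bs b, rotated 2]) (use u(1) in auto)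
    have a1: "?c (y A) \<in> ?K \<inter> FG n as (b - int (Suc 0))" if "vset n (Suc 0) A" for A
      using comb_FG[OF conv_hmat y(1)[OF that]] FG_FM[OF y(1)[OF that]] by simp
    have a2: "koszul n (\<lambda>A. ?c (y A)) A = z A" if "vset n 0 A" for A
      using y(2)[OF that] u(2) that unfolding koszul_comb[symmetric] by (simp add: vset_0)
    show "\<exists>w. (\<forall>A. vset n (Suc 0) A \<longrightarrow> w A \<in> ?K \<inter> FG n as (b - int (Suc 0))) \<and>
        (\<forall>A. vset n 0 A \<longrightarrow> koszul n w A = z A)"
      by (rule exI[of _ "\<lambda>A. ?c (y A)"], intro conjI allI impI a1 a2)
  qed
  have F1: "b = 1" if b: "b \<in> set (F 1)" for b
  proof (rule ccontr)
    assume "b \<noteq> 1"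
    then have "b \<ge> 2" using low[OF b] by simp
    then show False using van[of b] F(4)[of b 0] b by simp
  qed
  then have F1': "F 1 = replicate (length (F 1)) 1" by (intro replicate_eqI) auto
  have E: "k q j + k (Suc q) j = length (F (Suc q)) * Hilb n (j - d)" if "set (F (Suc q)) \<subseteq> {d}" for q j d
  proof -
    have "(\<Sum>a\<leftarrow>F (Suc q). Hilb n (j - a)) = length (F (Suc q)) * Hilb n (j - d)"
      by (rule sum_list_one_value[OF that])
    then show ?thesis using syz_dim[OF F(2), of q j] by (simp add: k_def)
  qed
  have z0: "k (Suc q) d = 0" if "set (F (Suc q)) \<subseteq> {d}" for q d
    using syz_lowest[OF F(2), of q d] that V.dim_le_card[of "{0}" "{}"] by (force simp: k_def)
  have s1: "set (F (Suc 0)) \<subseteq> {1}" using F1 by auto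
  have len1: "length (F 1) = 2 * (n - 1)"
    using E[OF s1, of 1] z0[OF s1] kl[of 1] n by simp
  then have F1bs: "F 1 = bs" using F1' by simp
  have k1: "k 1 j = 0" if "j \<le> int n - 1" for j
    using E[OF s1, of j] kl[OF that] len1 by simp
  have low2: "int n \<le> b" if b: "b \<in> set (F 2)" for b
  proof (rule ccontr)
    assume "\<not> int n \<le> b"
    then have "V.dim (syz n F G 1 b) = 0" using k1[of b] by (simp add: k_def)
    then have 0: "syz n F G 1 b = {0}" using V.dim_eq_0_iff[OF syz_findim[OF F(2)] syz_subspace] by blast
    obtain s where s: "s < length (F (Suc 1))" "F (Suc 1) ! s = b" using b by (auto simp: in_set_conv_nth numeral_2_eq_2)
    have "unit s 1 \<in> FG n (F (Suc 1)) b" by (rule unit_FG[OF s(1)]) (use s(2) in simp)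
    then have "comb (length (F (Suc 1))) (G 1) (unit s 1) \<in> syz n F G 1 b" unfolding syz_def by (rule imageI)
    then have "G 1 s = 0" unfolding 0 comb_unit[OF s(1)] by simp
    then show False using resolution_column_nonzero[OF F(2) s(1)] by simp
  qed
  have lowq: "\<forall>b\<in>set (F (q + 2)). int n + int q \<le> b" for q
  proof (induction q)
    case 0 then show ?case using low2 by (simp add: numeral_2_eq_2)
  next
    case (Suc q)
    then show ?case using resolution_degree_bound[OF F(2), of "q + 2" "int n + int q"] by fastforce
  qed
  have sq: "set (F (q + 2)) \<subseteq> {int n + int q}" for q
    using lowq[of q] up[of _ "q + 1"] by fastforce
  have "\<exists>d. set (F (Suc q)) \<subseteq> {d}" for q
  proof (cases q)
    case 0 then show ?thesis using s1 by auto
  next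
    case (Suc q') then show ?thesis using sq[of q'] by auto
  qed
  then obtain \<delta> where \<delta>: "\<And>q. set (F (Suc q)) \<subseteq> {\<delta> q}" by metis
  have div: "\<forall>j. n - 1 dvd k q j" for q
  proof (induction q)
    case 0
    show ?case
    proof
      fix j show "n - 1 dvd k 0 j"
        using kl[of j] kh[of j] by (cases "j \<le> int n - 1") simp_all
    qed
  next
    case (Suc q)
    have "length (F (Suc q)) = k q (\<delta> q)" using E[OF \<delta>[of q], of "\<delta> q"] z0[OF \<delta>[of q]] by simp
    then have "n - 1 dvd length (F (Suc q))" using Suc by simp
    then have "n - 1 dvd k q j + k (Suc q) j" for j unfolding E[OF \<delta>] by simp
    then show ?case using Suc dvd_add_right_iff by blast
  qed
  have "n - 1 dvd length (F q)" for q
  proof (cases q)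
    case 0 then show ?thesis by (simp add: F(1))
  next
    case (Suc q')
    have "length (F (Suc q')) = k q' (\<delta> q')" using E[OF \<delta>[of q'], of "\<delta> q'"] z0[OF \<delta>[of q']] by simp
    then show ?thesis using div Suc by simp
  qed
  moreover have "V.dim (syz n F G 0 j) = (n - 1) * Hilb n j" if "j \<ge> int n - 1" for j
    unfolding k0 by (rule dim_K0_high[OF that])
  ultimately show thesis by (intro that[of F G]) (use F F1bs sq in auto)
qed

end

section \<open>Kernels in low degrees and two linear columns\<close>

lemma resolution_kernel_low:
  assumes "resolution n F G" "v \<in> FG n (F (Suc q)) j" "comb (length (F (Suc q))) (G q) v = 0"
    and "\<And>a. a \<in> set (F (Suc (Suc q))) \<Longrightarrow> j < a"
  shows "v = 0"
proof -
  have "v \<in> syz n F G (Suc q) j" unfolding syz_kernel[OF assms(1)] using assms(2,3) by simp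
  then obtain u where "u \<in> FG n (F (Suc (Suc q))) j" "v = comb (length (F (Suc (Suc q)))) (G (Suc q)) u"
    unfolding syz_def by blast
  moreover from this(1) have "u = 0" by (rule FG_0_if_low) (rule assms(4))
  ultimately show ?thesis by simp
qed

lemma resolution_comp_0:
  assumes "resolution n F G" "s < length (F (Suc (Suc q)))"
  shows "comb (length (F (Suc q))) (G q) (G (Suc q) s) = 0"
proof -
  have "comb (length (F (Suc (Suc q)))) (G (Suc q)) (unit s 1)
      \<in> {v \<in> FM n (F (Suc q)). comb (length (F (Suc q))) (G q) v = 0}"
    unfolding resolutionD(3)[OF assms(1)] by (intro imageI unit_FM[OF assms(2)]) simp
  then show ?thesis unfolding comb_unit[OF assms(2)] by simp
qed

lemma resolution_free_module:
  "resolution n (\<lambda>q. if q = 0 then [0] else []) (\<lambda>q s t. 0 :: 'k::field mpoly)"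
proof -
  have "FM n [] = {0 :: nat \<Rightarrow> 'k mpoly}" by (auto simp: FM_iff)
  then show ?thesis unfolding resolution_def hmat_def by (auto simp: comb_def)
qed

text \<open>A syzygy \<open>(s, t)\<close> of the columns \<open>g, h\<close> makes all their \<open>2\<close> by \<open>2\<close> minors vanish. For every row \<open>i\<close>,
  \<open>(h\<^sub>i, - g\<^sub>i)\<close> then is a syzygy of degree \<open>2\<close>; there is none but zero if \<open>F 2\<close> is in degree \<open>3\<close>.\<close>

lemma no_linear_syzygy_of_two_columns:
  fixes G :: "nat \<Rightarrow> nat \<Rightarrow> nat \<Rightarrow> 'k::field mpoly"
  assumes R: "resolution n F G" and F0: "set (F 0) \<subseteq> {0}" and F1: "F (Suc 0) = [1, 1]"
    and F2: "set (F (Suc (Suc 0))) \<subseteq> {3}"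
  shows "F (Suc (Suc 0)) = []"
proof (rule ccontr)
  assume "F (Suc (Suc 0)) \<noteq> []"
  then have z: "0 < length (F (Suc (Suc 0)))" by simp
  define s t g h where "s = G 1 0 0" and "t = G 1 0 1" and "g = G 0 0" and "h = G 0 1"
  note defs = s_def t_def g_def h_def
  have c2: "comb (length (F (Suc 0))) (G 0) v i = v 0 * g i + v 1 * h i" for v i
    by (simp add: comb_apply F1 defs lessThan_Suc)
  have rel: "s * g i + t * h i = 0" for i
    using fun_cong[OF resolution_comp_0[OF R z], of i] unfolding c2 by (simp add: defs)
  have nz: "s \<noteq> 0 \<or> t \<noteq> 0"
  proof (rule ccontr)
    assume st: "\<not> (s \<noteq> 0 \<or> t \<noteq> 0)"
    have "G 1 0 \<in> FG n (F (Suc 0)) (F (Suc (Suc 0)) ! 0)"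
      using resolutionD(1)[OF R, of "Suc 0"] z unfolding hmat_def by simp
    then have "G 1 0 i = 0" if "i \<ge> 2" for i using that by (simp add: FG_iff F1)
    then have "G 1 0 i = 0" for i
      using st by (cases "i = 0"; cases "i = 1") (auto simp: defs)
    then have "G 1 0 = 0" by (simp add: fun_eq_iff)
    then show False using resolution_column_nonzero[OF R z] by simp
  qed
  have minor: "h i * g j - g i * h j = 0" for i j
  proof -
    have "s * (h i * g j - g i * h j) = (s * g j + t * h j) * h i - (s * g i + t * h i) * h j"
      "t * (h i * g j - g i * h j) = (s * g i + t * h i) * g j - (s * g j + t * h j) * g i"
      by (simp_all add: algebra_simps)
    then have "s * (h i * g j - g i * h j) = 0" "t * (h i * g j - g i * h j) = 0"
      unfolding rel by simp_all
    then show ?thesis using nz by auto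
  qed
  have "s' < 2 \<Longrightarrow> G 0 s' \<in> FG n (F 0) 1" for s'
    using resolutionD(1)[OF R, of 0] by (auto simp: hmat_def F1 less_Suc_eq numeral_2_eq_2)
  then have gh: "g \<in> FG n (F 0) 1" "h \<in> FG n (F 0) 1" by (simp_all add: defs)
  have hom: "f i \<in> poly_homogeneous n 1" if "f \<in> FG n (F 0) 1" for f i
  proof (cases "i < length (F 0)")
    case True
    then have 0: "F 0 ! i = 0" using F0 nth_mem by blast
    have "f i \<in> poly_homogeneous n (1 - F 0 ! i)" using that True by (simp add: FG_iff)
    then show ?thesis unfolding 0 by simp
  qed (use that in \<open>simp add: FG_iff\<close>)
  have "g i = 0" for i
  proof -
    let ?y = "\<lambda>l::nat. if l = 0 then h i else if l = 1 then - g i else 0"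
    have "?y = 0"
    proof (rule resolution_kernel_low[OF R])
      show "?y \<in> FG n (F (Suc 0)) 2" using hom[OF gh(1)] hom[OF gh(2)] by (auto simp: FG_iff F1 less_Suc_eq)
      show "comb (length (F (Suc 0))) (G 0) ?y = 0"
      proof
        fix j show "comb (length (F (Suc 0))) (G 0) ?y j = 0 j" unfolding c2 using minor[of i j] by simp
      qed
      show "2 < a" if "a \<in> set (F (Suc (Suc 0)))" for a using F2 that by auto
    qed
    then show ?thesis using fun_cong[of ?y 0 1] by simp
  qed
  then have "G 0 0 = 0" by (simp add: fun_eq_iff defs)
  then show False using resolution_column_nonzero[OF R, of 0 0] F1 by simp
qed

lemma F_of_betti:
  assumes "betti F = b" shows "of_nat (count_list (F i) j) = b i j" "j \<in> set (F i) \<longleftrightarrow> b i j \<noteq> 0"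
  using betti_nonzero[of F i j] assms by (auto simp: betti_def)

lemma list_one_value:
  assumes "\<And>a. a \<in> set xs \<Longrightarrow> a = d" "count_list xs d = m" shows "xs = replicate m d"
proof -
  have "xs = replicate (length xs) d" using assms(1) by (intro replicate_eqI) auto
  moreover have "count_list (replicate l d) d = l" for l by (induction l) auto
  ultimately show ?thesis using assms(2) by metis
qed

text \<open>The argument is indifferent to the number of rows, so free summands cannot help.\<close>

theorem half_pure_not_in_B_mod:
  "dgm (1 + k) 2 0 0 2 1 \<notin> B_mod TYPE('k::field) 3 3 window_lo window_hi"
proof
  assume "dgm (1 + k) 2 0 0 2 1 \<in> B_mod TYPE('k) 3 3 window_lo window_hi"
  then obtain F and G :: "nat \<Rightarrow> nat \<Rightarrow> nat \<Rightarrow> 'k mpoly" where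
    R: "resolution 3 F G" and b: "betti F = dgm (1 + k) 2 0 0 2 1" unfolding B_mod_iff by metis
  note Fb = F_of_betti[OF b]
  have s: "set (F 0) \<subseteq> {0}" "\<And>a. a \<in> set (F 1) \<Longrightarrow> a = 1" "set (F 2) \<subseteq> {3}"
    by (auto simp: Fb(2) dgm_def split: if_splits)
  have "count_list (F 1) 1 = 2" using Fb(1)[of 1 1] by (simp add: dgm_def)
  then have "F 1 = replicate 2 1" using s(2) by (intro list_one_value)
  then have "F (Suc (Suc 0)) = []"
    using s by (intro no_linear_syzygy_of_two_columns[OF R]) (simp_all add: numeral_2_eq_2)
  moreover have "3 \<in> set (F 2)" by (simp add: Fb(2) dgm_def)
  ultimately show False by (simp add: numeral_2_eq_2)
qed

lemma ring_in_B_mod: "dgm 1 0 0 0 0 0 \<in> B_mod TYPE('k::field) 3 3 window_lo window_hi"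
proof (rule dgm_in_B_mod[OF resolution_free_module])
  show "betti (\<lambda>q. if q = 0 then [0] else []) = dgm 1 0 0 0 0 0"
    by (auto simp: betti_def dgm_def fun_eq_iff)
qed

section \<open>Syzygies of wide matrices\<close>

lemma det_homogeneous:
  assumes "\<And>i j. i < r \<Longrightarrow> j < r \<Longrightarrow> B i j \<in> poly_homogeneous n 1"
  shows "det (mat r r (\<lambda>(i, j). B i j)) \<in> poly_homogeneous n (int r)"
proof -
  have sgn: "of_int (sign p) * f \<in> poly_homogeneous n e" if "f \<in> poly_homogeneous n e"
    for p e and f :: "'a mpoly" using that by (auto simp: sign_def)
  have prd: "(\<Prod>i = 0..<k. f i) \<in> poly_homogeneous n (int k)"
    if "\<forall>i<k. f i \<in> poly_homogeneous n 1" for k and f :: "nat \<Rightarrow> 'a mpoly"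
    using that by (induction k) (auto intro!: poly_homogeneous_mult simp del: of_nat_Suc simp: int_Suc)
  show ?thesis
    unfolding det_def'[OF mat_carrier]
  proof (intro poly_homogeneous_sum sgn)
    fix p assume "p \<in> {p. p permutes {0..<r}}"
    then have p: "\<And>i. i < r \<Longrightarrow> p i < r" using permutes_in_image by fastforce
    show "(\<Prod>i = 0..<r. mat r r (\<lambda>(i, j). B i j) $$ (i, p i)) \<in> poly_homogeneous n (int r)"
      by (rule prd) (use p assms in auto)
  qed
qed

text \<open>Cramer's rule: the signed maximal minors of the matrix that consists of a largest nonvanishing
  minor, one further column and any row have vanishing pairing with this row, since either the row
  is repeated or the larger minor vanishes.\<close>

lemma wide_matrix_syzygy:
  fixes A :: "nat \<Rightarrow> nat \<Rightarrow> 'k::field mpoly"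
  assumes A: "\<And>i j. i < m \<Longrightarrow> j < N \<Longrightarrow> A i j \<in> poly_homogeneous n 1" and mN: "m < N"
  obtains y r where "r \<le> m" "\<And>j. y j \<in> poly_homogeneous n (int r)" "\<And>j. N \<le> j \<Longrightarrow> y j = 0"
    "y \<noteq> 0" "\<And>i. i < m \<Longrightarrow> (\<Sum>j<N. y j * A i j) = 0"
proof -
  define M where "M r f g = mat r r (\<lambda>(i, j). A (f i) (g j))" for r and f g :: "nat \<Rightarrow> nat"
  have Mc: "M r f g \<in> carrier_mat r r" for r f g by (simp add: M_def)
  define P where "P r \<longleftrightarrow> (\<exists>f g. (\<forall>a<r. f a < m) \<and> (\<forall>a<r. g a < N) \<and> det (M r f g) \<noteq> 0)" for r
  have "r \<le> m" if "P r" for r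
  proof -
    obtain f g where fg: "\<forall>a<r. f a < m" "det (M r f g) \<noteq> 0" using \<open>P r\<close> P_def by blast
    have "inj_on f {..<r}"
    proof (rule inj_onI, rule ccontr)
      fix a b assume ab: "a \<in> {..<r}" "b \<in> {..<r}" "f a = f b" "a \<noteq> b"
      have "row (M r f g) a = row (M r f g) b" using ab by (intro eq_vecI) (auto simp: M_def)
      then show False using det_identical_rows[OF Mc ab(4)] ab(1,2) fg(2) by auto
    qed
    then have "card {..<r} \<le> card {..<m}" by (rule card_inj_on_le) (use fg(1) in auto)
    then show ?thesis by simp
  qed
  moreover have "P 0" unfolding P_def using det_dim_zero[OF Mc] by simp
  ultimately obtain r where r: "P r" "\<And>r'. P r' \<Longrightarrow> r' \<le> r" and rm: "r \<le> m"
    using Greatest_le_nat[of P _ m] GreatestI_nat[of P 0 m] by metis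
  from r(1) obtain f g where fg: "\<forall>a<r. f a < m" "\<forall>a<r. g a < N" "det (M r f g) \<noteq> 0"
    unfolding P_def by blast
  have "card (g ` {..<r}) < card {..<N}" using card_image_le[of "{..<r}" g] rm mN by simp
  then obtain c where c: "c < N" "c \<notin> g ` {..<r}"
    by (metis card_mono finite_imageI finite_lessThan lessThan_iff not_le subsetI)
  \<comment> \<open>one more column; \<open>Q s\<close> omits the column \<open>s\<close> and \<open>Y s\<close> is the cofactor of an added row\<close>
  define g' where "g' = g(r := c)"
  have g': "g' s < N" if "s \<le> r" for s using that fg(2) c(1) by (auto simp: g'_def)
  define Q where "Q s = mat r r (\<lambda>(a, b). A (f a) (g' (if b < s then b else Suc b)))" for s
  define Y where "Y s = (- 1) ^ (r + s) * det (Q s)" for s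
  define y where "y j = (\<Sum>s\<le>r. if g' s = j then Y s else 0)" for j
  have Yh: "Y s \<in> poly_homogeneous n (int r)" if "s \<le> r" for s
  proof -
    have "det (Q s) \<in> poly_homogeneous n (int r)" unfolding Q_def
      by (rule det_homogeneous) (use A fg(1) g' in auto)
    then show ?thesis by (cases "even (r + s)") (auto simp: Y_def)
  qed
  show thesis
  proof (rule that[of r y])
    show "r \<le> m" by (rule rm)
    show "y j \<in> poly_homogeneous n (int r)" for j
      unfolding y_def by (rule poly_homogeneous_sum) (use Yh in auto)
    show "y j = 0" if "N \<le> j" for j
      unfolding y_def by (rule sum.neutral) (use g' that in force)
    show "y \<noteq> 0"
    proof -
      have "y c = (\<Sum>s\<le>r. if s = r then Y s else 0)"
        unfolding y_def by (rule sum.cong) (use c(2) in \<open>auto simp: g'_def\<close>)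
      then have "y c = Y r" by (simp add: sum.delta)
      also have "Q r = M r f g" unfolding Q_def M_def by (intro eq_matI) (auto simp: g'_def)
      then have "Y r = (- 1) ^ (r + r) * det (M r f g)" by (simp add: Y_def)
      finally have "y c \<noteq> 0" using fg(3) by simp
      then show ?thesis by auto
    qed
  next
    fix i assume i: "i < m"
    define f' where "f' = f(r := i)"
    let ?M = "M (Suc r) f' g'"
    have "det ?M = 0"
    proof (rule ccontr)
      assume "det ?M \<noteq> 0"
      moreover have "\<forall>a<Suc r. f' a < m" "\<forall>a<Suc r. g' a < N" using fg(1) i g' by (auto simp: f'_def)
      ultimately have "P (Suc r)" unfolding P_def by blast
      then show False using r(2) by fastforce
    qed
    moreover have "cofactor ?M r s = Y s" if "s < Suc r" for s
    proof -
      have "mat_delete ?M r s = Q s"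
        unfolding mat_delete_def Q_def M_def using that by (intro eq_matI) (auto simp: f'_def)
      then show ?thesis by (simp add: cofactor_def Y_def)
    qed
    then have "det ?M = (\<Sum>s<Suc r. A i (g' s) * Y s)"
      unfolding laplace_expansion_row[OF Mc lessI] by (intro sum.cong) (auto simp: M_def f'_def)
    ultimately have 0: "(\<Sum>s\<le>r. Y s * A i (g' s)) = 0"
      by (simp add: lessThan_Suc_atMost mult.commute)
    have "(\<Sum>j<N. y j * A i j) = (\<Sum>j<N. \<Sum>s\<le>r. if g' s = j then Y s * A i j else 0)"
      unfolding y_def sum_distrib_right by (intro sum.cong) auto
    also have "\<dots> = (\<Sum>s\<le>r. \<Sum>j<N. if g' s = j then Y s * A i j else 0)" by (rule sum.swap)
    also have "\<dots> = (\<Sum>s\<le>r. Y s * A i (g' s))"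
      by (intro sum.cong refl, subst sum.delta') (use g' in auto)
    finally show "(\<Sum>j<N. y j * A i j) = 0" using 0 by simp
  qed
qed

section \<open>The pure resolution in three variables\<close>

lemma pure_resolution_3: "dgm 2 4 0 0 4 2 \<in> B_mod TYPE('k::field) 3 3 window_lo window_hi"
proof -
  obtain F and G :: "nat \<Rightarrow> nat \<Rightarrow> nat \<Rightarrow> 'k mpoly" where
    F: "resolution 3 F G" "F 0 = replicate (3 - 1) 0" "F 1 = replicate (2 * (3 - 1)) 1"
    "\<And>q. set (F (q + 2)) \<subseteq> {int 3 + int q}" "\<And>q. 3 < q \<Longrightarrow> F q = []"
    "\<And>q. 3 - 1 dvd length (F q)"
    "\<And>j. j \<ge> int 3 - 1 \<Longrightarrow> V.dim (syz 3 F G 0 j) = (3 - 1) * Hilb 3 j"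
    by (rule pure_resolution[of 3]) (simp, rule that)
  define k where "k q j = V.dim (syz 3 F G q j)" for q j
  have E: "k q j + k (Suc q) j = (\<Sum>a\<leftarrow>F (Suc q). Hilb 3 (j - a))" for q j
    unfolding k_def by (rule syz_dim[OF F(1)])
  have s2: "set (F (Suc (Suc 0))) \<subseteq> {3}" and s3: "set (F (Suc (Suc (Suc 0)))) \<subseteq> {4}"
    using F(4)[of 0] F(4)[of 1] by (simp_all add: numeral_3_eq_3 numeral_2_eq_2)
  have low: "k (Suc q) j = 0" if "set (F (Suc q)) \<subseteq> {j}" for q j
    unfolding k_def using syz_lowest[OF F(1), of q j] that V.dim_le_card[of "{0}" "{}"] by force
  have k0: "k 0 3 = 20" "k 0 4 = 30" using F(7)[of 3] F(7)[of 4] by (simp_all add: k_def Hilb_3)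
  have F1: "F (Suc 0) = replicate 4 1" using F(3) by simp
  then have k1: "k 1 3 = 4" "k 1 4 = 10"
    using E[of 0 3] E[of 0 4] k0 by (simp_all add: sum_list_replicate Hilb_3)
  have l2: "length (F (Suc (Suc 0))) = 4" and "k 2 4 = 2"
    using E[of 1 3] E[of 1 4] k1 low[OF s2] sum_list_one_value[OF s2]
    by (simp_all add: Hilb_3 numeral_2_eq_2)
  then have l3: "length (F (Suc (Suc (Suc 0)))) = 2"
    using E[of 2 4] low[OF s3] sum_list_one_value[OF s3] by (simp add: numeral_2_eq_2)
  have cr: "count_list (replicate m (x :: int)) y = (if y = x then m else 0)" for m x y
    by (induction m) auto
  have F2: "F (Suc (Suc 0)) = replicate 4 3" using s2 by (intro replicate_eqI l2) auto
  have F3: "F (Suc (Suc (Suc 0))) = replicate 2 4" using s3 by (intro replicate_eqI l3) auto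
  have "betti F = dgm 2 4 0 0 4 2"
  proof (intro ext)
    fix i j
    have "i = 0 \<or> i = Suc 0 \<or> i = Suc (Suc 0) \<or> i = Suc (Suc (Suc 0)) \<or> 3 < i" by auto
    then show "betti F i j = dgm 2 4 0 0 4 2 i j"
      unfolding betti_def dgm_def using F(2) F1 F2 F3 F(5)[of i] by (elim disjE) (simp_all add: cr)
  qed
  then show ?thesis by (rule dgm_in_B_mod[OF F(1)])
qed

section \<open>Rays and missing multiples\<close>

lemma scale_in_cone: "b \<in> B \<Longrightarrow> 0 \<le> q \<Longrightarrow> scale q b \<in> rational_cone B"
  unfolding rational_cone_def mem_Collect_eq
  by (intro exI[of _ "{b}"] exI[of _ "\<lambda>_. q"]) simp

lemma scale_scale: "scale p (scale q b) = scale (p * q) b"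
  by (simp add: scale_def mult.assoc)

lemma scale_1: "scale 1 b = b"
  by (simp add: scale_def)

lemma ray_of_primitive:
  assumes D: "D \<in> lattice_points" "D \<noteq> 0" and prim: "\<forall>q. scale q D \<in> lattice_points \<longrightarrow> q \<in> \<int>"
    and c: "0 < c" "scale c D \<in> B_mod TYPE('k::field) n p dl du"
  shows "half_line D \<inter> lattice_points \<in> rays TYPE('k) n p dl du"
    and "ray_generator (half_line D \<inter> lattice_points) D"
proof -
  have "scale q D \<in> B_Q TYPE('k) n p dl du" if "0 \<le> q" for q
    using scale_in_cone[OF c(2), of "q / c"] that c(1) by (simp add: B_Q_def scale_scale)
  then show "half_line D \<inter> lattice_points \<in> rays TYPE('k) n p dl du"
    using D(2) unfolding rays_def half_line_def by blast
  have "half_line D \<inter> lattice_points = range (\<lambda>m::nat. scale (of_nat m) D)"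
  proof (intro equalityI subsetI)
    fix x assume "x \<in> half_line D \<inter> lattice_points"
    then obtain q where q: "x = scale q D" "0 \<le> q" "scale q D \<in> lattice_points" by (auto simp: half_line_def)
    from prim q(3) have "q \<in> \<int>" by blast
    then obtain z where z: "q = of_int z" by (auto elim: Ints_cases)
    then have "q = of_nat (nat z)" using q(2) by simp
    then show "x \<in> range (\<lambda>m::nat. scale (of_nat m) D)" using q(1) by blast
  next
    fix x assume "x \<in> range (\<lambda>m::nat. scale (of_nat m) D)"
    then obtain m :: nat where x: "x = scale (of_nat m) D" by blast
    then have "x \<in> lattice_points" using D(1) by (auto simp: lattice_points_def scale_def)
    moreover have "x \<in> half_line D" unfolding x half_line_def by force
    ultimately show "x \<in> half_line D \<inter> lattice_points" by blast
  qed
  then show "ray_generator (half_line D \<inter> lattice_points) D"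
    using D(2) by (simp add: ray_generator_def)
qed

text \<open>The syzygy given by Cramer's rule has entries of degree \<open>r \<le> m\<close> and so lies in degree \<open>r + 1\<close>, because
  the columns have degree \<open>1\<close>. It would be zero if \<open>F 2\<close> started later.\<close>

lemma wide_presentation_syzygy:
  fixes G :: "nat \<Rightarrow> nat \<Rightarrow> nat \<Rightarrow> 'k::field mpoly"
  assumes R: "resolution n F G" and F0: "F 0 = replicate m 0" and F1: "F (Suc 0) = replicate w 1"
    and "m < w"
  shows "\<exists>a\<in>set (F (Suc (Suc 0))). a \<le> int m + 1"
proof (rule ccontr)
  assume low: "\<not> (\<exists>a\<in>set (F (Suc (Suc 0))). a \<le> int m + 1)"
  have G: "G 0 j \<in> FG n (replicate m 0) 1" if "j < w" for j
    using resolutionD(1)[OF R, of 0] that by (simp add: hmat_def F0 F1)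
  have hom: "G 0 j i \<in> poly_homogeneous n 1" if "i < m" "j < w" for i j
    using G[OF that(2)] that(1) by (simp add: FG_iff)
  obtain y r where y: "r \<le> m" "\<And>j. y j \<in> poly_homogeneous n (int r)" "\<And>j. w \<le> j \<Longrightarrow> y j = 0"
    "y \<noteq> 0" "\<And>i. i < m \<Longrightarrow> (\<Sum>j<w. y j * G 0 j i) = 0"
    by (rule wide_matrix_syzygy[of m w "\<lambda>i j. G 0 j i" n, OF hom assms(4)]) (assumption | rule that)+
  have "y = 0"
  proof (rule resolution_kernel_low[OF R])
    show "y \<in> FG n (F (Suc 0)) (int r + 1)" using y(2,3) by (simp add: FG_iff F1)
    show "comb (length (F (Suc 0))) (G 0) y = 0"
    proof
      fix i show "comb (length (F (Suc 0))) (G 0) y i = 0 i"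
      proof (cases "i < m")
        case True
        then show ?thesis using y(5) by (simp add: comb_apply F1)
      next
        case False
        have "(\<Sum>j<w. y j * G 0 j i) = 0"
          by (rule sum.neutral) (use G False in \<open>auto simp: FG_iff\<close>)
        then show ?thesis by (simp add: comb_apply F1)
      qed
    qed
    show "int r + 1 < a" if "a \<in> set (F (Suc (Suc 0)))" for a using low that y(1) by force
  qed
  then show False using y(4) by simp
qed

lemma degree_type_bounds: "2 \<le> n \<Longrightarrow> degree_bounds n (\<lambda>i. if i \<le> 1 then i else n + i - 2) (\<lambda>i. if i \<le> 1 then i else n + i - 2)"
  by (auto simp: degree_bounds_def degree_sequence_def)

text \<open>The ray is generated by the quotient of the pure diagram by \<open>n - 1\<close>, which is primitive because its
  first entry is \<open>1\<close>.\<close>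

theorem missing_multiples:
  assumes n: "2 \<le> n"
  defines "d \<equiv> (\<lambda>i. if i \<le> 1 then i else n + i - 2)"
  shows "\<exists>R\<in>rays TYPE('k::field) n n d d. \<exists>D. ray_generator R D \<and>
    (\<forall>m\<in>{1..n - 2}. scale (of_nat m) D \<notin> B_mod TYPE('k) n n d d)"
proof -
  obtain F and G :: "nat \<Rightarrow> nat \<Rightarrow> nat \<Rightarrow> 'k mpoly" where
    F: "resolution n F G" "F 0 = replicate (n - 1) 0" "F 1 = replicate (2 * (n - 1)) 1"
    "\<And>q. set (F (q + 2)) \<subseteq> {int n + int q}" "\<And>q. n < q \<Longrightarrow> F q = []"
    "\<And>q. n - 1 dvd length (F q)"
    "\<And>j. j \<ge> int n - 1 \<Longrightarrow> V.dim (syz n F G 0 j) = (n - 1) * Hilb n j"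
    by (rule pure_resolution[OF n]) (rule that)
  define c where "c = (of_nat (n - 1) :: rat)"
  have c: "c > 0" using n by (simp add: c_def)
  have cr: "count_list (replicate m (x :: int)) y = (if y = x then m else 0)" for m x y
    by (induction m) auto
  have mem: "i \<le> n \<and> j = int (d i)" if "j \<in> set (F i)" for i j
  proof -
    have "i \<le> n" using F(5)[of i] that by (cases "i \<le> n") auto
    moreover have "i = 0 \<or> i = 1 \<or> i = (i - 2) + 2" by auto
    then have "j = int (d i)"
    proof (elim disjE)
      assume i: "i = (i - 2) + 2"
      then have "j = int n + int (i - 2)" using F(4)[of "i - 2"] that by auto
      then show ?thesis using i by (auto simp: d_def)
    qed (use that F(2,3) in \<open>auto simp: d_def\<close>)
    ultimately show ?thesis by blast
  qed
  define D where "D = scale (1 / c) (betti F)"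
  have cD: "scale c D = betti F" using c by (simp add: D_def scale_scale scale_1)
  have B: "scale c D \<in> B_mod TYPE('k) n n d d"
    unfolding cD B_mod_iff using F(1) mem by (intro exI[of _ F] exI[of _ G]) auto
  have b01: "betti F 0 j = (if j = 0 then c else 0)" "betti F 1 j = (if j = 1 then 2 * c else 0)" for j
    unfolding betti_def F(2,3) cr c_def by simp_all
  have D0: "D 0 j = (if j = 0 then 1 else 0)" and D1: "D 1 j = (if j = 1 then 2 else 0)" for j
    unfolding D_def scale_def b01 using c by simp_all
  have lat: "D \<in> lattice_points"
    unfolding lattice_points_def mem_Collect_eq
  proof (intro allI)
    fix i j
    have len: "count_list (F i) j = length (F i)" if "j \<in> set (F i)"
    proof -
      have "set xs \<subseteq> {j} \<Longrightarrow> count_list xs j = length xs" for xs :: "int list" by (induction xs) auto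
      moreover have "set (F i) \<subseteq> {j}" using mem that by blast
      ultimately show ?thesis by blast
    qed
    have "n - 1 dvd count_list (F i) j"
      using len F(6)[of i] by (cases "j \<in> set (F i)") (auto simp: count_list_0_iff)
    then obtain t where "count_list (F i) j = (n - 1) * t" by blast
    then have "D i j = of_nat t" using c by (simp add: D_def scale_def betti_def c_def)
    then show "D i j \<in> \<int>" by simp
  qed
  have "D \<noteq> 0" using D0[of 0] by auto
  moreover have "q \<in> \<int>" if "scale q D \<in> lattice_points" for q
  proof -
    have "q * D 0 0 \<in> \<int>" using that unfolding lattice_points_def scale_def by blast
    then show ?thesis unfolding D0 by simp
  qed
  ultimately have ray: "half_line D \<inter> lattice_points \<in> rays TYPE('k) n n d d"
    "ray_generator (half_line D \<inter> lattice_points) D"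
    using ray_of_primitive[OF lat _ _ c B] by blast+
  have "scale (of_nat m) D \<notin> B_mod TYPE('k) n n d d" if m: "m \<in> {1..n - 2}" for m
  proof
    assume "scale (of_nat m) D \<in> B_mod TYPE('k) n n d d"
    then obtain F' and G' :: "nat \<Rightarrow> nat \<Rightarrow> nat \<Rightarrow> 'k mpoly" where
      R: "resolution n F' G'" "betti F' = scale (of_nat m) D"
      "\<forall>i. \<forall>j\<in>set (F' i). i \<le> n \<and> int (d i) \<le> j \<and> j \<le> int (d i)" unfolding B_mod_iff by metis
    note Fb = F_of_betti(1)[OF R(2)]
    have "of_nat (count_list (F' 0) 0) = (of_nat m :: rat)" "of_nat (count_list (F' 1) 1) = (of_nat (2 * m) :: rat)"
      unfolding Fb by (simp_all add: scale_def D0 D1[unfolded One_nat_def])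
    then have "count_list (F' 0) 0 = m" "count_list (F' 1) 1 = 2 * m" by (simp_all only: of_nat_eq_iff)
    moreover have "a = 0" if "a \<in> set (F' 0)" for a using R(3) that by (force simp: d_def)
    moreover have "a = 1" if "a \<in> set (F' 1)" for a using R(3) that by (force simp: d_def)
    ultimately have F': "F' 0 = replicate m 0" "F' (Suc 0) = replicate (2 * m) 1"
      using list_one_value by (metis One_nat_def)+
    obtain a where a: "a \<in> set (F' (Suc (Suc 0)))" "a \<le> int m + 1"
      using wide_presentation_syzygy[OF R(1) F'] m by auto
    have "int n \<le> a" using R(3) a(1) by (force simp: d_def)
    then show False using a(2) m by auto
  qed
  then show ?thesis using ray by blast
qed

lemma free_ray:
  "\<exists>R\<in>rays TYPE('k::field) n 0 (\<lambda>_. 0) (\<lambda>_. 0). \<exists>D. ray_generator R D"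
proof -
  let ?F = "\<lambda>q :: nat. if q = 0 then [0 :: int] else []"
  let ?D = "betti ?F"
  have D0: "?D 0 0 = 1" by (simp add: betti_def)
  have B: "scale 1 ?D \<in> B_mod TYPE('k) n 0 (\<lambda>_. 0) (\<lambda>_. 0)"
    unfolding scale_1 B_mod_iff using resolution_free_module[of n, where 'k = 'k]
    by (intro exI[of _ ?F] exI[of _ "\<lambda>q s t. 0"]) (auto split: if_splits)
  have lat: "?D \<in> lattice_points" by (simp add: lattice_points_def betti_def)
  have nz: "?D \<noteq> 0" using D0 by (metis zero_fun_apply zero_neq_one)
  have int: "q \<in> \<int>" if "scale q ?D \<in> lattice_points" for q
  proof -
    have "q * ?D 0 0 \<in> \<int>" using that unfolding lattice_points_def scale_def by blast
    then show ?thesis unfolding D0 by simp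
  qed
  have prim: "\<forall>q. scale q ?D \<in> lattice_points \<longrightarrow> q \<in> \<int>" using int by blast
  have "half_line ?D \<inter> lattice_points \<in> rays TYPE('k) n 0 (\<lambda>_. 0) (\<lambda>_. 0)"
    by (rule ray_of_primitive(1)[OF lat nz prim _ B]) simp
  moreover have "ray_generator (half_line ?D \<inter> lattice_points) ?D"
    by (rule ray_of_primitive(2)[OF lat nz prim _ B]) simp
  ultimately show ?thesis by blast
qed

section \<open>Saturation\<close>

text \<open>With the diagrams \<open>X\<close> and \<open>Y\<close>, the hole is \<open>2 Y - X\<close> and one half of the pure diagram.\<close>

theorem not_saturated: "\<not> saturated (B_mod TYPE('k::field) 3 3 window_lo window_hi)"
proof -
  let ?B = "B_mod TYPE('k) 3 3 window_lo window_hi"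
  let ?X = "dgm 1 0 6 0 8 3" and ?Y = "dgm 1 1 3 0 5 2" and ?w = "dgm (1 + 0) 2 0 0 2 1"
  \<comment> \<open>\<open>2 Y - X\<close>, written with differences only\<close>
  have "?Y - (?X - ?Y) \<in> group_closure ?B"
    by (rule group_closure.diff group_closure.base insertI2 square_zero_in_B_mod square_zero_quotient_in_B_mod)+
  also have "?Y - (?X - ?Y) = ?w" by (simp add: dgm_def fun_eq_iff)
  finally have "?w \<in> group_closure ?B" .
  moreover have "scale (of_nat 2) ?w = dgm 2 4 0 0 4 2" by (simp add: dgm_def fun_eq_iff scale_def)
  then have "\<exists>m::nat. 1 \<le> m \<and> scale (of_nat m) ?w \<in> ?B" using pure_resolution_3[where 'k = 'k]
    by (intro exI[of _ 2]) simp
  ultimately show ?thesis using half_pure_not_in_B_mod[of 0, where 'k = 'k] unfolding saturated_def by blast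
qed

text \<open>Adding copies of the diagram of the ring leaves the hole in the cone but never fills it.\<close>

theorem infinitely_many_missing:
  "infinite (B_N TYPE('k::field) 3 3 window_lo window_hi - B_mod TYPE('k) 3 3 window_lo window_hi)"
proof -
  let ?B = "B_mod TYPE('k) 3 3 window_lo window_hi"
  let ?w = "\<lambda>k. dgm (1 + k) 2 0 0 2 1"
  let ?b = "dgm 2 4 0 0 4 2" and ?e = "dgm 1 0 0 0 0 0"
  have be: "?b \<noteq> ?e" by (auto simp: dgm_def fun_eq_iff dest: spec[of _ 0])
  have "?w k \<in> B_N TYPE('k) 3 3 window_lo window_hi" for k
  proof -
    have sum: "(\<Sum>t\<in>{?b, ?e}. scale (if t = ?b then 1 / 2 else of_nat k) t)
        = scale (1 / 2) ?b + scale (of_nat k) ?e"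
      using be by simp
    have "?w k = (\<Sum>t\<in>{?b, ?e}. scale (if t = ?b then 1 / 2 else of_nat k) t)"
      unfolding sum by (simp add: scale_def dgm_def fun_eq_iff)
    moreover have "{?b, ?e} \<subseteq> ?B" using pure_resolution_3 ring_in_B_mod by blast
    ultimately have "?w k \<in> rational_cone ?B" unfolding rational_cone_def mem_Collect_eq
      by (intro exI[of _ "{?b, ?e}"] exI[of _ "\<lambda>t. if t = ?b then 1 / 2 else of_nat k"]) auto
    then show ?thesis by (auto simp: B_N_def B_Q_def lattice_points_def dgm_def)
  qed
  then have "range ?w \<subseteq> B_N TYPE('k) 3 3 window_lo window_hi - ?B" using half_pure_not_in_B_mod by blast
  moreover have "inj ?w"
  proof (rule injI)
    fix k l assume "?w k = ?w l"
    from fun_cong[OF fun_cong[OF this, of 0], of 0] show "k = l" by (simp add: dgm_def)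
  qed
  ultimately show ?thesis using range_inj_infinite infinite_super by blast
qed

section \<open>Three linear maps between six-dimensional spaces\<close>

context vspace
begin

abbreviation ssum :: "'b set \<Rightarrow> 'b set \<Rightarrow> 'b set" where
  "ssum P Q \<equiv> {x + y |x y. x \<in> P \<and> y \<in> Q}"

lemma dim_0: "local.dim {0} = 0"
  using dim_le_card[of "{0}" "{}"] by simp

text \<open>The part of \<open>P\<close> sent into \<open>B\<close> is the kernel of the induced map into the sum modulo \<open>B\<close>.\<close>

lemma dim_preimage:
  assumes f: "Vector_Spaces.linear scale scale f" and P: "local.subspace P" "findim P"
    and B: "local.subspace B" "findim B"
  shows "local.dim {v \<in> P. f v \<in> B} + local.dim (ssum B (f ` P)) = local.dim P + local.dim B"
proof -
  interpret f: Vector_Spaces.linear scale scale f by fact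
  let ?A = "{v \<in> P. f v \<in> B}"
  have A: "local.subspace ?A" using P(1) B(1)
    by (auto simp: subspace_def f.add f.scale)
  have "findim ?A" by (rule findim_subset[OF P(2)]) blast
  from rank_nullity[OF f A this] have 1: "local.dim ?A = local.dim (f ` ?A) + local.dim {a \<in> ?A. f a = 0}" .
  have 2: "f ` ?A = B \<inter> f ` P" by blast
  have 3: "{a \<in> ?A. f a = 0} = {a \<in> P. f a = 0}" using B(1) subspace_0 by auto
  show ?thesis
    using 1 rank_nullity[OF f P] dim_add(1)[OF B f.subspace_image[OF P(1)] findim_image[OF f P(2)]]
    unfolding 2 3 by simp
qed

text \<open>The maps \<open>a, b, c\<close> play the role of the multiplications by three variables from \<open>V\<close> to \<open>W\<close>, for a
  module that is generated by \<open>V\<close> and has no socle there; \<open>(\<alpha>, \<beta>, \<gamma>)\<close> embeds \<open>Z\<close> into the triples in \<open>V\<close>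
  that are related like \<open>(x\<^sub>0, x\<^sub>1, x\<^sub>2)\<close> times a common factor.\<close>

definition pencil :: "'b set \<Rightarrow> 'b set \<Rightarrow> 'b set \<Rightarrow> ('b \<Rightarrow> 'b) \<Rightarrow> ('b \<Rightarrow> 'b) \<Rightarrow> ('b \<Rightarrow> 'b) \<Rightarrow>
    ('b \<Rightarrow> 'b) \<Rightarrow> ('b \<Rightarrow> 'b) \<Rightarrow> ('b \<Rightarrow> 'b) \<Rightarrow> bool" where
  "pencil V W Z a b c \<alpha> \<beta> \<gamma> \<longleftrightarrow>
     local.subspace V \<and> findim V \<and> local.subspace Z \<and> findim Z \<and>
     (\<forall>f\<in>{a, b, c, \<alpha>, \<beta>, \<gamma>}. Vector_Spaces.linear scale scale f) \<and>
     \<alpha> ` Z \<subseteq> V \<and> \<beta> ` Z \<subseteq> V \<and> \<gamma> ` Z \<subseteq> V \<and>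
     (\<forall>z\<in>Z. a (\<beta> z) = b (\<alpha> z) \<and> a (\<gamma> z) = c (\<alpha> z) \<and> b (\<gamma> z) = c (\<beta> z)) \<and>
     (\<forall>z\<in>Z. \<alpha> z = 0 \<longrightarrow> \<beta> z = 0 \<longrightarrow> \<gamma> z = 0 \<longrightarrow> z = 0) \<and>
     (\<forall>v\<in>V. a v = 0 \<longrightarrow> b v = 0 \<longrightarrow> c v = 0 \<longrightarrow> v = 0) \<and>
     (\<forall>w\<in>W. \<exists>x\<in>V. \<exists>y\<in>V. \<exists>z\<in>V. w = a x + b y + c z)"

lemma pencilD:
  assumes "pencil V W Z a b c \<alpha> \<beta> \<gamma>"
  shows "local.subspace V" "findim V" "local.subspace Z" "findim Z"
    "Vector_Spaces.linear scale scale a" "Vector_Spaces.linear scale scale b" "Vector_Spaces.linear scale scale c"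
    "Vector_Spaces.linear scale scale \<alpha>" "Vector_Spaces.linear scale scale \<beta>" "Vector_Spaces.linear scale scale \<gamma>"
    "z \<in> Z \<Longrightarrow> \<alpha> z \<in> V" "z \<in> Z \<Longrightarrow> \<beta> z \<in> V" "z \<in> Z \<Longrightarrow> \<gamma> z \<in> V"
    "z \<in> Z \<Longrightarrow> a (\<beta> z) = b (\<alpha> z)" "z \<in> Z \<Longrightarrow> a (\<gamma> z) = c (\<alpha> z)" "z \<in> Z \<Longrightarrow> b (\<gamma> z) = c (\<beta> z)"
    "z \<in> Z \<Longrightarrow> \<alpha> z = 0 \<Longrightarrow> \<beta> z = 0 \<Longrightarrow> \<gamma> z = 0 \<Longrightarrow> z = 0"
    "v \<in> V \<Longrightarrow> a v = 0 \<Longrightarrow> b v = 0 \<Longrightarrow> c v = 0 \<Longrightarrow> v = 0"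
    "w \<in> W \<Longrightarrow> \<exists>x\<in>V. \<exists>y\<in>V. \<exists>z\<in>V. w = a x + b y + c z"
  using assms unfolding pencil_def by (simp_all add: image_subset_iff)

lemma pencil_swap:
  assumes "pencil V W Z a b c \<alpha> \<beta> \<gamma>" shows "pencil V W Z b a c \<beta> \<alpha> \<gamma>"
proof -
  note d = pencilD[OF assms]
  have "\<exists>x\<in>V. \<exists>y\<in>V. \<exists>z\<in>V. w = b x + a y + c z" if w: "w \<in> W" for w
    using d(19)[OF w] by (metis add.commute)
  then show ?thesis unfolding pencil_def using d(1-18) by (simp add: image_subset_iff)
qed

lemma pencil_rotate:
  assumes "pencil V W Z a b c \<alpha> \<beta> \<gamma>" shows "pencil V W Z c a b \<gamma> \<alpha> \<beta>"
proof -
  note d = pencilD[OF assms]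
  have "\<exists>x\<in>V. \<exists>y\<in>V. \<exists>z\<in>V. w = c x + a y + b z" if w: "w \<in> W" for w
  proof -
    obtain x y z where "x \<in> V" "y \<in> V" "z \<in> V" "w = a x + b y + c z" using d(19)[OF w] by blast
    moreover from this have "w = c z + a x + b y" by (simp add: algebra_simps)
    ultimately show ?thesis by blast
  qed
  then show ?thesis unfolding pencil_def using d(1-18) by (simp add: image_subset_iff)
qed

text \<open>The change of variables that replaces the first variable by its sum with the second one.\<close>

lemma pencil_add:
  assumes "pencil V W Z a b c \<alpha> \<beta> \<gamma>"
  shows "pencil V W Z (\<lambda>v. a v + b v) b c (\<lambda>z. \<alpha> z + \<beta> z) \<beta> \<gamma>"
proof -
  note d = pencilD[OF assms]
  interpret vector_space_pair scale scale ..
  interpret a: Vector_Spaces.linear scale scale a by (rule d(5))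
  interpret b: Vector_Spaces.linear scale scale b by (rule d(6))
  interpret c: Vector_Spaces.linear scale scale c by (rule d(7))
  have lin: "Vector_Spaces.linear scale scale (\<lambda>v. a v + b v)"
    "Vector_Spaces.linear scale scale (\<lambda>z. \<alpha> z + \<beta> z)"
    by (rule linear_compose_add d(5-10))+
  have gen: "\<exists>x\<in>V. \<exists>y\<in>V. \<exists>z\<in>V. w = (a x + b x) + b y + c z" if w: "w \<in> W" for w
  proof -
    obtain x y z where xyz: "x \<in> V" "y \<in> V" "z \<in> V" "w = a x + b y + c z" using d(19)[OF w] by blast
    then have "w = (a x + b x) + b (y - x) + c z" by (simp add: b.diff)
    then show ?thesis using xyz subspace_diff[OF d(1)] by blast
  qed
  have "\<alpha> z + \<beta> z \<in> V" if "z \<in> Z" for z by (rule subspace_add[OF d(1) d(11,12)[OF that]])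
  moreover have i1: "\<forall>z\<in>Z. \<alpha> z + \<beta> z = 0 \<longrightarrow> \<beta> z = 0 \<longrightarrow> \<gamma> z = 0 \<longrightarrow> z = 0"
    by (intro ballI impI, rule d(17)) simp_all
  have i2: "\<forall>v\<in>V. a v + b v = 0 \<longrightarrow> b v = 0 \<longrightarrow> c v = 0 \<longrightarrow> v = 0"
    by (intro ballI impI, rule d(18)) simp_all
  ultimately show ?thesis unfolding pencil_def using d(1-16) lin gen
    by (simp add: image_subset_iff a.add b.add c.add) (rule conjI[OF i1 i2])
qed

text \<open>Restrict to the kernels of \<open>\<alpha>\<close> and of \<open>(\<alpha>, \<beta>)\<close>. The relations put the values of \<open>\<alpha>\<close> into the
  space \<open>A\<close> of vectors that \<open>b\<close> and \<open>c\<close> map into the image of \<open>a\<close>, and the values of \<open>\<beta>\<close> and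
  \<open>\<gamma>\<close> on the kernel of \<open>\<alpha>\<close> into the kernel \<open>K\<close> of \<open>a\<close>.\<close>

lemma pencil_rank_3:
  assumes pen: "pencil V W Z a b c \<alpha> \<beta> \<gamma>" and V6: "local.dim V = 6" and W6: "6 \<le> local.dim W"
    and r3: "3 \<le> local.dim (a ` V)"
  shows "local.dim Z \<le> 8"
proof -
  note p = pencilD[OF pen]
  note la = p(5) and lb = p(6) and lc = p(7) and l\<alpha> = p(8) and l\<beta> = p(9) and l\<gamma> = p(10)
  interpret a: Vector_Spaces.linear scale scale a by (rule la)
  interpret b: Vector_Spaces.linear scale scale b by (rule lb)
  interpret c: Vector_Spaces.linear scale scale c by (rule lc)
  interpret \<alpha>: Vector_Spaces.linear scale scale \<alpha> by (rule l\<alpha>)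
  interpret \<beta>: Vector_Spaces.linear scale scale \<beta> by (rule l\<beta>)
  interpret \<gamma>: Vector_Spaces.linear scale scale \<gamma> by (rule l\<gamma>)
  note V = p(1,2) and Z = p(3,4)
  have aV: "local.subspace (a ` V)" "findim (a ` V)" by (rule a.subspace_image[OF V(1)] findim_image[OF la V(2)])+
  define K where "K = {v \<in> V. a v = 0}"
  have K: "local.subspace K" "findim K"
    using V(1) findim_subset[OF V(2), of K] by (auto simp: K_def subspace_def a.add a.scale)
  define A where "A = {v \<in> V. b v \<in> a ` V \<and> c v \<in> a ` V}"
  have fA: "findim A" by (rule findim_subset[OF V(2)]) (auto simp: A_def)
  have dK: "local.dim V = local.dim (a ` V) + local.dim K" unfolding K_def by (rule rank_nullity[OF la V])
  \<comment> \<open>the images of \<open>b\<close> and \<open>c\<close> modulo the image of \<open>a\<close> depend only on \<open>V / A\<close>\<close>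
  let ?B = "ssum (a ` V) (b ` V)"
  have B: "local.subspace ?B" "findim ?B"
    using subspace_sums[OF aV(1) b.subspace_image[OF V(1)]]
      dim_add(2)[OF aV b.subspace_image[OF V(1)] findim_image[OF lb V(2)]] .
  have aB: "a ` V \<subseteq> ?B"
  proof
    fix x assume "x \<in> a ` V"
    moreover have "0 \<in> b ` V" by (rule image_eqI[of _ _ 0]) (use subspace_0[OF V(1)] in \<open>simp_all add: b.zero\<close>)
    ultimately show "x \<in> ?B" unfolding mem_Collect_eq by (intro exI[of _ x] exI[of _ 0]) simp
  qed
  have "local.dim A \<le> local.dim {v \<in> V. b v \<in> a ` V}"
    by (rule findim_dim_mono[OF findim_subset[OF V(2)]]) (auto simp: A_def)
  then have d1: "local.dim A + local.dim ?B \<le> local.dim V + local.dim (a ` V)"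
    using dim_preimage[OF lb V aV] by simp
  have "local.dim A \<le> local.dim {v \<in> V. c v \<in> ?B}"
    by (rule findim_dim_mono[OF findim_subset[OF V(2)]]) (use aB in \<open>auto simp: A_def\<close>)
  then have d2: "local.dim A + local.dim (ssum ?B (c ` V)) \<le> local.dim V + local.dim ?B"
    using dim_preimage[OF lc V B] by simp
  have "W \<subseteq> ssum ?B (c ` V)"
  proof
    fix w assume "w \<in> W"
    then obtain x y z where "x \<in> V" "y \<in> V" "z \<in> V" "w = a x + b y + c z" using p(19) by blast
    then show "w \<in> ssum ?B (c ` V)" by blast
  qed
  then have d3: "local.dim W \<le> local.dim (ssum ?B (c ` V))"
    by (intro findim_dim_mono dim_add(2)[OF B c.subspace_image[OF V(1)] findim_image[OF lc V(2)]])
  \<comment> \<open>no vector is killed by the whole pencil\<close>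
  have bK: "local.subspace (b ` K)" "findim (b ` K)" by (rule b.subspace_image[OF K(1)] findim_image[OF lb K(2)])+
  let ?C = "ssum (b ` K) (c ` K)"
  have C: "findim ?C" by (rule dim_add(2)[OF bK c.subspace_image[OF K(1)] findim_image[OF lc K(2)]])
  let ?N = "{v \<in> K. b v = 0}"
  have N: "local.subspace ?N" "findim ?N"
    using K(1) findim_subset[OF K(2), of ?N] by (auto simp: subspace_def b.add b.scale)
  have z: "0 \<in> b ` K" "0 \<in> c ` K" using subspace_0[OF K(1)] b.zero c.zero by (metis imageI)+
  have dN: "local.dim K = local.dim (b ` K) + local.dim ?N" by (rule rank_nullity[OF lb K])
  have "{v \<in> ?N. c v = 0} = {0}" using p(18) subspace_0[OF N(1)] c.zero by (auto simp: K_def)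
  then have "local.dim ?N = local.dim (c ` ?N)"
    using rank_nullity[OF lc N] dim_0 by simp
  moreover have "local.dim (c ` ?N) \<le> local.dim ?C"
  proof (rule findim_dim_mono[OF C], safe)
    fix v assume "v \<in> K"
    then show "\<exists>x y. c v = x + y \<and> x \<in> b ` K \<and> y \<in> c ` K" using z(1) by (intro exI[of _ 0] exI[of _ "c v"]) auto
  qed
  moreover have "local.dim (b ` K) \<le> local.dim ?C"
  proof (rule findim_dim_mono[OF C], safe)
    fix v assume "v \<in> K"
    then show "\<exists>x y. b v = x + y \<and> x \<in> b ` K \<and> y \<in> c ` K" using z(2) by (intro exI[of _ "b v"] exI[of _ 0]) auto
  qed
  ultimately have d4: "local.dim K \<le> 2 * local.dim ?C" using dN by simp
  have d5: "local.dim {v \<in> K. c v \<in> b ` K} + local.dim ?C = local.dim K + local.dim (b ` K)"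
    by (rule dim_preimage[OF lc K bK])
  \<comment> \<open>the filtration of \<open>Z\<close>\<close>
  let ?Z1 = "{z \<in> Z. \<alpha> z = 0}" and ?Z2 = "{z \<in> {z \<in> Z. \<alpha> z = 0}. \<beta> z = 0}"
  have Z1: "local.subspace ?Z1" "findim ?Z1"
    using Z(1) findim_subset[OF Z(2), of ?Z1] by (auto simp: subspace_def \<alpha>.add \<alpha>.scale)
  have Z2: "local.subspace ?Z2" "findim ?Z2"
    using Z1(1) findim_subset[OF Z1(2), of ?Z2] by (auto simp: subspace_def \<beta>.add \<beta>.scale)
  have "\<alpha> ` Z \<subseteq> A"
  proof safe
    fix z assume "z \<in> Z"
    then have "b (\<alpha> z) = a (\<beta> z)" "c (\<alpha> z) = a (\<gamma> z)" "\<alpha> z \<in> V" "\<beta> z \<in> V" "\<gamma> z \<in> V"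
      using p(11-16) by auto
    then show "\<alpha> z \<in> A" unfolding A_def by simp
  qed
  then have e1: "local.dim Z \<le> local.dim A + local.dim ?Z1"
    using rank_nullity[OF l\<alpha> Z] findim_dim_mono[OF fA] by simp
  have inK: "\<beta> z \<in> K \<and> \<gamma> z \<in> K \<and> b (\<gamma> z) = c (\<beta> z)" if "z \<in> ?Z1" for z
  proof -
    have "a (\<beta> z) = b (\<alpha> z)" "a (\<gamma> z) = c (\<alpha> z)" "b (\<gamma> z) = c (\<beta> z)" "\<beta> z \<in> V" "\<gamma> z \<in> V"
      using p(11-16) that by auto
    then show ?thesis using that by (simp add: K_def b.zero c.zero)
  qed
  have "\<beta> ` ?Z1 \<subseteq> {v \<in> K. c v \<in> b ` K}"
  proof
    fix v assume "v \<in> \<beta> ` ?Z1"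
    then obtain z where z: "v = \<beta> z" "z \<in> ?Z1" by blast
    have "c (\<beta> z) \<in> b ` K" using inK[OF z(2)] by (metis imageI)
    then show "v \<in> {v \<in> K. c v \<in> b ` K}" using inK[OF z(2)] z(1) by simp
  qed
  then have e2: "local.dim ?Z1 \<le> local.dim {v \<in> K. c v \<in> b ` K} + local.dim ?Z2"
    using rank_nullity[OF l\<beta> Z1] findim_dim_mono[OF findim_subset[OF K(2)], of "{v \<in> K. c v \<in> b ` K}" "\<beta> ` ?Z1"]
    by auto
  have "\<gamma> ` ?Z2 \<subseteq> ?N"
  proof
    fix v assume "v \<in> \<gamma> ` ?Z2"
    then obtain z where z: "v = \<gamma> z" "z \<in> ?Z1" "\<beta> z = 0" by auto
    then show "v \<in> ?N" using inK[OF z(2)] by (simp add: c.zero)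
  qed
  then have "local.dim (\<gamma> ` ?Z2) \<le> local.dim ?N" by (rule findim_dim_mono[OF N(2)])
  moreover have "{z \<in> ?Z2. \<gamma> z = 0} = {0}"
    using p(17) subspace_0[OF Z2(1)] \<gamma>.zero by auto
  ultimately have e3: "local.dim ?Z2 \<le> local.dim ?N"
    using rank_nullity[OF l\<gamma> Z2] dim_0 by simp
  have "2 * local.dim A + local.dim K \<le> 12" using d1 d2 d3 dK V6 W6 by linarith
  moreover have "local.dim Z + local.dim ?C \<le> local.dim A + 2 * local.dim K" using d5 dN e1 e2 e3 by linarith
  moreover have "local.dim K \<le> 3" using dK V6 r3 by linarith
  moreover have "Z \<le> 8" if "2 * A + K \<le> 12" "Z + C \<le> A + 2 * K" "K \<le> 3" "K \<le> 2 * C" for A C K Z :: nat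
  proof -
    have "A \<le> (12 - K) div 2" "(K + 1) div 2 \<le> C" using that(1,4) by linarith+
    moreover have "K = 0 \<or> K = 1 \<or> K = 2 \<or> K = 3" using that(3) by linarith
    ultimately show ?thesis using that(2) by auto
  qed
  ultimately show ?thesis using d4 by blast
qed

text \<open>If all three maps had rank at most two, then their images would be independent and their kernels
  would meet pairwise in planes, so the sum of two of the maps would have rank four.\<close>

theorem pencil_bound:
  assumes pen: "pencil V W Z a b c \<alpha> \<beta> \<gamma>" and V6: "local.dim V = 6" and W6: "6 \<le> local.dim W"
  shows "local.dim Z \<le> 8"
proof (rule ccontr)
  assume Z8: "\<not> local.dim Z \<le> 8"
  have r: "local.dim (a ` V) \<le> 2" "local.dim (b ` V) \<le> 2" "local.dim (c ` V) \<le> 2"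
    "local.dim ((\<lambda>v. a v + b v) ` V) \<le> 2"
    using Z8 pencil_rank_3[OF pen V6 W6] pencil_rank_3[OF pencil_swap[OF pen] V6 W6]
      pencil_rank_3[OF pencil_rotate[OF pen] V6 W6] pencil_rank_3[OF pencil_add[OF pen] V6 W6] by linarith+
  note p = pencilD[OF pen]
  note la = p(5) and lb = p(6) and lc = p(7)
  interpret a: Vector_Spaces.linear scale scale a by (rule la)
  interpret b: Vector_Spaces.linear scale scale b by (rule lb)
  interpret c: Vector_Spaces.linear scale scale c by (rule lc)
  note V = p(1,2)
  have im: "local.subspace (f ` U)" "findim (f ` U)"
    if "Vector_Spaces.linear scale scale f" "local.subspace U" "findim U" for f U
    using findim_image[OF that(1,3)] module_hom.subspace_image[OF Vector_Spaces.linear.axioms(3)[OF that(1)] that(2)] by auto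
  let ?B = "ssum (a ` V) (b ` V)"
  have B: "local.subspace ?B" "findim ?B"
    by (rule subspace_sums dim_add(2) im la lb V)+
  have "W \<subseteq> ssum ?B (c ` V)"
  proof
    fix w assume "w \<in> W"
    then obtain x y z where "x \<in> V" "y \<in> V" "z \<in> V" "w = a x + b y + c z" using p(19) by blast
    then show "w \<in> ssum ?B (c ` V)" by blast
  qed
  from findim_dim_mono[OF dim_add(2)[OF B im[OF lc V]] this]
  have "6 \<le> local.dim (ssum ?B (c ` V))" using W6 by linarith
  then have "4 \<le> local.dim ?B"
    using dim_add(1)[OF B im[OF lc V]] r(3) by simp
  then have i0: "local.dim (a ` V \<inter> b ` V) = 0"
    using dim_add(1)[OF im[OF la V] im[OF lb V]] r(1,2) by simp
  let ?K = "{v \<in> V. a v = 0}" and ?L = "{v \<in> V. b v = 0}" and ?M = "{v \<in> V. a v = 0 \<and> b v = 0}"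
  have K: "local.subspace ?K" "findim ?K"
    using V(1) findim_subset[OF V(2), of ?K] by (auto simp: subspace_def a.add a.scale)
  have L: "local.subspace ?L" "findim ?L"
    using V(1) findim_subset[OF V(2), of ?L] by (auto simp: subspace_def b.add b.scale)
  have M: "local.subspace ?M" "findim ?M"
    using V(1) findim_subset[OF V(2), of ?M] by (auto simp: subspace_def a.add a.scale b.add b.scale)
  have dK: "4 \<le> local.dim ?K" "4 \<le> local.dim ?L"
    using rank_nullity[OF la V] rank_nullity[OF lb V] r V6 by simp_all
  have "{v \<in> ?M. c v = 0} = {0}" using p(18) subspace_0[OF M(1)] c.zero by auto
  then have "local.dim ?M = local.dim (c ` ?M)"
    using rank_nullity[OF lc M] dim_0 by simp
  also have "\<dots> \<le> local.dim (c ` V)" by (rule findim_dim_mono[OF im(2)[OF lc V]]) auto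
  finally have dM: "local.dim ?M \<le> 2" using r(3) by simp
  have "{v \<in> ?L. a v = 0} = ?M" "{v \<in> ?K. b v = 0} = ?M" by auto
  then have d2: "2 \<le> local.dim (a ` ?L)" "2 \<le> local.dim (b ` ?K)"
    using rank_nullity[OF la L] rank_nullity[OF lb K] dK dM by simp_all
  have "local.dim (a ` ?L \<inter> b ` ?K) \<le> local.dim (a ` V \<inter> b ` V)"
    by (rule findim_dim_mono[OF findim_subset[OF im(2)[OF la V]]]) auto
  then have "4 \<le> local.dim (ssum (a ` ?L) (b ` ?K))"
    using dim_add(1)[OF im[OF la L] im[OF lb K]] d2 i0 by simp
  also have "\<dots> \<le> local.dim ((\<lambda>v. a v + b v) ` V)"
  proof (rule findim_dim_mono)
    have "Vector_Spaces.linear scale scale (\<lambda>v. a v + b v)"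
      by (rule pencilD(5)[OF pencil_add[OF pen]])
    then show "findim ((\<lambda>v. a v + b v) ` V)" by (rule findim_image[OF _ V(2)])
    show "ssum (a ` ?L) (b ` ?K) \<subseteq> (\<lambda>v. a v + b v) ` V"
    proof safe
      fix x y assume xy: "x \<in> V" "b x = 0" "y \<in> V" "a y = 0"
      then have "a x + b y = a (x + y) + b (x + y)" by (simp add: a.add b.add)
      then show "a x + b y \<in> (\<lambda>v. a v + b v) ` V" using subspace_add[OF V(1) xy(1,3)] by blast
    qed
  qed
  finally show False using r(4) by simp
qed

end

section \<open>Quadratic second syzygies\<close>

lemma linear_comp:
  "Vector_Spaces.linear vscale vscale f \<Longrightarrow> Vector_Spaces.linear vscale vscale g \<Longrightarrow>
    Vector_Spaces.linear vscale vscale (\<lambda>v :: nat \<Rightarrow> 'k::field mpoly. g (f v :: nat \<Rightarrow> 'k mpoly) :: nat \<Rightarrow> 'k mpoly)"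
  using Vector_Spaces.linear_compose[of vscale vscale f vscale g] by (simp add: o_def)

definition dv :: "nat \<Rightarrow> (nat \<Rightarrow> 'k::field mpoly) \<Rightarrow> nat \<Rightarrow> 'k mpoly" where
  "dv u y = (\<lambda>t. dvar u (y t))"

definition cv :: "nat \<Rightarrow> (nat \<Rightarrow> 'k::field mpoly) \<Rightarrow> nat \<Rightarrow> 'k mpoly" where
  "cv l y = (\<lambda>t. Con (lin y t l))"

lemma dv_linear: "Vector_Spaces.linear vscale vscale (dv u :: (nat \<Rightarrow> 'k::field mpoly) \<Rightarrow> _)"
  by unfold_locales (auto simp: dv_def fun_eq_iff vscale_def pm_apply dvar_Con_mult)

lemma cv_linear: "Vector_Spaces.linear vscale vscale (cv u :: (nat \<Rightarrow> 'k::field mpoly) \<Rightarrow> _)"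
  by unfold_locales (simp_all add: cv_def fun_eq_iff lin_simps, simp add: vscale_def pm_apply)

lemma dv_FG: "y \<in> FG n as d \<Longrightarrow> dv u y \<in> FG n as (d - 1)"
  unfolding FG_iff dv_def using dvar_homogeneous by (fastforce simp: algebra_simps)

lemma dv_expand:
  assumes "\<And>t. y t \<in> irrelevant_ideal n" shows "y = (\<Sum>u<n. pm (X u) (dv u y))"
proof
  fix t show "y t = (\<Sum>u<n. pm (X u) (dv u y)) t"
    using var_expand[of "y t" n] assms[of t] by (simp add: sum_fun_apply pm_apply dv_def irrelevant_iff)
qed

lemma cv_FG: "cv l y \<in> FG n (replicate a 0) 0" if "y \<in> FG n (replicate a 0) d"
  using that by (auto simp: FG_iff cv_def lin_def)

lemma cv_expand:
  assumes "y \<in> FG n (replicate a 0) 1" shows "y = (\<Sum>l<n. pm (X l) (cv l y))"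
proof
  fix t show "y t = (\<Sum>l<n. pm (X l) (cv l y)) t"
  proof (cases "t < a")
    case True
    then have "y t \<in> poly_homogeneous n 1" using assms by (simp add: FG_iff)
    from linear_form_expand[OF this] show ?thesis by (simp add: sum_fun_apply pm_apply cv_def lin_def)
  next
    case False
    then have "y t = 0" using assms by (simp add: FG_iff)
    then show ?thesis by (simp add: sum_fun_apply pm_apply cv_def lin_def)
  qed
qed

text \<open>Both facts compare the coefficients of \<open>x\<^sub>u x\<^sub>v\<close>; in characteristic \<open>2\<close> the second
  one does not follow from the first one.\<close>

lemma linear_syzygy_of_variables:
  fixes f :: "nat \<Rightarrow> 'k::field mpoly"
  assumes "(\<Sum>l<n. X l * f l) = 0" "u < n" "v < n"
  shows "lk (f u) (Poly_Mapping.single v 1) = - lk (f v) (Poly_Mapping.single u 1)"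
    and "lk (f u) (Poly_Mapping.single u 1) = 0"
proof -
  have uu: "lk (f u) (Poly_Mapping.single u 1) = 0" if "u < n" for u
  proof -
    let ?m = "Poly_Mapping.single u (1::nat) + Poly_Mapping.single u 1"
    have "0 = lk (\<Sum>l<n. X l * f l) ?m" unfolding assms(1) by simp
    also have "\<dots> = (\<Sum>l<n. if l = u then lk (f u) (Poly_Mapping.single u 1) else 0)"
      unfolding lookup_sum by (rule sum.cong) (auto simp: lk_X_mult lookup_add lookup_single when_def)
    finally show ?thesis using that by simp
  qed
  then show "lk (f u) (Poly_Mapping.single u 1) = 0" using assms(2) .
  show "lk (f u) (Poly_Mapping.single v 1) = - lk (f v) (Poly_Mapping.single u 1)"
  proof (cases "u = v")
    case True
    then show ?thesis using uu[OF assms(2)] by simp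
  next
    case False
    let ?a = "Poly_Mapping.single u (1::nat)" and ?b = "Poly_Mapping.single v (1::nat)"
    have c: "lk (X l * f l) (?a + ?b) = (if l = u then lk (f u) ?b else 0) + (if l = v then lk (f v) ?a else 0)" for l
    proof -
      have "?a + ?b - ?a = ?b" "?a + ?b - ?b = ?a" by simp_all
      then show ?thesis using False by (auto simp: lk_X_mult lookup_add lookup_single when_def)
    qed
    have "0 = lk (\<Sum>l<n. X l * f l) (?a + ?b)" unfolding assms(1) by simp
    also have "\<dots> = (\<Sum>l<n. if l = u then lk (f u) ?b else 0) + (\<Sum>l<n. if l = v then lk (f v) ?a else 0)"
      unfolding lookup_sum c sum.distrib ..
    finally show ?thesis using assms(2,3) by (simp add: eq_neg_iff_add_eq_0)
  qed
qed

lemma constant_syzygy_of_variables: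
  fixes f :: "nat \<Rightarrow> 'k::field mpoly"
  assumes "(\<Sum>l<n. X l * f l) = 0" "u < n" shows "lk (f u) 0 = 0"
proof -
  have "0 = lk (\<Sum>l<n. X l * f l) (Poly_Mapping.single u 1)" unfolding assms(1) by simp
  also have "\<dots> = (\<Sum>l<n. if l = u then lk (f u) 0 else 0)"
    unfolding lookup_sum by (rule sum.cong) (auto simp: lk_X_mult lookup_single when_def)
  finally show ?thesis using assms(2) by simp
qed

lemma sum_lessThan_3: "(\<Sum>l<3. f l) = f 0 + f 1 + (f (2::nat) :: 'a::comm_monoid_add)"
  by (simp add: numeral_3_eq_3 numeral_2_eq_2 add.assoc)

lemma sum_pm_eq_0: "(\<Sum>l<n. pm (f l) (v l)) = 0 \<Longrightarrow> (\<Sum>l<n. f l * v l t) = 0"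
  by (drule fun_cong[of _ _ t]) (simp add: sum_fun_apply pm_apply)

lemma lowest_degree_eq_0:
  assumes v: "v \<in> FG n as d" and low: "\<And>a. a \<in> set as \<Longrightarrow> d \<le> a" and "\<And>t. lk (v t) 0 = 0"
  shows "v = 0"
proof (rule FG_irrelevant_low[OF v _ low])
  show "v t \<in> irrelevant_ideal n" for t
    using FM_coeff[OF FG_FM[OF v]] assms(3) by (simp add: irrelevant_iff)
qed

context
  fixes F :: "nat \<Rightarrow> int list" and G :: "nat \<Rightarrow> nat \<Rightarrow> nat \<Rightarrow> 'k::field mpoly" and a :: nat
  assumes R: "resolution 3 F G" and F0: "F 0 = replicate a 0"
    and F1: "set (F (Suc 0)) \<subseteq> {1, 1 + 1}" and F2: "set (F (Suc (Suc 0))) \<subseteq> {2, 2 + 1}"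
    and F3: "set (F (Suc (Suc (Suc 0)))) \<subseteq> {4}"
begin

private abbreviation "g0 \<equiv> comb (length (F (Suc 0))) (G 0)"
private abbreviation "g1 \<equiv> comb (length (F (Suc (Suc 0)))) (G (Suc 0))"
private abbreviation "T \<equiv> syz 3 F G 0 1"

lemma ker0: "y \<in> FG 3 (F (Suc 0)) j \<Longrightarrow> g0 y = 0 \<Longrightarrow> j \<le> 1 \<Longrightarrow> y = 0"
  by (rule resolution_kernel_low[OF R]) (use F2 in auto)

lemma ker1: "y \<in> FG 3 (F (Suc (Suc 0))) j \<Longrightarrow> g1 y = 0 \<Longrightarrow> j \<le> 3 \<Longrightarrow> y = 0"
  by (rule resolution_kernel_low[OF R]) (use F3 in auto)

text \<open>If all products \<open>x\<^sub>i v\<close> are combinations of the linear columns, with coefficients \<open>f\<^sub>i\<close>, then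
  \<open>x\<^sub>i f\<^sub>j - x\<^sub>j f\<^sub>i\<close> comes from second syzygies \<open>g\<^sub>i\<^sub>j\<close>, whose Koszul combination is a syzygy in degree \<open>3\<close>.
  As \<open>F 3\<close> is in degree \<open>4\<close>, it vanishes, and with it \<open>g\<close>, \<open>f\<close> and \<open>v\<close>.\<close>

lemma no_socle:
  assumes v: "v \<in> FG 3 (F 0) 0" and T: "\<And>i. i < 3 \<Longrightarrow> pm (X i) v \<in> T" shows "v = 0"
proof -
  have "\<exists>f. f \<in> FG 3 (F (Suc 0)) 1 \<and> pm (X i) v = g0 f" if "i < 3" for i
    using T[OF that] unfolding syz_def by blast
  then obtain f where f: "\<And>i. i < 3 \<Longrightarrow> f i \<in> FG 3 (F (Suc 0)) 1" "\<And>i. i < 3 \<Longrightarrow> pm (X i) v = g0 (f i)"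
    by metis
  have "\<exists>g. g \<in> FG 3 (F (Suc (Suc 0))) 2 \<and> pm (X i) (f j) - pm (X j) (f i) = g1 g" if "i < 3" "j < 3" for i j
  proof -
    have "pm (X i) (f j) - pm (X j) (f i) \<in> FG 3 (F (Suc 0)) 2"
      using FG_X[OF that(1) f(1)[OF that(2)]] FG_X[OF that(2) f(1)[OF that(1)]] by simp
    moreover have "g0 (pm (X i) (f j) - pm (X j) (f i)) = 0"
      by (simp add: f(2)[OF that(1), symmetric] f(2)[OF that(2), symmetric] mult.commute)
    ultimately have "pm (X i) (f j) - pm (X j) (f i) \<in> syz 3 F G (Suc 0) 2" unfolding syz_kernel[OF R] by simp
    then show ?thesis unfolding syz_def by blast
  qed
  then obtain g where g: "\<And>i j. i < 3 \<Longrightarrow> j < 3 \<Longrightarrow> g i j \<in> FG 3 (F (Suc (Suc 0))) 2"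
    "\<And>i j. i < 3 \<Longrightarrow> j < 3 \<Longrightarrow> pm (X i) (f j) - pm (X j) (f i) = g1 (g i j)" by metis
  define h where "h l = (if l = 0 then g 1 2 else if l = 1 then g 2 0 else g 0 1)" for l :: nat
  have hF: "h l \<in> FG 3 (F (Suc (Suc 0))) 2" for l using g(1) by (simp add: h_def)
  have "(\<Sum>l<3. pm (X l) (h l)) = 0"
  proof (rule ker1)
    show "(\<Sum>l<3. pm (X l) (h l)) \<in> FG 3 (F (Suc (Suc 0))) 3"
      using FG_X[OF _ hF] by (intro FG_sum) auto
    have k: "g1 (h 0) = pm (X 1) (f 2) - pm (X 2) (f 1)" "g1 (h 1) = pm (X 2) (f 0) - pm (X 0) (f 2)"
      "g1 (h 2) = pm (X 0) (f 1) - pm (X 1) (f 0)"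
      using g(2)[of 1 2] g(2)[of 2 0] g(2)[of 0 1] by (simp_all add: h_def)
    show "g1 (\<Sum>l<3. pm (X l) (h l)) = 0"
      unfolding comb_sum sum_lessThan_3 comb_simps(2,3) k by (simp add: fun_eq_iff pm_apply algebra_simps)
  qed simp
  then have "(\<Sum>l<3. X l * h l t) = 0" for t by (rule sum_pm_eq_0)
  then have lkh: "lk (h l t) 0 = 0" if "l < 3" for l t by (rule constant_syzygy_of_variables[OF _ that])
  have h0: "h l = 0" if "l < 3" for l
    by (rule lowest_degree_eq_0[OF hF]) (use F2 lkh[OF that] in auto)
  have fx: "X 0 * f 1 t = X 1 * f 0 t" "X 0 * f 2 t = X 2 * f 0 t" for t
  proof -
    have "pm (X 0) (f 1) - pm (X 1) (f 0) = 0" "pm (X 2) (f 0) - pm (X 0) (f 2) = 0"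
      using g(2)[of 2 0] g(2)[of 0 1] h0[of 1] h0[of 2] by (simp_all add: h_def)
    from fun_cong[OF this(1), of t] fun_cong[OF this(2), of t]
    show "X 0 * f 1 t = X 1 * f 0 t" "X 0 * f 2 t = X 2 * f 0 t" by (simp_all add: pm_apply)
  qed
  have lkf: "lk (f 0 t) 0 = 0" for t
    using arg_cong[OF fx(1)[of t], of "\<lambda>p. lk p (Poly_Mapping.single 1 1)"]
    by (simp add: lk_X_mult lookup_single when_def)
  have "f 0 = 0" by (rule lowest_degree_eq_0[OF f(1)]) (use F1 lkf in auto)
  then show "v = 0" using f(2)[of 0] by (simp add: pm_eq_0)
qed

text \<open>An element \<open>z\<close> of degree \<open>2\<close> of \<open>F 2\<close> is a linear relation between linear columns. Writing its entries
  as \<open>\<Sum>\<^sub>u x\<^sub>u y\<^sub>u\<close> gives vectors \<open>t\<^sub>u = G 0 (y\<^sub>u)\<close> with \<open>\<Sum>\<^sub>u x\<^sub>u t\<^sub>u = 0\<close>, and \<open>\<tau> u l z\<close> is the coefficient of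
  \<open>x\<^sub>l\<close> in \<open>t\<^sub>u\<close>. By skew-symmetry three constant vectors \<open>\<tau> 1 2 z, \<tau> 2 0 z, \<tau> 0 1 z\<close> remain. Each
  \<open>t\<^sub>u\<close> is a relation of the module, which says that these three are related like \<open>x\<^sub>0, x\<^sub>1, x\<^sub>2\<close>.\<close>

private definition "\<tau> u l z = cv l (g0 (dv u (g1 z)))"

lemma \<tau>_linear: "Vector_Spaces.linear vscale vscale (\<tau> u l)"
  unfolding \<tau>_def
  by (rule linear_comp[OF linear_comp[OF linear_comp[OF comb_linear dv_linear] comb_linear] cv_linear])

lemma \<tau>_facts:
  assumes z: "z \<in> FG 3 (F (Suc (Suc 0))) 2"
  shows "\<tau> u l z \<in> FG 3 (F 0) 0"
    and "(\<Sum>l<3. pm (X l) (\<tau> u l z)) \<in> T"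
    and "u < 3 \<Longrightarrow> l < 3 \<Longrightarrow> \<tau> u l z = - \<tau> l u z" and "u < 3 \<Longrightarrow> \<tau> u u z = 0"
    and "(\<And>u l. u < 3 \<Longrightarrow> l < 3 \<Longrightarrow> \<tau> u l z = 0) \<Longrightarrow> z = 0"
proof -
  define y where "y = g1 z"
  have "y \<in> syz 3 F G (Suc 0) 2" unfolding syz_def y_def by (rule imageI[OF z])
  then have y: "y \<in> FG 3 (F (Suc 0)) 2" "g0 y = 0" unfolding syz_kernel[OF R] by simp_all
  have yd: "y = (\<Sum>u<3. pm (X u) (dv u y))"
    by (rule dv_expand, rule resolution_kernel_irrelevant[OF R FG_FM[OF y(1)] y(2)])
  have dy: "dv u y \<in> FG 3 (F (Suc 0)) 1" for u using dv_FG[OF y(1), of u] by simp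
  define t where "t u = g0 (dv u y)" for u
  have tT: "t u \<in> T" for u unfolding t_def syz_def by (rule imageI[OF dy])
  then have tF: "t u \<in> FG 3 (F 0) 1" for u using syz_FG[OF R, of 0 1] by blast
  note tF' = tF[unfolded F0]
  have \<tau>t: "\<tau> u l z = cv l (t u)" for u l by (simp add: \<tau>_def t_def y_def)
  have tex: "t u = (\<Sum>l<3. pm (X l) (\<tau> u l z))" for u unfolding \<tau>t by (rule cv_expand[OF tF'])
  show "\<tau> u l z \<in> FG 3 (F 0) 0" unfolding \<tau>t F0 by (rule cv_FG[OF tF'])
  show "(\<Sum>l<3. pm (X l) (\<tau> u l z)) \<in> T" unfolding tex[symmetric] by (rule tT)
  have "0 = g0 (\<Sum>u<3. pm (X u) (dv u y))" using y(2) yd by simp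
  also have "\<dots> = (\<Sum>u<3. pm (X u) (t u))" by (simp only: comb_sum comb_simps t_def)
  finally have "(\<Sum>u<3. pm (X u) (t u)) = 0" by simp
  then have rel: "(\<Sum>u<3. X u * t u s) = 0" for s by (rule sum_pm_eq_0)
  show "\<tau> u l z = - \<tau> l u z" if "u < 3" "l < 3"
  proof
    fix s show "\<tau> u l z s = (- \<tau> l u z) s"
      using linear_syzygy_of_variables(1)[OF rel that, of s] by (simp add: \<tau>t cv_def lin_def)
  qed
  show "\<tau> u u z = 0" if "u < 3"
  proof
    fix s show "\<tau> u u z s = 0 s"
      using linear_syzygy_of_variables(2)[OF rel that that, of s] by (simp add: \<tau>t cv_def lin_def)
  qed
  show "z = 0" if 0: "\<And>u l. u < 3 \<Longrightarrow> l < 3 \<Longrightarrow> \<tau> u l z = 0"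
  proof -
    have "dv u y = 0" if "u < 3" for u
    proof (rule ker0[OF dy])
      have "t u = 0" by (subst tex, rule sum.neutral) (use 0[OF that] in simp)
      then show "g0 (dv u y) = 0" by (simp add: t_def)
    qed simp
    then have "y = 0" by (subst yd, intro sum.neutral) simp
    then show ?thesis using ker1[OF z] by (simp add: y_def)
  qed
qed

text \<open>The spaces of the pencil are the parts of degree \<open>0\<close> and \<open>1\<close> of the module, of dimensions \<open>6\<close> and
  \<open>18 - 12\<close>, and the part of degree \<open>2\<close> of \<open>F 2\<close>.\<close>

theorem linear_second_syzygies_bound:
  assumes a: "a = 6" and c1: "count_list (F (Suc 0)) 1 = 12"
  shows "count_list (F (Suc (Suc 0))) 2 \<le> 8"
proof -
  let ?V = "FG 3 (F 0) 0 :: (nat \<Rightarrow> 'k mpoly) set" and ?R = "FG 3 (F 0) 1 :: (nat \<Rightarrow> 'k mpoly) set"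
    and ?Z = "FG 3 (F (Suc (Suc 0))) 2 :: (nat \<Rightarrow> 'k mpoly) set"
  have H: "Hilb 3 (- 1) = 0" by (rule Hilb_neg) simp
  have dV: "V.dim ?V = 6" and dR: "V.dim ?R = 18"
    by (simp_all add: dim_FG F0 a sum_list_replicate Hilb_3)
  have dZ: "V.dim ?Z = count_list (F (Suc (Suc 0))) 2"
    unfolding dim_FG sum_list_two_values[OF F2] using H by simp
  have "V.dim (syz 3 F G (Suc 0) 1) = 0"
  proof -
    have "syz 3 F G (Suc 0) 1 = {0}" by (rule syz_lowest[OF R]) (use F1 in auto)
    then show ?thesis by (simp add: V.dim_0)
  qed
  then have dT: "V.dim T = 12"
    using syz_dim[OF R, of 0 1] sum_list_two_values[OF F1, of "\<lambda>a. Hilb 3 (1 - a)"] c1 H by simp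
  have TR: "T \<subseteq> ?R" by (rule syz_FG[OF R])
  obtain p where p: "Vector_Spaces.linear vscale vscale p" "\<And>r. r \<in> ?R \<Longrightarrow> p r = 0 \<longleftrightarrow> r \<in> T"
    by (rule V.projection_exists[OF syz_subspace FG_subspace TR]) (rule that)
  interpret p: Vector_Spaces.linear vscale vscale p by (rule p(1))
  have "{r \<in> ?R. p r = 0} = T" using p(2) TR by auto
  then have dW: "V.dim (p ` ?R) = 6"
    using V.rank_nullity[OF p(1) FG_subspace findim_FG, of 3 "F 0" 1] dR dT by simp
  define x where "x i v = p (pm (X i) v)" for i v
  have x_lin: "Vector_Spaces.linear vscale vscale (x i)" for i
    unfolding x_def by (rule linear_comp[OF pm_linear p(1)])
  interpret x: Vector_Spaces.linear vscale vscale "x i" for i by (rule x_lin)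
  have XR: "pm (X i) v \<in> ?R" if "i < 3" "v \<in> ?V" for i v using FG_X[OF that] by simp
  have rel: "x 0 (\<tau> u 0 z) + x 1 (\<tau> u 1 z) + x 2 (\<tau> u 2 z) = 0" if z: "z \<in> ?Z" for u z
  proof -
    have "p (\<Sum>l<3. pm (X l) (\<tau> u l z)) = 0" using p(2) TR \<tau>_facts(2)[OF z] by blast
    then show ?thesis unfolding sum_lessThan_3 p.add x_def .
  qed
  have "V.pencil ?V (p ` ?R) ?Z (x 0) (x 1) (x 2) (\<tau> 1 2) (\<tau> 2 0) (\<tau> 0 1)"
    unfolding V.pencil_def
  proof (intro conjI FG_subspace findim_FG)
    show "\<forall>f\<in>{x 0, x 1, x 2, \<tau> 1 2, \<tau> 2 0, \<tau> 0 1}. Vector_Spaces.linear vscale vscale f"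
      using x_lin \<tau>_linear by simp
    show "\<tau> 1 2 ` ?Z \<subseteq> ?V" "\<tau> 2 0 ` ?Z \<subseteq> ?V" "\<tau> 0 1 ` ?Z \<subseteq> ?V" using \<tau>_facts(1) by blast+
    show "\<forall>z\<in>?Z. x 0 (\<tau> 2 0 z) = x 1 (\<tau> 1 2 z) \<and> x 0 (\<tau> 0 1 z) = x 2 (\<tau> 1 2 z) \<and>
        x 1 (\<tau> 0 1 z) = x 2 (\<tau> 2 0 z)"
    proof
      fix z assume z: "z \<in> ?Z"
      have s: "\<tau> 0 0 z = 0" "\<tau> 1 1 z = 0" "\<tau> 2 2 z = 0" "\<tau> 0 2 z = - \<tau> 2 0 z" "\<tau> 1 0 z = - \<tau> 0 1 z"
        "\<tau> 2 1 z = - \<tau> 1 2 z" by (rule \<tau>_facts(3,4)[OF z]; simp)+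
      show "x 0 (\<tau> 2 0 z) = x 1 (\<tau> 1 2 z) \<and> x 0 (\<tau> 0 1 z) = x 2 (\<tau> 1 2 z) \<and>
        x 1 (\<tau> 0 1 z) = x 2 (\<tau> 2 0 z)"
        using rel[OF z, of 0] rel[OF z, of 1] rel[OF z, of 2] unfolding s x.zero x.neg
        by (simp add: algebra_simps)
    qed
    show "\<forall>z\<in>?Z. \<tau> 1 2 z = 0 \<longrightarrow> \<tau> 2 0 z = 0 \<longrightarrow> \<tau> 0 1 z = 0 \<longrightarrow> z = 0"
    proof (intro ballI impI)
      fix z assume z: "z \<in> ?Z" and 0: "\<tau> 1 2 z = 0" "\<tau> 2 0 z = 0" "\<tau> 0 1 z = 0"
      have s: "\<tau> 0 0 z = 0" "\<tau> 1 1 z = 0" "\<tau> 2 2 z = 0" "\<tau> 0 2 z = - \<tau> 2 0 z" "\<tau> 1 0 z = - \<tau> 0 1 z"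
        "\<tau> 2 1 z = - \<tau> 1 2 z" by (rule \<tau>_facts(3,4)[OF z]; simp)+
      show "z = 0"
      proof (rule \<tau>_facts(5)[OF z])
        fix u l :: nat assume "u < 3" "l < 3"
        then have "(u = 0 \<or> u = 1 \<or> u = 2) \<and> (l = 0 \<or> l = 1 \<or> l = 2)" by auto
        then show "\<tau> u l z = 0" using s 0 by auto
      qed
    qed
    show "\<forall>v\<in>?V. x 0 v = 0 \<longrightarrow> x 1 v = 0 \<longrightarrow> x 2 v = 0 \<longrightarrow> v = 0"
    proof (intro ballI impI)
      fix v assume v: "v \<in> ?V" and 0: "x 0 v = 0" "x 1 v = 0" "x 2 v = 0"
      show "v = 0"
      proof (rule no_socle[OF v])
        fix i :: nat assume i: "i < 3"
        then have "i = 0 \<or> i = 1 \<or> i = 2" by auto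
        then have "x i v = 0" using 0 by auto
        then show "pm (X i) v \<in> T" using p(2)[OF XR[OF i v]] by (simp add: x_def)
      qed
    qed
    show "\<forall>w\<in>p ` ?R. \<exists>u\<in>?V. \<exists>v\<in>?V. \<exists>z\<in>?V. w = x 0 u + x 1 v + x 2 z"
    proof
      fix w assume "w \<in> p ` ?R"
      then obtain r where r: "r \<in> ?R" "w = p r" by blast
      note r' = r(1)[unfolded F0]
      have "w = p (\<Sum>l<3. pm (X l) (cv l r))" using cv_expand[OF r'] r(2) by simp
      then have "w = x 0 (cv 0 r) + x 1 (cv 1 r) + x 2 (cv 2 r)" unfolding sum_lessThan_3 p.add x_def .
      moreover have "cv l r \<in> ?V" for l unfolding F0 by (rule cv_FG[OF r'])
      ultimately show "\<exists>u\<in>?V. \<exists>v\<in>?V. \<exists>z\<in>?V. w = x 0 u + x 1 v + x 2 z" by blast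
    qed
  qed
  from V.pencil_bound[OF this dV] dW show ?thesis unfolding dZ by simp
qed

end

section \<open>The four phenomena\<close>

text \<open>The double of \<open>D\<close> is the sum of the diagrams of the ring modulo the square of the irrelevant ideal and of
  its dual. The triple has nine linear second syzygies, one more than possible. As \<open>4\<close> and \<open>3\<close> are
  entries of \<open>D\<close>, only integral multiples are lattice points.\<close>

theorem gap_on_a_ray:
  defines "D \<equiv> dgm 2 4 3 3 4 2"
  shows "\<exists>R\<in>rays TYPE('k::field) 3 3 window_lo window_hi. ray_generator R D" (is ?ray)
    and "scale (of_nat 2) D \<in> B_mod TYPE('k) 3 3 window_lo window_hi" (is ?two)
    and "scale (of_nat 3) D \<notin> B_mod TYPE('k) 3 3 window_lo window_hi" (is ?three)
    and "scale (of_nat 4) D \<in> B_mod TYPE('k) 3 3 window_lo window_hi" (is ?four)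
proof -
  have "scale (of_nat 2) D = dgm 3 8 0 6 0 1 + dgm 1 0 6 0 8 3"
    by (simp add: D_def dgm_def scale_def fun_eq_iff)
  then show two: ?two using B_mod_add[OF dual_in_B_mod square_zero_in_B_mod] by simp
  have "scale (of_nat 4) D = scale (of_nat 2) D + scale (of_nat 2) D"
    by (simp add: scale_def fun_eq_iff)
  then show ?four using B_mod_add[OF two two] by simp
  have lat: "D \<in> lattice_points" by (simp add: D_def lattice_points_def dgm_def)
  have D: "D 0 0 = 2" "D 1 1 = 4" "D 1 2 = 3" by (simp_all add: D_def dgm_def)
  have nz: "D \<noteq> 0" using D(1) by (metis zero_fun_apply zero_neq_numeral)
  have int: "q \<in> \<int>" if "scale q D \<in> lattice_points" for q
  proof -
    have "q * D 1 1 \<in> \<int>" "q * D 1 2 \<in> \<int>" using that unfolding lattice_points_def scale_def by blast+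
    then have "q * 4 - q * 3 \<in> \<int>" unfolding D by (rule Ints_diff)
    then show ?thesis by (simp add: algebra_simps)
  qed
  then have prim: "\<forall>q. scale q D \<in> lattice_points \<longrightarrow> q \<in> \<int>" by blast
  have "half_line D \<inter> lattice_points \<in> rays TYPE('k) 3 3 window_lo window_hi"
    by (rule ray_of_primitive(1)[OF lat nz prim _ two]) simp
  moreover have "ray_generator (half_line D \<inter> lattice_points) D"
    by (rule ray_of_primitive(2)[OF lat nz prim _ two]) simp
  ultimately show ?ray by blast
  show ?three
  proof
    assume "scale (of_nat 3) D \<in> B_mod TYPE('k) 3 3 window_lo window_hi"
    moreover have D3: "scale (of_nat 3) D = dgm 6 12 9 9 12 6"
      by (simp add: D_def dgm_def scale_def fun_eq_iff)
    ultimately have "dgm 6 12 9 9 12 6 \<in> B_mod TYPE('k) 3 3 window_lo window_hi" by simp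
    then obtain F and G :: "nat \<Rightarrow> nat \<Rightarrow> nat \<Rightarrow> 'k mpoly" where
      R: "resolution 3 F G" and b: "betti F = dgm 6 12 9 9 12 6" unfolding B_mod_iff by metis
    note Fb = F_of_betti[OF b]
    have s: "\<And>a. a \<in> set (F 0) \<Longrightarrow> a = 0" "set (F 1) \<subseteq> {1, 1 + 1}" "set (F 2) \<subseteq> {2, 2 + 1}" "set (F 3) \<subseteq> {4}"
      by (auto simp: Fb(2) dgm_def split: if_splits)
    have c: "count_list (F 0) 0 = 6" "count_list (F 1) 1 = 12" "count_list (F 2) 2 = 9"
      using Fb(1)[of 0 0] Fb(1)[of 1 1] Fb(1)[of 2 2] by (simp_all add: dgm_def)
    have F0: "F 0 = replicate 6 0" by (rule list_one_value[OF s(1) c(1)])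
    have "count_list (F (Suc (Suc 0))) 2 \<le> 8"
      by (rule linear_second_syzygies_bound[OF R F0])
        (use s(2-4) c(2) in \<open>simp_all add: numeral_2_eq_2 numeral_3_eq_3\<close>)
    then show False using c(3) by (simp add: numeral_2_eq_2)
  qed
qed

theorem theorem1p6:
  shows
    "(\<exists>n p dl du. 1 \<le> n \<and> degree_bounds p dl du \<and> \<not> saturated (B_mod TYPE('k::field) n p dl du)) \<and>
     (\<exists>n p dl du. 1 \<le> n \<and> degree_bounds p dl du \<and>
        infinite (B_N TYPE('k::field) n p dl du - B_mod TYPE('k::field) n p dl du)) \<and>
     (\<forall>n\<ge>1. \<exists>p dl du. degree_bounds p dl du \<and>
        (\<exists>R \<in> rays TYPE('k::field) n p dl du. \<exists>D a. ray_generator R D \<and>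
           (\<forall>m \<in> {a + 1..a + (n - 2)}. scale (of_nat m) D \<notin> B_mod TYPE('k::field) n p dl du))) \<and>
     (\<exists>n p dl du. 1 \<le> n \<and> degree_bounds p dl du \<and>
        (\<exists>R \<in> rays TYPE('k::field) n p dl du. \<exists>D a b c. ray_generator R D \<and> 1 \<le> a \<and> a < b \<and> b < c \<and>
           scale (of_nat a) D \<in> B_mod TYPE('k::field) n p dl du \<and>
           scale (of_nat b) D \<notin> B_mod TYPE('k::field) n p dl du \<and>
           scale (of_nat c) D \<in> B_mod TYPE('k::field) n p dl du))"
    (is "?unsaturated \<and> ?infinite \<and> ?missing \<and> ?nonconsecutive")
proof (intro conjI)
  show ?unsaturated
    using window not_saturated by (intro exI[of _ 3] exI[of _ window_lo] exI[of _ window_hi]) simp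
  show ?infinite
    using window infinitely_many_missing by (intro exI[of _ 3] exI[of _ window_lo] exI[of _ window_hi]) simp
  show ?missing
  proof (intro allI impI)
    fix n :: nat assume "1 \<le> n"
    then consider "n = 1" | "2 \<le> n" by linarith
    then show "\<exists>p dl du. degree_bounds p dl du \<and> (\<exists>R\<in>rays TYPE('k) n p dl du. \<exists>D a. ray_generator R D \<and>
        (\<forall>m\<in>{a + 1..a + (n - 2)}. scale (of_nat m) D \<notin> B_mod TYPE('k) n p dl du))"
    proof cases
      case 1
      \<comment> \<open>no multiple is asked for, so any ray will do\<close>
      obtain R D where R: "R \<in> rays TYPE('k) n 0 (\<lambda>_. 0) (\<lambda>_. 0)" "ray_generator R D"
        using free_ray by blast
      have "degree_bounds 0 (\<lambda>_. 0) (\<lambda>_. 0)" by (simp add: degree_bounds_def degree_sequence_def)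
      moreover have "{0 + 1..0 + (n - 2)} = ({} :: nat set)" using 1 by simp
      ultimately show ?thesis using R by (metis ball_empty)
    next
      case 2
      let ?d = "\<lambda>i. if i \<le> 1 then i else n + i - 2"
      obtain R D where R: "R \<in> rays TYPE('k) n n ?d ?d" "ray_generator R D"
        "\<forall>m\<in>{1..n - 2}. scale (of_nat m) D \<notin> B_mod TYPE('k) n n ?d ?d"
        using missing_multiples[OF 2, where 'k = 'k] by blast
      have "\<forall>m\<in>{0 + 1..0 + (n - 2)}. scale (of_nat m) D \<notin> B_mod TYPE('k) n n ?d ?d" using R(3) by simp
      then show ?thesis using degree_type_bounds[OF 2] R(1,2) by blast
    qed
  qed
  obtain R where R: "R \<in> rays TYPE('k) 3 3 window_lo window_hi" "ray_generator R (dgm 2 4 3 3 4 2)"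
    using gap_on_a_ray(1)[where 'k = 'k] by blast
  have "\<exists>D a b c. ray_generator R D \<and> 1 \<le> a \<and> a < b \<and> b < c \<and>
      scale (of_nat a) D \<in> B_mod TYPE('k) 3 3 window_lo window_hi \<and> scale (of_nat b) D \<notin> B_mod TYPE('k) 3 3 window_lo window_hi \<and>
      scale (of_nat c) D \<in> B_mod TYPE('k) 3 3 window_lo window_hi"
    by (rule exI[of _ "dgm 2 4 3 3 4 2"], rule exI[of _ 2], rule exI[of _ 3], rule exI[of _ 4])
      (use R(2) gap_on_a_ray(2-4)[where 'k = 'k] in simp)
  then show ?nonconsecutive
    by - (rule exI[of _ 3], rule exI[of _ 3], rule exI[of _ window_lo], rule exI[of _ window_hi],
        intro conjI window bexI[OF _ R(1)], simp)
qed

end
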